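(* Let $m$ be a positive integer. Then $$ \begin{aligned} -\gamma+\sum_{j=1}^{m}\frac{1}{j}={}&\frac{\pi}{3}\log m+\frac{1}{2m}-\frac{1}{4\pi m^2}+\sum_{\substack{k=1\\ k\neq m}}^{\infty}\frac{2k}{(e^{2\pi k}-1)(k^2-m^2)}\\ &+\frac{\pi}{2}\left(\frac{\log\pi-\log(2m^3)-1}{\sinh^2(\pi m)}\right)-\frac{\pi}{2}\sum_{\substack{k=1\\ k\neq m}}^{\infty}\frac{\log|k^4-m^4|}{\sinh^2(\pi k)}\\ &+\frac{1}{2m\left(e^{2\pi m}-1\right)}+2\pi\sum_{k=1}^{\infty}k\,e^{-2\pi km}\sum_{n=1}^{\infty}\frac{k^2}{n(k^2+n^2)}. \end{aligned} $$
   Context: $\gamma$ denotes Euler's constant, $\gamma=\lim_{N\to\infty}\left(\sum_{j=1}^{N}\frac1j-\log N\right)$, and $\log$ is the natural logarithm. *)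

theory Defs
  imports "HOL-Analysis.Harmonic_Numbers"
begin

end

theory Submission
  imports Defs "HOL-Analysis.Analysis" "HOL-Real_Asymp.Real_Asymp"
begin

text \<open>
  Multiply the expansions of \<open>\<pi>\<^sup>2 / sin\<^sup>2 (\<pi> w)\<close> and \<open>\<pi> coth (\<pi> w)\<close> over their poles
  and decompose each product into partial fractions. This gives the expansion of
  \<open>\<pi>\<^sup>2 / (sin\<^sup>2 (\<pi> w) (exp (2 \<pi> w) - 1))\<close> over its poles, the positive and negative
  integers (double poles) and their multiples by \<open>\<i>\<close> (simple poles). Now restrict to the ray
  \<open>w = m + \<i> y\<close> with \<open>y > 0\<close>, where \<open>sin\<^sup>2 (\<pi> w) = - sinh\<^sup>2 (\<pi> y)\<close> because \<open>m\<close> is an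
  integer, and integrate in \<open>y\<close>. The pole expansion integrates to the Digamma function, to
  \<open>2 k / (k\<^sup>2 - w\<^sup>2)\<close> and to logarithms \<open>ln |w\<^sup>4 - k\<^sup>4|\<close>. The left-hand side, expanded into
  the double series of \<open>n exp (2 \<pi> (\<i> n - j) w)\<close>, integrates to a double series that yields
  the last sum of the theorem as \<open>y \<rightarrow> 0\<close>. Both antiderivatives vanish as \<open>y \<rightarrow> \<infinity>\<close>, so they
  agree, and the theorem compares their behaviour as \<open>y \<rightarrow> 0\<close>, where both have the same
  logarithmic singularity from the pole at \<open>w = m\<close>.
\<close>

section \<open>Expansions over the poles\<close>

text \<open>Decomposing the product puts the coefficient of each pole into the form of an infinite
  sum over the poles of the other factor. These sums close up because they are again values of the
  two expansions: that of \<open>pi * coth\<close> at the integer \<open>a\<close> gives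
  \<open>1 / (exp (2 * pi * a) - 1)\<close>, that of \<open>pi^2 / sin^2\<close> at
  \<open>\<i> * a\<close> gives \<open>1 / sinh^2 (pi * a)\<close>. Along the line
  \<open>dw = \<i> dy\<close>, and only real parts are integrated. Hence logarithms occur as
  logarithms of absolute values, without branches, and the simple pole of
  \<open>2 * m / (m^2 - w^2)\<close> at \<open>w = m\<close>, being imaginary on the line, leaves
  the logarithm as the only singularity. Every part is normalised by \<open>ln |w|\<close> so as to
  vanish at infinity. That these normalisations balance amounts to the classical value
  \<open>1 / 6 - 1 / (2 * pi)\<close> of the sum of \<open>1 / sinh^2 (pi * k)\<close>; it turns the
  coefficient of \<open>log m\<close> into \<open>pi / 3\<close>. At the end point
  \<open>1 - exp (- 2 * pi * y)\<close> behaves like \<open>2 * pi * y\<close>, which gives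
  \<open>ln (2 * pi)\<close>, and the nonvanishing factors of \<open>w^4 - m^4\<close> give
  \<open>ln (4 * m^3)\<close>; together they form \<open>ln pi - ln (2 * m^3)\<close>.\<close>

lemma Digamma_reflection_complex:
  fixes z :: complex
  assumes "z \<notin> \<int>"
  shows "Digamma (1 - z) - Digamma z = of_real pi * cot (of_real pi * z)"
proof -
  have z: "z \<notin> \<int>\<^sub>\<le>\<^sub>0" "1 - z \<notin> \<int>\<^sub>\<le>\<^sub>0"
    using assms Ints_diff[of 1 "1 - z"] by auto
  have s: "sin (of_real pi * z) \<noteq> 0"
    using assms by (auto simp: sin_eq_0 mult.commute)
  \<comment> \<open>The derivative of \<open>rGamma z\<close> is
    \<open>- rGamma z * Digamma z\<close>, so the product rule produces the difference of the
    Digamma values; the reflection formula turns the same product into a sine.\<close>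
  have "((\<lambda>z. rGamma z * rGamma (1 - z)) has_field_derivative
      rGamma z * rGamma (1 - z) * (Digamma (1 - z) - Digamma z)) (at z)"
    using z by (auto intro!: derivative_eq_intros simp: algebra_simps)
  moreover have "((\<lambda>z. rGamma z * rGamma (1 - z)) has_field_derivative cos (of_real pi * z)) (at z)"
    unfolding rGamma_reflection_complex by (auto intro!: derivative_eq_intros)
  ultimately have "sin (of_real pi * z) / of_real pi * (Digamma (1 - z) - Digamma z) = cos (of_real pi * z)"
    using DERIV_unique unfolding rGamma_reflection_complex by blast
  with s show ?thesis by (simp add: cot_def field_simps)
qed

lemma Polygamma_1_reflection_complex:
  fixes z :: complex
  assumes "z \<notin> \<int>"
  shows "Polygamma 1 z + Polygamma 1 (1 - z) = (of_real pi / sin (of_real pi * z))\<^sup>2"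
proof -
  have z: "z \<notin> \<int>\<^sub>\<le>\<^sub>0" "1 - z \<notin> \<int>\<^sub>\<le>\<^sub>0"
    using assms Ints_diff[of 1 "1 - z"] by auto
  have s: "sin (of_real pi * z) \<noteq> 0"
    using assms by (auto simp: sin_eq_0 mult.commute)
  have "((\<lambda>z. Digamma (1 - z) - Digamma z) has_field_derivative
      - Polygamma 1 (1 - z) - Polygamma 1 z) (at z)"
    using z by (auto intro!: derivative_eq_intros simp: algebra_simps)
  moreover have "((\<lambda>z. Digamma (1 - z) - Digamma z) has_field_derivative
      - (of_real pi / sin (of_real pi * z))\<^sup>2) (at z)"
  proof (rule has_field_derivative_transform_within_open)
    show "open (- \<int> :: complex set)" by (simp add: closed_Ints open_Compl)
    show "z \<in> - \<int>" using assms by simp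
    show "((\<lambda>z. of_real pi * cot (of_real pi * z)) has_field_derivative
        - (of_real pi / sin (of_real pi * z))\<^sup>2) (at z)"
      by (rule derivative_eq_intros DERIV_chain2[OF DERIV_cot] s refl)+
         (use s in \<open>simp add: field_simps power2_eq_square\<close>)
    show "of_real pi * cot (of_real pi * w) = Digamma (1 - w) - Digamma w" if "w \<in> - \<int>" for w :: complex
      using Digamma_reflection_complex[of w] that by simp
  qed
  ultimately have "- Polygamma 1 (1 - z) - Polygamma 1 z = - (of_real pi / sin (of_real pi * z))\<^sup>2"
    using DERIV_unique by blast
  thus ?thesis by (simp add: algebra_simps minus_equation_iff)
qed

lemma sums_Polygamma_1:
  fixes z :: complex
  assumes "z \<noteq> 0"
  shows "(\<lambda>k. 1 / (z + of_nat k)\<^sup>2) sums Polygamma 1 z"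
  using Polygamma_LIMSEQ[of z 1] assms by (simp add: numeral_2_eq_2 inverse_eq_divide)

text \<open>In the reflection identity \<open>Polygamma 1 z\<close> carries the poles 0, -1, -2, ...
  and \<open>Polygamma 1 (1 - z)\<close> the poles 1, 2, ...; the pole 0 is split off and the others
  are paired with their negatives.\<close>

lemma csc_squared_partial_fractions:
  fixes z :: complex
  assumes "z \<notin> \<int>"
  shows "(\<lambda>k. 1 / (z - of_nat (Suc k))\<^sup>2 + 1 / (z + of_nat (Suc k))\<^sup>2) sums
           ((of_real pi / sin (of_real pi * z))\<^sup>2 - 1 / z\<^sup>2)"
proof -
  have z: "z \<noteq> 0" "1 - z \<noteq> 0" using assms by auto
  have "(\<lambda>k. 1 / (z + of_nat (Suc k))\<^sup>2) sums (Polygamma 1 z - 1 / z\<^sup>2)"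
    using sums_Polygamma_1[OF z(1)] by (subst sums_Suc_iff) simp
  from sums_add[OF sums_Polygamma_1[OF z(2)] this]
  have "(\<lambda>k. 1 / (1 - z + of_nat k)\<^sup>2 + 1 / (z + of_nat (Suc k))\<^sup>2) sums
           ((of_real pi / sin (of_real pi * z))\<^sup>2 - 1 / z\<^sup>2)"
    unfolding Polygamma_1_reflection_complex[OF assms, symmetric] by (simp add: algebra_simps)
  moreover have "(1 - z + of_nat k)\<^sup>2 = (z - of_nat (Suc k))\<^sup>2" for k
    by (simp add: power2_eq_square algebra_simps)
  ultimately show ?thesis by simp
qed

text \<open>Passing from \<open>Digamma z\<close> to \<open>Digamma (z + 1)\<close> removes the pole
  at 0. In the difference of two Digamma series the convergence terms \<open>1 / (k + 1)\<close> and
  Euler's constant cancel.\<close>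

lemma cot_partial_fractions:
  fixes z :: complex
  assumes "z \<notin> \<int>"
  shows "(\<lambda>k. 1 / (z - of_nat (Suc k)) + 1 / (z + of_nat (Suc k))) sums
           (of_real pi * cot (of_real pi * z) - 1 / z)"
proof -
  have z: "z \<noteq> 0" "1 - z \<noteq> 0" "z + 1 \<noteq> 0"
    using assms by (auto simp: add_eq_0_iff2)
  have *: "(\<lambda>k. inverse (of_nat (Suc k)) - inverse (u + of_nat k)) sums (Digamma u + euler_mascheroni)"
    if "u \<noteq> 0" for u :: complex
    using summable_Digamma[OF that] by (simp add: Digamma_def summable_sums)
  have "(\<lambda>k. inverse (z + 1 + of_nat k) - inverse (1 - z + of_nat k)) sums
          (Digamma (1 - z) - Digamma (z + 1))"
    using sums_diff[OF *[OF z(2)] *[OF z(3)]] by simp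
  also have "Digamma (1 - z) - Digamma (z + 1) = of_real pi * cot (of_real pi * z) - 1 / z"
    using Digamma_reflection_complex[OF assms] Digamma_plus1[OF z(1)] by simp
  also have "(\<lambda>k. inverse (z + 1 + of_nat k) - inverse (1 - z + of_nat k)) =
     (\<lambda>k. 1 / (z - of_nat (Suc k)) + 1 / (z + of_nat (Suc k)))"
  proof
    fix k
    have "inverse (1 - z + of_nat k) = - (1 / (z - of_nat (Suc k)))"
      by (simp add: inverse_eq_divide minus_divide_right)
    thus "inverse (z + 1 + of_nat k) - inverse (1 - z + of_nat k) =
     1 / (z - of_nat (Suc k)) + 1 / (z + of_nat (Suc k))"
      by (simp add: inverse_eq_divide add_ac)
  qed
  finally show ?thesis .
qed

text \<open>The cotangent expansion at \<open>\<i> * w\<close>, multiplied by \<open>\<i>\<close>: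
  one has \<open>\<i> * cot (\<i> * x) = coth x\<close> and
  \<open>coth (pi * w) = 1 + 2 / (exp (2 * pi * w) - 1)\<close>.\<close>

lemma coth_partial_fractions:
  fixes w :: complex
  assumes "\<i> * w \<notin> \<int>"
  shows "(\<lambda>k. 2 * w / (w\<^sup>2 + of_nat (Suc k) ^ 2)) sums
           (of_real pi + 2 * of_real pi / (exp (2 * of_real pi * w) - 1) - 1 / w)"
proof -
  have w: "w \<noteq> 0" using assms by auto
  have s: "sin (of_real pi * (\<i> * w)) \<noteq> 0"
    using assms by (auto simp: sin_eq_0 mult.commute)
  have nz: "\<i> * w - of_nat (Suc k) \<noteq> 0" "\<i> * w + of_nat (Suc k) \<noteq> 0" for k
    using assms Ints_of_nat[of "Suc k"] Ints_minus[OF Ints_of_nat[of "Suc k"]]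
    by (metis eq_iff_diff_eq_0, metis eq_neg_iff_add_eq_0)
  define E where "E = exp (of_real pi * w)"
  have E: "exp (2 * of_real pi * w) = E\<^sup>2" "E \<noteq> 0" unfolding E_def
    by (auto simp: exp_double[symmetric] mult_ac)
  have ee: "exp (\<i> * (of_real pi * (\<i> * w))) = inverse E" "exp (- (\<i> * (of_real pi * (\<i> * w)))) = E"
  proof -
    have "\<i> * (of_real pi * (\<i> * w)) = - (of_real pi * w)" by (simp add: algebra_simps)
    thus "exp (\<i> * (of_real pi * (\<i> * w))) = inverse E" "exp (- (\<i> * (of_real pi * (\<i> * w)))) = E"
      by (auto simp: E_def exp_minus)
  qed
  have c: "\<i> * cot (of_real pi * (\<i> * w)) = 1 + 2 / (E\<^sup>2 - 1)"
  proof -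
    have "E\<^sup>2 - 1 \<noteq> 0"
    proof
      assume "E\<^sup>2 - 1 = 0"
      hence "inverse E = E" using E(2) by (simp add: field_simps power2_eq_square)
      with s show False by (simp add: sin_exp_eq ee)
    qed
    moreover have "inverse E - E \<noteq> 0" using s by (simp add: sin_exp_eq ee)
    ultimately show ?thesis using E(2)
      unfolding cot_def sin_exp_eq cos_exp_eq ee by (simp add: field_simps power2_eq_square)
  qed
  have "(\<lambda>k. \<i> * (1 / (\<i> * w - of_nat (Suc k)) + 1 / (\<i> * w + of_nat (Suc k)))) sums
           (\<i> * (of_real pi * cot (of_real pi * (\<i> * w)) - 1 / (\<i> * w)))"
    by (intro sums_mult cot_partial_fractions assms)
  also have "\<i> * (of_real pi * cot (of_real pi * (\<i> * w)) - 1 / (\<i> * w)) =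
     of_real pi * (\<i> * cot (of_real pi * (\<i> * w))) - 1 / w" using w by (simp add: field_simps)
  also have "\<dots> = of_real pi + 2 * of_real pi / (exp (2 * of_real pi * w) - 1) - 1 / w"
    unfolding c E by (simp add: algebra_simps)
  also have "(\<lambda>k. \<i> * (1 / (\<i> * w - of_nat (Suc k)) + 1 / (\<i> * w + of_nat (Suc k)))) =
     (\<lambda>k. 2 * w / (w\<^sup>2 + of_nat (Suc k) ^ 2))"
  proof
    fix k
    define a :: complex where "a = of_nat (Suc k)"
    have p: "(\<i> * w - a) * (\<i> * w + a) = - (w\<^sup>2 + a\<^sup>2)"
      by (simp add: algebra_simps power2_eq_square)
    have "\<i> * (1 / (\<i> * w - a) + 1 / (\<i> * w + a)) = \<i> * (2 * (\<i> * w)) / ((\<i> * w - a) * (\<i> * w + a))"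
      using nz[of k] unfolding a_def[symmetric] by (simp add: divide_simps)
    also have "\<i> * (2 * (\<i> * w)) = - (2 * w)" by (simp add: algebra_simps)
    also have "- (2 * w) / ((\<i> * w - a) * (\<i> * w + a)) = 2 * w / (w\<^sup>2 + a\<^sup>2)"
      unfolding p by (simp only: minus_divide_divide)
    finally show "\<i> * (1 / (\<i> * w - of_nat (Suc k)) + 1 / (\<i> * w + of_nat (Suc k))) =
      2 * w / (w\<^sup>2 + of_nat (Suc k) ^ 2)" unfolding a_def .
  qed
  finally show ?thesis .
qed

section \<open>Exchange of limits and summations by domination\<close>

lemma dominated_series_tendsto:
  fixes a :: "nat \<Rightarrow> 'b \<Rightarrow> 'a :: {real_normed_algebra, banach}"
  assumes "\<And>k. (a k \<longlongrightarrow> b k) F"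
    and "eventually (\<lambda>x. \<forall>k. norm (a k x) \<le> M k) F" and "summable M" and "F \<noteq> bot"
  shows "((\<lambda>x. \<Sum>k. a k x) \<longlongrightarrow> suminf b) F" "summable b"
proof -
  have "eventually (\<lambda>(k, x). norm (a k x) \<le> M k) (sequentially \<times>\<^sub>F F)"
    using eventually_prodI[OF eventually_True assms(2), of sequentially]
    by (rule eventually_mono) auto
  from tannerys_theorem[of a b F M, OF assms(1) this assms(3,4)]
  show "((\<lambda>x. \<Sum>k. a k x) \<longlongrightarrow> suminf b) F" "summable b"
    using summable_norm_cancel[of b] by auto
qed

text \<open>The sum of the first \<open>N\<close> rows is computed columnwise, and Tannery's theorem
  with the majorant \<open>suminf f * g b\<close> lets \<open>N\<close> tend to infinity. Row and
  column sums are parameters because both are later known in closed form.\<close>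

lemma sums_swap:
  fixes X :: "nat \<Rightarrow> nat \<Rightarrow> complex"
  assumes bound: "\<And>a b. norm (X a b) \<le> f a * g b"
    and f: "summable f" "\<And>a. f a \<ge> 0" and g: "summable g" "\<And>b. g b \<ge> 0"
    and rows: "\<And>a. X a sums R a" and columns: "\<And>b. (\<lambda>a. X a b) sums S b"
  shows "R sums suminf S" "summable S"
proof -
  have bound': "norm (\<Sum>a<N. X a b) \<le> suminf f * g b" for N b
  proof -
    have "norm (\<Sum>a<N. X a b) \<le> (\<Sum>a<N. f a * g b)"
      by (intro sum_norm_le bound)
    also have "\<dots> \<le> suminf f * g b" unfolding sum_distrib_right[symmetric]
      by (intro mult_right_mono sum_le_suminf f g) auto
    finally show ?thesis .
  qed
  have "\<And>b. ((\<lambda>N. \<Sum>a<N. X a b) \<longlongrightarrow> S b) sequentially" using columns by (simp add: sums_def)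
  note T = dominated_series_tendsto[OF this, where M = "\<lambda>b. suminf f * g b"]
  have T: "(\<lambda>N. \<Sum>b. \<Sum>a<N. X a b) \<longlonglongrightarrow> suminf S" "summable S"
    using T bound' g by (auto simp: summable_mult)
  show "summable S" by fact
  have "(\<Sum>b. \<Sum>a<N. X a b) = (\<Sum>a<N. R a)" for N
    using rows by (subst suminf_sum) (auto simp: sums_iff)
  with T show "R sums suminf S" by (simp add: sums_def)
qed

section \<open>The product of the two expansions, decomposed into partial fractions\<close>

lemma lattice_sum_inverse_squares:
  fixes a :: nat
  assumes "a \<ge> 1"
  shows "(\<lambda>b. 2 * (of_nat a ^ 2 - of_nat (Suc b) ^ 2) / (of_nat a ^ 2 + of_nat (Suc b) ^ 2)\<^sup>2) sums
           (of_real ((pi / sinh (pi * real a))\<^sup>2) - 1 / of_nat a ^ 2 :: complex)"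
proof -
  \<comment> \<open>At this point the expansion of \<open>pi^2 / sin^2\<close> becomes, up to sign,
    the required real series, because \<open>sin (pi * z) = \<i> * sinh (pi * a)\<close>.\<close>
  define z where "z = \<i> * of_nat a"
  have z: "z \<notin> \<int>" using assms by (auto simp: z_def complex_is_Int_iff)
  have "sin (of_real pi * z) = \<i> * of_real (sinh (pi * real a))"
    by (simp add: z_def sinh_field_def sin_exp_eq exp_of_real[symmetric] field_simps)
  hence val: "(of_real pi / sin (of_real pi * z))\<^sup>2 - 1 / z\<^sup>2 =
      - (of_real ((pi / sinh (pi * real a))\<^sup>2) - 1 / of_nat a ^ 2)"
    by (simp add: z_def power_mult_distrib power_divide)
  have terms: "1 / (z - of_nat (Suc b))\<^sup>2 + 1 / (z + of_nat (Suc b))\<^sup>2 =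
     - (2 * (of_nat a ^ 2 - of_nat (Suc b) ^ 2) / (of_nat a ^ 2 + of_nat (Suc b) ^ 2)\<^sup>2)" for b
  proof -
    define c :: complex where "c = of_nat (Suc b)"
    have c: "z - c \<noteq> 0" "z + c \<noteq> 0"
      using assms by (auto simp: z_def c_def complex_eq_iff)
    have p: "(z - c) * (z + c) = - (of_nat a ^ 2 + c ^ 2)"
      by (simp add: z_def algebra_simps power2_eq_square)
    have "1 / (z - c)\<^sup>2 + 1 / (z + c)\<^sup>2 = ((z + c)\<^sup>2 + (z - c)\<^sup>2) / ((z - c) * (z + c))\<^sup>2"
      using c by (simp add: add_frac_eq power_mult_distrib)
    also have "(z + c)\<^sup>2 + (z - c)\<^sup>2 = - (2 * (of_nat a ^ 2 - c\<^sup>2))"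
      by (simp add: z_def algebra_simps power2_eq_square)
    finally have "1 / (z - c)\<^sup>2 + 1 / (z + c)\<^sup>2 = - (2 * (of_nat a ^ 2 - c\<^sup>2)) / (of_nat a ^ 2 + c\<^sup>2)\<^sup>2"
      unfolding p power2_minus .
    thus ?thesis by (simp only: c_def minus_divide_left)
  qed
  have "(\<lambda>b. - (2 * (of_nat a ^ 2 - of_nat (Suc b) ^ 2) / (of_nat a ^ 2 + of_nat (Suc b) ^ 2)\<^sup>2)) sums
           - (of_real ((pi / sinh (pi * real a))\<^sup>2) - 1 / of_nat a ^ 2 :: complex)"
    using csc_squared_partial_fractions[OF z] unfolding val terms .
  from sums_minus[OF this] show ?thesis by simp
qed

text \<open>The first product on the right multiplies the term of \<open>pi^2 / sin^2\<close> at the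
  poles \<open>a\<close>, \<open>-a\<close> by the term of \<open>pi * coth\<close> at
  \<open>\<i> * b\<close>, \<open>- \<i> * b\<close>. Its partial fractions have double and simple
  poles at the former and simple poles at the latter. The identity is solved for the part with the
  imaginary poles, the one whose order of summation is reversed.\<close>

lemma partial_fraction_product:
  fixes w a b :: complex
  assumes "w - a \<noteq> 0" "w + a \<noteq> 0" "w\<^sup>2 + b\<^sup>2 \<noteq> 0" "a\<^sup>2 + b\<^sup>2 \<noteq> 0"
  shows "2 * (a\<^sup>2 - b\<^sup>2) / (a\<^sup>2 + b\<^sup>2)\<^sup>2 * (2 * w / (w\<^sup>2 + b\<^sup>2)) =
    (1 / (w - a)\<^sup>2 + 1 / (w + a)\<^sup>2) * (2 * w / (w\<^sup>2 + b\<^sup>2))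
    - 2 * a / (a\<^sup>2 + b\<^sup>2) * (4 * w * a / (w\<^sup>2 - a\<^sup>2)\<^sup>2)
    + 2 * (a\<^sup>2 - b\<^sup>2) / (a\<^sup>2 + b\<^sup>2)\<^sup>2 * (2 * w / (w\<^sup>2 - a\<^sup>2))"
proof -
  define x where "x = w\<^sup>2 - a\<^sup>2"
  define y where "y = w\<^sup>2 + b\<^sup>2"
  define s where "s = a\<^sup>2 + b\<^sup>2"
  have x: "x = (w - a) * (w + a)" unfolding x_def by (simp add: power2_eq_square algebra_simps)
  have nz: "x \<noteq> 0" "y \<noteq> 0" "s \<noteq> 0" using assms by (auto simp: x y_def s_def)
  have p: "1 / (w - a)\<^sup>2 + 1 / (w + a)\<^sup>2 = 2 * (w\<^sup>2 + a\<^sup>2) / x\<^sup>2"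
    using assms by (simp add: x add_frac_eq power_mult_distrib) (simp add: power2_eq_square algebra_simps)
  \<comment> \<open>By this relation \<open>1 / y - 1 / x = - s / (x * y)\<close>, which cancels one
    factor \<open>s\<close>; then \<open>e1\<close> and \<open>e2\<close> have a common denominator
    and, by \<open>e3\<close>, equal numerators.\<close>
  have "s = y - x" by (simp add: x_def y_def s_def)
  hence e1: "2 * (a\<^sup>2 - b\<^sup>2) / s\<^sup>2 * (2 * w / y) - 2 * (a\<^sup>2 - b\<^sup>2) / s\<^sup>2 * (2 * w / x) =
        4 * w * (- ((a\<^sup>2 - b\<^sup>2) * x)) / (s * x\<^sup>2 * y)"
    using nz by (simp add: divide_simps) (simp add: algebra_simps power2_eq_square)
  have e2: "2 * (w\<^sup>2 + a\<^sup>2) / x\<^sup>2 * (2 * w / y) - 2 * a / s * (4 * w * a / x\<^sup>2) =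
      4 * w * ((w\<^sup>2 + a\<^sup>2) * s - 2 * a\<^sup>2 * y) / (s * x\<^sup>2 * y)"
    using nz by (simp add: divide_simps) (simp add: algebra_simps power2_eq_square)
  have e3: "(w\<^sup>2 + a\<^sup>2) * s - 2 * a\<^sup>2 * y = - ((a\<^sup>2 - b\<^sup>2) * x)"
    by (simp add: x_def y_def s_def algebra_simps power2_eq_square)
  show ?thesis unfolding p x_def[symmetric] y_def[symmetric] s_def[symmetric]
    using e1 e2[unfolded e3] by (metis diff_add_cancel)
qed

text \<open>The terms of the product in which one of the two poles is 0.\<close>

lemma partial_fraction_diagonal:
  fixes w a :: complex
  assumes "w - a \<noteq> 0" "w + a \<noteq> 0" "w\<^sup>2 + a\<^sup>2 \<noteq> 0" "w \<noteq> 0" "a \<noteq> 0"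
  shows "4 * w * a / (w\<^sup>2 - a\<^sup>2)\<^sup>2 / a - (2 * w / (w\<^sup>2 - a\<^sup>2) + 2 * w / (w\<^sup>2 + a\<^sup>2)) / a\<^sup>2 =
    2 * w / (w\<^sup>2 + a\<^sup>2) / w\<^sup>2 + (1 / (w - a)\<^sup>2 + 1 / (w + a)\<^sup>2) / w - 4 / w * (1 / a\<^sup>2)"
proof -
  define x where "x = w\<^sup>2 - a\<^sup>2"
  define z where "z = w\<^sup>2 + a\<^sup>2"
  have x: "x = (w - a) * (w + a)" unfolding x_def by (simp add: power2_eq_square algebra_simps)
  have nz: "x \<noteq> 0" "z \<noteq> 0" using assms by (auto simp: x z_def)
  have p: "1 / (w - a)\<^sup>2 + 1 / (w + a)\<^sup>2 = 2 * z / x\<^sup>2"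
    using assms by (simp add: x z_def add_frac_eq power_mult_distrib) (simp add: power2_eq_square algebra_simps)
  have "(4 * w * a / x\<^sup>2 / a - (2 * w / x + 2 * w / z) / a\<^sup>2) -
        (2 * w / z / w\<^sup>2 + 2 * z / x\<^sup>2 / w - 4 / w * (1 / a\<^sup>2)) =
    2 * (2 * w\<^sup>2 * a\<^sup>2 * z - w\<^sup>2 * x * z - w\<^sup>2 * x\<^sup>2 - x\<^sup>2 * a\<^sup>2 - z\<^sup>2 * a\<^sup>2 + 2 * x\<^sup>2 * z) / (w * x\<^sup>2 * z * a\<^sup>2)"
    using nz assms by (simp add: divide_simps) (simp add: algebra_simps power2_eq_square)
  also have "2 * w\<^sup>2 * a\<^sup>2 * z - w\<^sup>2 * x * z - w\<^sup>2 * x\<^sup>2 - x\<^sup>2 * a\<^sup>2 - z\<^sup>2 * a\<^sup>2 + 2 * x\<^sup>2 * z = 0"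
    unfolding x_def z_def by algebra
  finally show ?thesis unfolding p x_def[symmetric] z_def[symmetric] by simp
qed

text \<open>The terms with \<open>1 / w^3\<close>, \<open>1 / w^2\<close> and \<open>1 / w\<close>
  are the principal part at 0. At \<open>w = -k\<close> one has \<open>1 / (exp (- 2 * pi * k) - 1)
  = - 1 - 1 / (exp (2 * pi * k) - 1)\<close>: the second summand makes the double poles at
  \<open>k\<close> and \<open>-k\<close> antisymmetric, and the extra \<open>-1\<close> leaves
  double poles at the negative integers, collected in \<open>Polygamma 1 (w + 1)\<close>. At all of
  the points \<open>k\<close>, \<open>-k\<close>, \<open>\<i> * k\<close> and
  \<open>- \<i> * k\<close> the residue is \<open>- pi^2 / sinh^2 (pi * k)\<close>.\<close>

lemma cosecant_coth_expansion:
  fixes w :: complex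
  assumes "w \<notin> \<int>" "\<i> * w \<notin> \<int>"
  shows "(\<lambda>k. of_real (2 * pi / (exp (2 * pi * real (Suc k)) - 1)) *
              (4 * w * of_nat (Suc k) / (w\<^sup>2 - of_nat (Suc k) ^ 2)\<^sup>2) -
            of_real ((pi / sinh (pi * real (Suc k)))\<^sup>2) *
              (2 * w / (w\<^sup>2 - of_nat (Suc k) ^ 2) + 2 * w / (w\<^sup>2 + of_nat (Suc k) ^ 2)))
    sums ((of_real pi / sin (of_real pi * w))\<^sup>2 * (2 * of_real pi / (exp (2 * of_real pi * w) - 1))
       - 1 / w ^ 3 - 2 * of_real pi ^ 2 / (3 * w) + of_real pi / w\<^sup>2
       + 2 * of_real pi * Polygamma 1 (w + 1))"
proof -
  define A :: "nat \<Rightarrow> complex" where "A k = of_nat (Suc k)" for k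
  define c :: "nat \<Rightarrow> complex" where "c k = of_real (2 * pi / (exp (2 * pi * real (Suc k)) - 1))" for k
  define s :: "nat \<Rightarrow> complex" where "s k = of_real ((pi / sinh (pi * real (Suc k)))\<^sup>2)" for k
  define P1 where "P1 = (of_real pi / sin (of_real pi * w))\<^sup>2"
  define P2 where "P2 = 2 * of_real pi / (exp (2 * of_real pi * w) - 1)"
  define p where "p k = 1 / (w - A k)\<^sup>2 + 1 / (w + A k)\<^sup>2" for k
  define q where "q k = 2 * w / (w\<^sup>2 + (A k)\<^sup>2)" for k
  define r where "r k = 4 * w * A k / (w\<^sup>2 - (A k)\<^sup>2)\<^sup>2" for k
  define u where "u k = 2 * w / (w\<^sup>2 - (A k)\<^sup>2)" for k
  define d where "d a b = 2 * ((A a)\<^sup>2 - (A b)\<^sup>2) / ((A a)\<^sup>2 + (A b)\<^sup>2)\<^sup>2" for a b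
  have w0: "w \<noteq> 0" using assms by auto
  have A0: "A k \<noteq> 0" for k unfolding A_def by (simp del: of_nat_Suc)
  have sq0: "(A a)\<^sup>2 + (A b)\<^sup>2 \<noteq> 0" for a b
  proof -
    have "(A a)\<^sup>2 + (A b)\<^sup>2 = of_real (real (Suc a)^2 + real (Suc b)^2)" by (simp add: A_def)
    also have "\<dots> \<noteq> 0" unfolding of_real_eq_0_iff by (simp add: sum_power2_eq_zero_iff)
    finally show ?thesis .
  qed
  have wm: "w - A k \<noteq> 0" and wp: "w + A k \<noteq> 0" for k
    using assms(1) Ints_of_nat[of "Suc k"] Ints_minus[OF Ints_of_nat[of "Suc k"]] unfolding A_def
    by (metis eq_iff_diff_eq_0, metis eq_neg_iff_add_eq_0)
  have wq: "w\<^sup>2 + (A k)\<^sup>2 \<noteq> 0" for k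
  proof
    assume "w\<^sup>2 + (A k)\<^sup>2 = 0"
    hence "(\<i> * w - A k) * (\<i> * w + A k) = 0" by (simp add: algebra_simps power2_eq_square minus_equation_iff add_eq_0_iff2)
    hence "\<i> * w = A k \<or> \<i> * w = - A k" by (auto simp: eq_neg_iff_add_eq_0)
    thus False using assms(2) unfolding A_def by (metis Ints_minus Ints_of_nat)
  qed

  have p_sums: "p sums (P1 - 1 / w\<^sup>2)"
    using csc_squared_partial_fractions[OF assms(1)] unfolding p_def A_def P1_def .
  have q_sums: "q sums (of_real pi + P2 - 1 / w)"
    using coth_partial_fractions[OF assms(2)] unfolding q_def A_def P2_def .
  have coth_sums: "(\<lambda>b. 2 * A a / ((A a)\<^sup>2 + (A b)\<^sup>2)) sums (of_real pi + c a - 1 / A a)" for a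
  proof -
    have "\<i> * of_nat (Suc a) \<notin> \<int>" by (simp add: complex_is_Int_iff)
    from coth_partial_fractions[OF this] show ?thesis
      unfolding A_def c_def by (simp add: exp_of_real[symmetric])
  qed
  have d_sums: "d a sums (s a - 1 / (A a)\<^sup>2)" for a
    using lattice_sum_inverse_squares[of "Suc a"] unfolding d_def s_def A_def by simp
  have d_anti: "d a b = - d b a" for a b
    unfolding d_def minus_divide_left by (simp add: add.commute)
  have d_bound: "norm (d a b) \<le> 2 * (1 / real (Suc a) ^ 2)" for a b
  proof -
    define x where "x = real (Suc a) ^ 2"
    define y where "y = real (Suc b) ^ 2"
    have xy: "x > 0" "y > 0" by (auto simp: x_def y_def)
    have "d a b = of_real (2 * (x - y) / (x + y)\<^sup>2)" by (simp add: d_def A_def x_def y_def)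
    hence "norm (d a b) = \<bar>2 * (x - y) / (x + y)\<^sup>2\<bar>" by (simp only: norm_of_real)
    also have "\<dots> = 2 * \<bar>x - y\<bar> / (x + y)\<^sup>2" by (simp only: abs_mult abs_divide abs_numeral abs_power2)
    also have "\<dots> \<le> 2 * (x + y) / (x + y)\<^sup>2" using xy by (intro divide_right_mono) (auto simp: abs_if)
    also have "\<dots> = 2 * (1 / (x + y))"
    proof -
      have "2 * t / t\<^sup>2 = 2 * (1 / t)" for t :: real by (simp add: power2_eq_square)
      thus ?thesis .
    qed
    also have "\<dots> \<le> 2 * (1 / x)" using xy by (intro mult_left_mono divide_left_mono) auto
    finally show ?thesis by (simp add: x_def)
  qed
  have sq_summable: "summable (\<lambda>k. 1 / real (Suc k) ^ 2)"
    using inverse_squares_sums by (simp add: sums_iff add.commute)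

  obtain C where C: "C > 0" "\<And>b. norm (q b) \<le> C * (1 / real (Suc b) ^ 2)"
  proof -
    have "(\<lambda>b. 2 * w * inverse (w\<^sup>2 * (inverse (A b))\<^sup>2 + 1)) \<longlonglongrightarrow> 2 * w * inverse (w\<^sup>2 * 0\<^sup>2 + 1)"
      unfolding A_def by (intro tendsto_intros LIMSEQ_Suc[OF lim_inverse_n]) simp
    also have "(\<lambda>b. 2 * w * inverse (w\<^sup>2 * (inverse (A b))\<^sup>2 + 1)) = (\<lambda>b. q b * (A b)\<^sup>2)"
    proof
      fix b
      have "w\<^sup>2 * (inverse (A b))\<^sup>2 + 1 = (w\<^sup>2 + (A b)\<^sup>2) / (A b)\<^sup>2"
        using A0[of b] by (simp add: field_simps)
      thus "2 * w * inverse (w\<^sup>2 * (inverse (A b))\<^sup>2 + 1) = q b * (A b)\<^sup>2"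
        by (simp add: q_def)
    qed
    finally have "Bseq (\<lambda>b. q b * (A b)\<^sup>2)" by (rule convergent_imp_Bseq[OF convergentI])
    then obtain C where "C > 0" "\<And>b. norm (q b * (A b)\<^sup>2) \<le> C" by (auto elim: BseqE)
    moreover have "norm (q b * (A b)\<^sup>2) = norm (q b) * real (Suc b) ^ 2" for b
      by (simp add: norm_mult norm_power A_def del: of_nat_Suc)
    ultimately show thesis by (intro that[of C]) (auto simp: field_simps simp del: of_nat_Suc)
  qed

  \<comment> \<open>Only the part carried by the poles \<open>\<i> b\<close> has to be summed over \<open>a\<close> first; it is dominated by
    \<open>1 / (a\<^sup>2 b\<^sup>2)\<close>. The other parts are summed over \<open>b\<close> first, where they need not be
    exchanged.\<close>
  define R where "R a = p a * (of_real pi + P2 - 1 / w) - (of_real pi + c a - 1 / A a) * r a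
      + (s a - 1 / (A a)\<^sup>2) * u a" for a
  have rows: "(\<lambda>b. d a b * q b) sums R a" for a
  proof -
    have "(\<lambda>b. d a b * q b) = (\<lambda>b. p a * q b - 2 * A a / ((A a)\<^sup>2 + (A b)\<^sup>2) * r a + d a b * u a)"
      unfolding d_def p_def q_def r_def u_def
      by (intro ext partial_fraction_product wm wp wq sq0)
    also have "\<dots> sums R a" unfolding R_def
      by (intro sums_add sums_diff sums_mult sums_mult2 q_sums coth_sums d_sums)
    finally show ?thesis .
  qed
  \<comment> \<open>Since \<open>d\<close> is antisymmetric, its column sums are the negatives of
    its row sums, which are known; \<open>q b\<close> is a constant factor here.\<close>
  have columns: "(\<lambda>a. d a b * q b) sums (- (s b - 1 / (A b)\<^sup>2) * q b)" for b
    using sums_mult2[OF sums_minus[OF d_sums[of b]], of "q b"] by (subst d_anti) simp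
  have bound: "norm (d a b * q b) \<le> 2 * (1 / real (Suc a) ^ 2) * (C * (1 / real (Suc b) ^ 2))" for a b
    unfolding norm_mult by (intro mult_mono d_bound C) auto
  have "R sums (\<Sum>b. - (s b - 1 / (A b)\<^sup>2) * q b)" "summable (\<lambda>b. - (s b - 1 / (A b)\<^sup>2) * q b)"
    by (rule sums_swap[OF bound summable_mult[OF sq_summable] _ summable_mult[OF sq_summable] _ rows columns];
        use C(1) in simp)+
  \<comment> \<open>Row and column summation give the same total, so the termwise difference of the
    two series sums to 0 and the total itself drops out.\<close>
  hence Z: "(\<lambda>a. R a - - (s a - 1 / (A a)\<^sup>2) * q a) sums 0"
    using sums_diff[OF _ summable_sums] by fastforce
  have PG: "(\<lambda>a. 2 * of_real pi * (1 / (w + 1 + of_nat a)\<^sup>2)) sums (2 * of_real pi * Polygamma 1 (w + 1))"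
    using wp[of 0] by (intro sums_mult sums_Polygamma_1) (simp add: A_def)
  have SQ: "(\<lambda>a. 1 / (A a)\<^sup>2) sums (of_real pi ^ 2 / 6)"
    using sums_of_real[OF inverse_squares_sums, where 'a = complex] by (simp add: A_def add.commute)
  \<comment> \<open>The combination is chosen so that \<open>R a\<close> cancels:
    \<open>pi * p a\<close> and the Polygamma terms absorb \<open>pi * r a\<close>, and
    \<open>partial_fraction_diagonal\<close> absorbs the corrections \<open>1 / A a\<close> and
    \<open>1 / (A a)^2\<close>. What remains is
    \<open>c a * r a - s a * (u a + q a)\<close>.\<close>
  have "(\<lambda>a. p a * (of_real pi + P2 - 1 / w) - of_real pi * p a
        + 2 * of_real pi * (1 / (w + 1 + of_nat a)\<^sup>2)
        + (q a / w\<^sup>2 + p a / w - 4 / w * (1 / (A a)\<^sup>2)) - (R a - - (s a - 1 / (A a)\<^sup>2) * q a))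
     sums ((P1 - 1 / w\<^sup>2) * (of_real pi + P2 - 1 / w) - of_real pi * (P1 - 1 / w\<^sup>2)
        + 2 * of_real pi * Polygamma 1 (w + 1)
        + ((of_real pi + P2 - 1 / w) / w\<^sup>2 + (P1 - 1 / w\<^sup>2) / w - 4 / w * (of_real pi ^ 2 / 6)) - 0)"
    by (rule sums_diff[OF sums_add[OF sums_add[OF
          sums_diff[OF sums_mult2[OF p_sums] sums_mult[OF p_sums]] PG]
          sums_diff[OF sums_add[OF sums_divide[OF q_sums] sums_divide[OF p_sums]] sums_mult[OF SQ]]] Z])
  also have "(\<lambda>a. p a * (of_real pi + P2 - 1 / w) - of_real pi * p a
        + 2 * of_real pi * (1 / (w + 1 + of_nat a)\<^sup>2)
        + (q a / w\<^sup>2 + p a / w - 4 / w * (1 / (A a)\<^sup>2)) - (R a - - (s a - 1 / (A a)\<^sup>2) * q a)) =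
     (\<lambda>a. c a * r a - s a * (u a + q a))"
  proof
    fix a
    have r: "r a = p a - 2 * (1 / (w + 1 + of_nat a)\<^sup>2)"
    proof -
      have "p a - 2 * (1 / (w + A a)\<^sup>2) = 1 / (w - A a)\<^sup>2 - 1 / (w + A a)\<^sup>2" by (simp add: p_def)
      also have "\<dots> = ((w + A a)\<^sup>2 - (w - A a)\<^sup>2) / ((w - A a) * (w + A a))\<^sup>2"
        using wm[of a] wp[of a] by (simp add: diff_frac_eq power_mult_distrib)
      also have "\<dots> = r a" unfolding r_def by (simp add: power2_eq_square algebra_simps)
      finally show ?thesis by (simp add: A_def add_ac)
    qed
    have diag: "r a / A a - (u a + q a) / (A a)\<^sup>2 = q a / w\<^sup>2 + p a / w - 4 / w * (1 / (A a)\<^sup>2)"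
      unfolding r_def u_def q_def p_def by (intro partial_fraction_diagonal wm wp wq w0 A0)
    show "p a * (of_real pi + P2 - 1 / w) - of_real pi * p a
        + 2 * of_real pi * (1 / (w + 1 + of_nat a)\<^sup>2)
        + (q a / w\<^sup>2 + p a / w - 4 / w * (1 / (A a)\<^sup>2)) - (R a - - (s a - 1 / (A a)\<^sup>2) * q a) =
        c a * r a - s a * (u a + q a)"
    proof -
      have "of_real pi * p a - 2 * of_real pi * (1 / (w + 1 + of_nat a)\<^sup>2) = of_real pi * r a"
        unfolding r by (simp add: algebra_simps)
      thus ?thesis unfolding R_def diag[symmetric] by (simp add: algebra_simps add_divide_distrib)
    qed
  qed
  also have "(P1 - 1 / w\<^sup>2) * (of_real pi + P2 - 1 / w) - of_real pi * (P1 - 1 / w\<^sup>2)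
        + 2 * of_real pi * Polygamma 1 (w + 1)
        + ((of_real pi + P2 - 1 / w) / w\<^sup>2 + (P1 - 1 / w\<^sup>2) / w - 4 / w * (of_real pi ^ 2 / 6)) - 0 =
     P1 * P2 - 1 / w ^ 3 - 2 * of_real pi ^ 2 / (3 * w) + of_real pi / w\<^sup>2
       + 2 * of_real pi * Polygamma 1 (w + 1)"
    using w0 by (simp add: field_simps power2_eq_square power3_eq_cube)
  finally show ?thesis unfolding c_def r_def s_def u_def q_def P1_def P2_def A_def .
qed

section \<open>The terms of the expansion on a vertical line\<close>

text \<open>The majorant may depend on \<open>\<delta>\<close> and blow up as
  \<open>\<delta>\<close> tends to 0, as it must for terms that are singular at
  \<open>y = 0\<close>. For the derivative at \<open>y\<close> the ray starting at
  \<open>y / 2\<close> suffices.\<close>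

lemma has_real_derivative_suminf_pos:
  fixes f f' :: "nat \<Rightarrow> real \<Rightarrow> real"
  assumes deriv: "\<And>k y. y > 0 \<Longrightarrow> (f k has_real_derivative f' k y) (at y)"
    and bound: "\<And>\<delta>. \<delta> > 0 \<Longrightarrow> \<exists>M. summable M \<and> (\<forall>k. \<forall>y\<ge>\<delta>. \<bar>f' k y\<bar> \<le> M k)"
    and summable: "\<And>y. y > 0 \<Longrightarrow> summable (\<lambda>k. f k y)"
    and "y > 0"
  shows "((\<lambda>y. \<Sum>k. f k y) has_real_derivative (\<Sum>k. f' k y)) (at y)"
proof (rule has_field_derivative_series'(2)[where f = f and f' = f' and S = "{y / 2..}" and ?x0.0 = y])
  obtain M where M: "summable M" "\<And>k t. t \<ge> y / 2 \<Longrightarrow> \<bar>f' k t\<bar> \<le> M k"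
    using bound[OF half_gt_zero[OF \<open>y > 0\<close>]] by blast
  show "uniformly_convergent_on {y / 2..} (\<lambda>n x. \<Sum>i<n. f' i x)"
    by (rule Weierstrass_m_test'[OF _ M(1)]) (simp add: M(2))
  show "convex {y / 2..}" by simp
  show "y \<in> {y / 2..}" "y \<in> interior {y / 2..}" using \<open>y > 0\<close> by auto
  show "(f n has_real_derivative f' n x) (at x within {y / 2..})" if "x \<in> {y / 2..}" for n x
    using that \<open>y > 0\<close> by (intro has_field_derivative_at_within[OF deriv]) auto
qed (rule summable[OF \<open>y > 0\<close>])

definition vline :: "nat \<Rightarrow> real \<Rightarrow> complex" where
  "vline m y = Complex (real m) y"

lemma Re_vline [simp]: "Re (vline m y) = real m" and Im_vline [simp]: "Im (vline m y) = y"
  by (simp_all add: vline_def)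

lemma vline_eq: "vline m y = of_nat m + \<i> * of_real y"
  by (simp add: complex_eq_iff)

text \<open>The factor \<open>\<i>\<close> is \<open>dw / dy\<close> on the vertical line; it
  accompanies every derivative below.\<close>

lemma has_real_derivative_Re_vline:
  assumes "(g has_field_derivative g') (at (vline m y))"
  shows "((\<lambda>y. Re (g (vline m y))) has_real_derivative Re (\<i> * g')) (at y)"
proof -
  have "(vline m has_derivative (\<lambda>t. \<i> * of_real t)) (at y)"
    unfolding vline_eq
    using has_derivative_add[OF has_derivative_const[of "of_nat m :: complex"]
        has_derivative_mult_right[OF has_derivative_of_real[OF has_derivative_ident], of \<i>]] by simp
  from has_derivative_compose[OF this assms[unfolded has_field_derivative_def]]
  have "((\<lambda>y. g (vline m y)) has_derivative (\<lambda>t. g' * (\<i> * of_real t))) (at y)" .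
  from has_derivative_Re[OF this] show ?thesis
    by (rule has_derivative_imp_has_field_derivative) simp
qed

text \<open>\<open>ln (norm (w - z))\<close> is the real part of any branch of
  \<open>ln (w - z)\<close>, but it has no cut and is differentiable along the whole line off
  \<open>z\<close>.\<close>

lemma has_real_derivative_ln_norm_vline:
  assumes "vline m y \<noteq> z"
  shows "((\<lambda>y. ln (norm (vline m y - z))) has_real_derivative Re (\<i> * (1 / (vline m y - z)))) (at y)"
proof -
  have pos: "(real m - Re z)\<^sup>2 + (y - Im z)\<^sup>2 > 0"
    using assms by (auto simp: sum_power2_gt_zero_iff complex_eq_iff)
  have "((\<lambda>y. ln (sqrt ((real m - Re z)\<^sup>2 + (y - Im z)\<^sup>2))) has_real_derivative
      (y - Im z) / ((real m - Re z)\<^sup>2 + (y - Im z)\<^sup>2)) (at y)"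
  proof (rule DERIV_cong)
    have gen: "inverse s * (inverse s / 2 * (2 * t)) = t / (s * s)" for s t :: real
      by (simp add: field_simps)
    show "((\<lambda>y. ln (sqrt ((real m - Re z)\<^sup>2 + (y - Im z)\<^sup>2))) has_real_derivative
      inverse (sqrt ((real m - Re z)\<^sup>2 + (y - Im z)\<^sup>2)) *
      (inverse (sqrt ((real m - Re z)\<^sup>2 + (y - Im z)\<^sup>2)) / 2 * (2 * (y - Im z)))) (at y)"
      using pos by (auto intro!: derivative_eq_intros simp: field_simps)
    show "inverse (sqrt ((real m - Re z)\<^sup>2 + (y - Im z)\<^sup>2)) *
      (inverse (sqrt ((real m - Re z)\<^sup>2 + (y - Im z)\<^sup>2)) / 2 * (2 * (y - Im z))) =
      (y - Im z) / ((real m - Re z)\<^sup>2 + (y - Im z)\<^sup>2)"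
      using gen[of "sqrt ((real m - Re z)\<^sup>2 + (y - Im z)\<^sup>2)" "y - Im z"]
      unfolding real_sqrt_mult_self abs_of_pos[OF pos] .
  qed
  moreover have "(y - Im z) / ((real m - Re z)\<^sup>2 + (y - Im z)\<^sup>2) = Re (\<i> * (1 / (vline m y - z)))"
    by (simp add: Re_divide)
  ultimately show ?thesis by (simp add: cmod_def)
qed

section \<open>The weights of the poles, and the integrated terms with their derivatives and
  bounds\<close>

definition BE_weight :: "nat \<Rightarrow> real" where
  "BE_weight k = 2 / (exp (2 * pi * real k) - 1)"

text \<open>Like \<open>BE_weight\<close>, which has the Bose-Einstein form
  \<open>1 / (exp x - 1)\<close>, this is a coefficient of the pole expansion divided by
  \<open>pi\<close>. At index 0 both have a zero denominator and hence the value 0, so a series over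
  all natural numbers effectively starts at 1.\<close>

definition sinh_weight :: "nat \<Rightarrow> real" where
  "sinh_weight k = pi / (sinh (pi * real k))\<^sup>2"

lemma BE_weight_nonneg: "BE_weight k \<ge> 0" and sinh_weight_nonneg: "sinh_weight k \<ge> 0"
  by (simp_all add: BE_weight_def sinh_weight_def)

lemma summable_BE_weight: "summable BE_weight"
proof (rule summable_comparison_test_bigo)
  show "summable (\<lambda>k. norm (1 / real k ^ 2))"
    using inverse_power_summable[of 2, where 'a = real] by (simp add: inverse_eq_divide)
  show "BE_weight \<in> O(\<lambda>k. 1 / real k ^ 2)"
    unfolding BE_weight_def by real_asymp
qed

lemma summable_sinh_weight_mult: "summable (\<lambda>k. sinh_weight k * real k)"
proof (rule summable_comparison_test_bigo)
  show "summable (\<lambda>k. norm (1 / real k ^ 2))"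
    using inverse_power_summable[of 2, where 'a = real] by (simp add: inverse_eq_divide)
  show "(\<lambda>k. sinh_weight k * real k) \<in> O(\<lambda>k. 1 / real k ^ 2)"
    unfolding sinh_weight_def by real_asymp
qed

lemma summable_sinh_weight: "summable sinh_weight"
proof (rule summable_comparison_test_bigo)
  show "summable (\<lambda>k. norm (1 / real k ^ 2))"
    using inverse_power_summable[of 2, where 'a = real] by (simp add: inverse_eq_divide)
  show "sinh_weight \<in> O(\<lambda>k. 1 / real k ^ 2)"
    unfolding sinh_weight_def by real_asymp
qed

definition pole_term :: "nat \<Rightarrow> nat \<Rightarrow> real \<Rightarrow> real" where
  "pole_term m k y = Re (2 * of_nat k / (of_nat k ^ 2 - (vline m y)\<^sup>2))"

text \<open>This is \<open>ln |w^4 - k^4| - 4 * ln |w|\<close> with the quartic split into its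
  linear factors, so that each logarithm can be differentiated, bounded and passed to the limit
  separately. The subtraction makes each term vanish at infinity.\<close>

definition log_term :: "nat \<Rightarrow> nat \<Rightarrow> real \<Rightarrow> real" where
  "log_term m k y =
     ln (norm (vline m y - of_nat k)) + ln (norm (vline m y - (- of_nat k))) +
     ln (norm (vline m y - \<i> * of_nat k)) + ln (norm (vline m y - (- (\<i> * of_nat k)))) -
     4 * ln (norm (vline m y))"

lemma vline_neq:
  assumes "m \<ge> 1"
  shows "y \<noteq> 0 \<Longrightarrow> vline m y \<noteq> of_nat k" "vline m y \<noteq> - of_nat k"
    "vline m y \<noteq> \<i> * of_nat k" "vline m y \<noteq> - (\<i> * of_nat k)"
  using assms by (auto simp: complex_eq_iff)

lemma vline_nonzero: "m \<ge> 1 \<Longrightarrow> vline m y \<noteq> 0"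
  by (auto simp: complex_eq_iff)

lemma norm_vline_ge_Im: "norm (vline m y) \<ge> \<bar>y\<bar>" and norm_vline_ge_Re: "norm (vline m y) \<ge> real m"
  using abs_Re_le_cmod[of "vline m y"] abs_Im_le_cmod[of "vline m y"] by auto

lemma norm_vline_ge:
  assumes "m \<ge> 1"
  shows "norm (vline m y - of_nat k) \<ge> \<bar>y\<bar>" "norm (vline m y - (- of_nat k)) \<ge> 1"
    "norm (vline m y - \<i> * of_nat k) \<ge> 1" "norm (vline m y - (- (\<i> * of_nat k))) \<ge> 1"
  using assms abs_Re_le_cmod[of "vline m y - (- of_nat k)"] abs_Im_le_cmod[of "vline m y - of_nat k"]
    abs_Re_le_cmod[of "vline m y - \<i> * of_nat k"] abs_Re_le_cmod[of "vline m y - (- (\<i> * of_nat k))"]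
  by auto

lemma norm_vline_diff_ge_1:
  assumes "k \<noteq> m"
  shows "norm (vline m y - of_nat k) \<ge> 1"
proof -
  have "1 \<le> \<bar>real m - real k\<bar>" using assms by linarith
  thus ?thesis using abs_Re_le_cmod[of "vline m y - of_nat k"] by simp
qed

lemma Re_ii_inverse_le: "\<bar>Re (\<i> * (1 / z))\<bar> \<le> 1 / norm z"
  using abs_Re_le_cmod[of "\<i> * (1 / z)"] by (simp add: norm_divide norm_mult)

text \<open>The derivative is the real part of
  \<open>\<i> * (1 / (w - k)^2 - 1 / (w + k)^2)\<close>. The distances of \<open>w\<close> from
  \<open>k\<close> and \<open>-k\<close> are at least \<open>y\<close> and 1, which bounds it
  uniformly in \<open>k\<close>.\<close>

lemma pole_term_deriv:
  assumes "m \<ge> 1" "y > 0"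
  shows "(pole_term m k has_real_derivative
      Re (\<i> * (4 * vline m y * of_nat k / ((vline m y)\<^sup>2 - of_nat k ^ 2)\<^sup>2))) (at y)"
    and "\<bar>Re (\<i> * (4 * vline m y * of_nat k / ((vline m y)\<^sup>2 - of_nat k ^ 2)\<^sup>2))\<bar> \<le> 1 / y\<^sup>2 + 1"
proof -
  let ?w = "vline m y"
  have nz: "?w - of_nat k \<noteq> 0" "?w + of_nat k \<noteq> 0"
    using vline_neq[OF assms(1), of y k] assms(2) by (auto simp: eq_neg_iff_add_eq_0)
  have "of_nat k ^ 2 - ?w\<^sup>2 = - ((?w - of_nat k) * (?w + of_nat k))"
    by (simp add: power2_eq_square algebra_simps)
  hence nz': "of_nat k ^ 2 - ?w\<^sup>2 \<noteq> 0" using nz by (metis mult_eq_0_iff neg_equal_0_iff_equal)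
  show "(pole_term m k has_real_derivative
      Re (\<i> * (4 * ?w * of_nat k / (?w\<^sup>2 - of_nat k ^ 2)\<^sup>2))) (at y)"
    unfolding pole_term_def
  proof (rule has_real_derivative_Re_vline)
    show "((\<lambda>z. 2 * of_nat k / (of_nat k ^ 2 - z\<^sup>2)) has_field_derivative
        4 * ?w * of_nat k / (?w\<^sup>2 - of_nat k ^ 2)\<^sup>2) (at ?w)"
      using nz' by (auto intro!: derivative_eq_intros simp: power2_commute[of "?w\<^sup>2"])
        (simp add: power2_eq_square)
  qed
  have "4 * ?w * of_nat k / (?w\<^sup>2 - of_nat k ^ 2)\<^sup>2 =
      ((?w + of_nat k)\<^sup>2 - (?w - of_nat k)\<^sup>2) / ((?w - of_nat k) * (?w + of_nat k))\<^sup>2"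
    by (simp add: power2_eq_square algebra_simps)
  also have "\<dots> = 1 / (?w - of_nat k)\<^sup>2 - 1 / (?w + of_nat k)\<^sup>2"
    using nz by (simp add: diff_frac_eq power_mult_distrib)
  also have "norm \<dots> \<le> 1 / norm (?w - of_nat k) ^ 2 + 1 / norm (?w + of_nat k) ^ 2"
    using norm_triangle_ineq4[of "1 / (?w - of_nat k)\<^sup>2" "1 / (?w + of_nat k)\<^sup>2"]
    by (simp add: norm_divide norm_power)
  also have "\<dots> \<le> 1 / y\<^sup>2 + 1 / 1\<^sup>2"
    using norm_vline_ge[OF assms(1), of y k] assms(2)
    by (intro add_mono divide_left_mono power_mono mult_pos_pos zero_less_power) auto
  finally show "\<bar>Re (\<i> * (4 * ?w * of_nat k / (?w\<^sup>2 - of_nat k ^ 2)\<^sup>2))\<bar> \<le> 1 / y\<^sup>2 + 1"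
    using abs_Re_le_cmod[of "\<i> * (4 * ?w * of_nat k / (?w\<^sup>2 - of_nat k ^ 2)\<^sup>2)"]
    unfolding norm_mult[of \<i>] by simp
qed

text \<open>Of the four linear factors only \<open>w - k\<close> can come close to 0 and contributes
  \<open>1 / y\<close>; the 7 collects 3 from the other factors and 4 from the
  normalisation.\<close>

lemma log_term_deriv:
  fixes m k :: nat and y :: real
  assumes "m \<ge> 1" "y > 0"
  defines "w \<equiv> vline m y"
  defines "D \<equiv> Re (\<i> * (2 * w / (w\<^sup>2 - of_nat k ^ 2) + 2 * w / (w\<^sup>2 + of_nat k ^ 2))) - 4 * Re (\<i> * (1 / w))"
  shows "(log_term m k has_real_derivative D) (at y)"
    and "\<bar>D\<bar> \<le> 1 / y + 7"
proof -
  note neq = vline_neq[OF assms(1), of y k, folded w_def]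
  have nz: "w - of_nat k \<noteq> 0" "w + of_nat k \<noteq> 0" "w - \<i> * of_nat k \<noteq> 0" "w + \<i> * of_nat k \<noteq> 0"
    using neq assms(2) by (auto simp: eq_neg_iff_add_eq_0)
  have e: "w\<^sup>2 - of_nat k ^ 2 = (w - of_nat k) * (w + of_nat k)"
     "w\<^sup>2 + of_nat k ^ 2 = (w - \<i> * of_nat k) * (w + \<i> * of_nat k)"
    by (simp_all add: power2_eq_square algebra_simps)
  have "2 * w / (w\<^sup>2 - of_nat k ^ 2) = 1 / (w - of_nat k) + 1 / (w - (- of_nat k))"
    "2 * w / (w\<^sup>2 + of_nat k ^ 2) = 1 / (w - \<i> * of_nat k) + 1 / (w - (- (\<i> * of_nat k)))"
    unfolding e using nz by (simp_all add: add_frac_eq)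
  hence D: "D = Re (\<i> * (1 / (w - of_nat k))) + Re (\<i> * (1 / (w - (- of_nat k)))) +
     Re (\<i> * (1 / (w - \<i> * of_nat k))) + Re (\<i> * (1 / (w - (- (\<i> * of_nat k))))) - 4 * Re (\<i> * (1 / w))"
    unfolding D_def by (simp only: distrib_left plus_complex.sel add.assoc)
  have "((\<lambda>y. ln (norm (vline m y))) has_real_derivative Re (\<i> * (1 / w))) (at y)"
    using has_real_derivative_ln_norm_vline[of m y 0] vline_nonzero[OF assms(1)] by (simp add: w_def)
  thus "(log_term m k has_real_derivative D) (at y)"
    unfolding log_term_def D w_def using neq assms(2)
    by (intro DERIV_add DERIV_diff DERIV_cmult has_real_derivative_ln_norm_vline) (auto simp: w_def)
  have le: "\<bar>Re (\<i> * (1 / z))\<bar> \<le> 1 / c" if "norm z \<ge> c" "c > 0" for z :: complex and c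
    using Re_ii_inverse_le[of z] by (rule order_trans) (use that in \<open>auto intro!: divide_left_mono mult_pos_pos\<close>)
  note ge = norm_vline_ge[OF assms(1), of y k, folded w_def]
  have "\<bar>Re (\<i> * (1 / (w - of_nat k)))\<bar> \<le> 1 / y" using ge assms(2) by (intro le) auto
  moreover have "\<bar>Re (\<i> * (1 / (w - (- of_nat k))))\<bar> \<le> 1 / 1" using ge by (intro le) auto
  moreover have "\<bar>Re (\<i> * (1 / (w - \<i> * of_nat k)))\<bar> \<le> 1 / 1" using ge by (intro le) auto
  moreover have "\<bar>Re (\<i> * (1 / (w - (- (\<i> * of_nat k)))))\<bar> \<le> 1 / 1" using ge by (intro le) auto
  moreover have "\<bar>Re (\<i> * (1 / w))\<bar> \<le> 1 / 1"
    using norm_vline_ge_Re[of m y] assms(1) by (intro le) (auto simp: w_def)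
  ultimately show "\<bar>D\<bar> \<le> 1 / y + 7" unfolding D by linarith
qed

lemma pole_term_bound:
  assumes "c > 0" "norm (vline m y - of_nat k) \<ge> c" "norm (vline m y + of_nat k) \<ge> c"
  shows "\<bar>pole_term m k y\<bar> \<le> 2 / c"
proof -
  let ?w = "vline m y"
  have nz: "?w - of_nat k \<noteq> 0" "?w + of_nat k \<noteq> 0" using assms by auto
  have "2 * of_nat k / (of_nat k ^ 2 - ?w\<^sup>2) = 1 / (?w + of_nat k) - 1 / (?w - of_nat k)"
  proof -
    have "of_nat k ^ 2 - ?w\<^sup>2 = - ((?w + of_nat k) * (?w - of_nat k))"
      by (simp add: power2_eq_square algebra_simps)
    thus ?thesis using nz by (simp add: diff_frac_eq)
  qed
  hence "norm (2 * of_nat k / (of_nat k ^ 2 - ?w\<^sup>2)) \<le> 1 / norm (?w + of_nat k) + 1 / norm (?w - of_nat k)"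
    using norm_triangle_ineq4[of "1 / (?w + of_nat k)" "1 / (?w - of_nat k)"] by (simp add: norm_divide)
  also have "\<dots> \<le> 1 / c + 1 / c"
    using assms by (intro add_mono divide_left_mono mult_pos_pos) auto
  finally show ?thesis unfolding pole_term_def
    using abs_Re_le_cmod[of "2 * of_nat k / (of_nat k ^ 2 - ?w\<^sup>2)"] by simp
qed

text \<open>\<open>ln\<close> is Lipschitz with constant 1 on \<open>[1, \<infinity>)\<close>, and
  so is the norm.\<close>

lemma abs_ln_norm_diff_le:
  fixes w z :: complex
  assumes "norm w \<ge> 1" "norm (w - z) \<ge> 1"
  shows "\<bar>ln (norm (w - z)) - ln (norm w)\<bar> \<le> norm z"
proof -
  have *: "ln (norm a) - ln (norm b) \<le> norm (a - b)" if "norm a \<ge> 1" "norm b \<ge> 1" for a b :: complex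
  proof -
    have pos: "norm a > 0" "norm b > 0" using that by linarith+
    have "norm a \<le> norm b + norm (a - b)" by (rule norm_triangle_sub)
    also have "\<dots> \<le> norm b * (1 + norm (a - b))"
      using mult_right_mono[OF that(2), of "norm (a - b)"] by (simp add: distrib_left)
    finally have "norm a / norm b \<le> 1 + norm (a - b)" using pos by (simp add: field_simps)
    hence "ln (norm a / norm b) \<le> ln (1 + norm (a - b))"
      using pos by (subst ln_le_cancel_iff) (auto intro: add_pos_nonneg)
    also have "\<dots> \<le> norm (a - b)" by (rule ln_add_one_self_le_self) simp
    finally show ?thesis using pos by (simp add: ln_div)
  qed
  show ?thesis using *[OF assms(1,2)] *[OF assms(2,1)] by (simp add: abs_le_iff)
qed

text \<open>Each of the four logarithms differs from \<open>ln |w|\<close> by at most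
  \<open>k\<close>. The bound is uniform in \<open>y\<close>, and its linear growth is absorbed by
  the exponentially small \<open>sinh_weight k\<close>.\<close>

lemma log_term_bound:
  assumes "m \<ge> 1" "norm (vline m y - of_nat k) \<ge> 1"
  shows "\<bar>log_term m k y\<bar> \<le> 4 * real k"
proof -
  note ge = norm_vline_ge[OF assms(1), of y k]
  have "\<bar>ln (norm (vline m y - z)) - ln (norm (vline m y))\<bar> \<le> real k"
    if "z \<in> {of_nat k, - of_nat k, \<i> * of_nat k, - (\<i> * of_nat k)}" for z
  proof -
    have "norm (vline m y - z) \<ge> 1" using that ge assms(2) by blast
    from abs_ln_norm_diff_le[OF _ this] norm_vline_ge_Re[of m y] assms(1) show ?thesis using that by (auto simp: norm_mult)
  qed
  note le = this
  have "\<bar>a + b + c + d - 4 * e\<bar> \<le> 4 * x"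
    if "\<bar>a - e\<bar> \<le> x" "\<bar>b - e\<bar> \<le> x" "\<bar>c - e\<bar> \<le> x" "\<bar>d - e\<bar> \<le> x" for a b c d e x :: real
    using that by linarith
  thus ?thesis unfolding log_term_def by (blast intro: le)
qed

section \<open>The double series\<close>

text \<open>
  \<open>corner_term j n\<close> is, up to the factor \<open>exp (- 2 \<pi> j m)\<close>, the real part of
  \<open>n / (j - \<i> n) exp (2 \<pi> (\<i> n - j) w)\<close> at \<open>w = m + \<i> y\<close>. The terms with \<open>n = 0\<close> or \<open>j = 0\<close>
  do not contribute: for \<open>n = 0\<close> the term is 0 (also for \<open>j = n = 0\<close>, since \<open>0 / 0 = 0\<close>), and
  for \<open>j = 0\<close> the sine vanishes.
\<close>

definition corner_term :: "nat \<Rightarrow> nat \<Rightarrow> real \<Rightarrow> real" where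
  "corner_term j n y = real n / (real n ^ 2 + real j ^ 2) * exp (- 2 * pi * y) ^ n *
     (real j * cos (2 * pi * real j * y) + real n * sin (2 * pi * real j * y))"

text \<open>The sum over \<open>n\<close> is the inner one: it converges only through
  \<open>exp (- 2 * pi * y) ^ n\<close> and carries the whole singularity at \<open>y = 0\<close>,
  while the outer sum stays under control thanks to \<open>exp (- 2 * pi * j * m)\<close>.\<close>

definition corner_row :: "nat \<Rightarrow> real \<Rightarrow> real" where
  "corner_row j y = (\<Sum>n. corner_term j n y)"

text \<open>With \<open>4 * pi\<close> the derivative is the left-hand side of the pole expansion
  divided by \<open>pi\<close>: differentiation yields \<open>- 2 * pi\<close>, and the sum over
  \<open>n\<close> yields \<open>1 / (4 * sinh^2 (pi * y))\<close>.\<close>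

definition corner_sum :: "nat \<Rightarrow> real \<Rightarrow> real" where
  "corner_sum m y = 4 * pi * (\<Sum>j. exp (- 2 * pi * real j * real m) * corner_row j y)"

lemma exp_2pi_power: "exp (- 2 * pi * y) ^ n = exp (- 2 * pi * real n * y)"
  by (simp add: exp_of_nat_mult[symmetric] mult_ac)

lemma corner_term_bound: "\<bar>corner_term j n y\<bar> \<le> 2 * exp (- 2 * pi * y) ^ n"
proof -
  define J where "J = real j"
  define N where "N = real n"
  have nonneg: "J \<ge> 0" "N \<ge> 0" by (simp_all add: J_def N_def)
  have "\<bar>J * cos (2 * pi * J * y) + N * sin (2 * pi * J * y)\<bar> \<le>
      J * \<bar>cos (2 * pi * J * y)\<bar> + N * \<bar>sin (2 * pi * J * y)\<bar>"
    using nonneg abs_triangle_ineq[of "J * cos (2 * pi * J * y)" "N * sin (2 * pi * J * y)"]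
    by (simp add: abs_mult)
  also have "\<dots> \<le> J * 1 + N * 1"
    using nonneg by (intro add_mono mult_left_mono abs_cos_le_one abs_sin_le_one)
  finally have *: "\<bar>J * cos (2 * pi * J * y) + N * sin (2 * pi * J * y)\<bar> \<le> J + N" by simp
  have "N * (J + N) \<le> 2 * (N\<^sup>2 + J\<^sup>2)"
  proof -
    have "2 * (N\<^sup>2 + J\<^sup>2) - N * (J + N) = (N - J / 2)\<^sup>2 + 7 / 4 * J\<^sup>2"
      by (simp add: power2_eq_square algebra_simps)
    also have "\<dots> \<ge> 0" by simp
    finally show ?thesis by simp
  qed
  hence "N / (N\<^sup>2 + J\<^sup>2) * (J + N) \<le> 2"
    by (cases "N\<^sup>2 + J\<^sup>2 = 0") (auto simp: divide_le_eq add_nonneg_nonneg less_le)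
  hence "N / (N\<^sup>2 + J\<^sup>2) * \<bar>J * cos (2 * pi * J * y) + N * sin (2 * pi * J * y)\<bar> \<le> 2"
    using mult_left_mono[OF *, of "N / (N\<^sup>2 + J\<^sup>2)"] nonneg by simp
  from mult_left_mono[OF this, of "exp (- 2 * pi * y) ^ n"] show ?thesis
    unfolding corner_term_def J_def N_def by (simp add: abs_mult mult_ac)
qed

lemma summable_corner_term:
  assumes "y > 0"
  shows "summable (\<lambda>n. corner_term j n y)"
proof (rule summable_comparison_test')
  show "summable (\<lambda>n. 2 * exp (- 2 * pi * y) ^ n)"
    using assms by (intro summable_mult summable_geometric) simp
  show "norm (corner_term j n y) \<le> 2 * exp (- 2 * pi * y) ^ n" for n
    using corner_term_bound[of j n y] by simp
qed

lemma corner_row_bound: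
  assumes "y > 0"
  shows "\<bar>corner_row j y\<bar> \<le> 2 / (1 - exp (- 2 * pi * y))"
proof -
  have s: "(\<lambda>n. 2 * exp (- 2 * pi * y) ^ n) sums (2 * (1 / (1 - exp (- 2 * pi * y))))"
    using assms by (intro sums_mult geometric_sums) simp
  have abs: "summable (\<lambda>n. \<bar>corner_term j n y\<bar>)"
    by (rule summable_comparison_test'[OF sums_summable[OF s]]) (use corner_term_bound in simp)
  have "\<bar>corner_row j y\<bar> \<le> (\<Sum>n. \<bar>corner_term j n y\<bar>)"
    unfolding corner_row_def by (rule summable_rabs[OF abs])
  also have "\<dots> \<le> (\<Sum>n. 2 * exp (- 2 * pi * y) ^ n)"
    by (intro suminf_le abs sums_summable[OF s] corner_term_bound)
  finally show ?thesis using s by (simp add: sums_iff)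
qed

text \<open>The cosines cancel and the sines acquire the factor \<open>n^2 + j^2\<close>, which
  removes the denominator. The derivative is thus a function of \<open>j\<close> times a function of
  \<open>n\<close>, and the differentiated double series factors into two single ones.\<close>

lemma corner_term_deriv:
  "(corner_term j n has_real_derivative
     - 2 * pi * sin (2 * pi * real j * y) * (real n * exp (- 2 * pi * y) ^ n)) (at y)"
proof (cases "n = 0")
  case True
  thus ?thesis by (simp add: corner_term_def [abs_def])
next
  case False
  hence nz: "real n ^ 2 + real j ^ 2 \<noteq> 0" by (simp add: sum_power2_eq_zero_iff)
  define K where "K = real n / (real n ^ 2 + real j ^ 2)"
  define E where "E = exp (- 2 * pi * real n * y)"
  define c where "c = cos (2 * pi * real j * y)"
  define s where "s = sin (2 * pi * real j * y)"
  have "((\<lambda>y. exp (- 2 * pi * real n * y)) has_real_derivative - 2 * pi * real n * E) (at y)"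
    "((\<lambda>y. cos (2 * pi * real j * y)) has_real_derivative - s * (2 * pi * real j)) (at y)"
    "((\<lambda>y. sin (2 * pi * real j * y)) has_real_derivative c * (2 * pi * real j)) (at y)"
    unfolding E_def c_def s_def by (auto intro!: derivative_eq_intros)
  note DERIV_mult[OF DERIV_cmult[OF this(1), of K]
    DERIV_add[OF DERIV_cmult[OF this(2), of "real j"] DERIV_cmult[OF this(3), of "real n"]]]
  moreover have "K * (- 2 * pi * real n * E) * (real j * c + real n * s) +
      (real j * (- s * (2 * pi * real j)) + real n * (c * (2 * pi * real j))) * (K * E) =
      K * (real n ^ 2 + real j ^ 2) * (- 2 * pi * s * E)"
    by (simp add: algebra_simps power2_eq_square)
  moreover have "K * (real n ^ 2 + real j ^ 2) = real n" using nz by (simp add: K_def)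
  ultimately have "((\<lambda>y. K * exp (- 2 * pi * real n * y) *
     (real j * cos (2 * pi * real j * y) + real n * sin (2 * pi * real j * y))) has_real_derivative
     - 2 * pi * s * (real n * E)) (at y)"
    unfolding E_def[symmetric] c_def[symmetric] s_def[symmetric] by (simp add: mult_ac)
  thus ?thesis unfolding corner_term_def [abs_def] exp_2pi_power K_def E_def s_def .
qed

lemma sums_nat_mult_power:
  fixes z :: real
  assumes "\<bar>z\<bar> < 1"
  shows "(\<lambda>n. real n * z ^ n) sums (z / (1 - z)\<^sup>2)"
proof -
  have "(\<lambda>n. z * (of_nat (Suc n) * z ^ n)) sums (z * (1 / (1 - z)\<^sup>2))"
    by (intro sums_mult geometric_deriv_sums) (use assms in simp)
  hence "(\<lambda>n. real (Suc n) * z ^ Suc n) sums (z / (1 - z)\<^sup>2)" by (simp add: mult_ac)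
  thus ?thesis using sums_Suc_iff[of "\<lambda>n. real n * z ^ n"] by simp
qed

lemma sums_nat_mult_exp:
  assumes "y > 0"
  shows "(\<lambda>n. real n * exp (- 2 * pi * y) ^ n) sums (1 / (4 * (sinh (pi * y))\<^sup>2))"
proof -
  define e where "e = exp (pi * y)"
  have e: "e > 1" using assms by (simp add: e_def)
  define t where "t = e\<^sup>2"
  have t: "t > 1" using e by (simp add: t_def one_less_power)
  have q: "exp (- 2 * pi * y) = inverse t"
    by (simp add: t_def e_def exp_minus exp_double[symmetric] mult_ac)
  have "sinh (pi * y) = (t - 1) / (2 * e)"
    using e by (simp add: sinh_field_def e_def[symmetric] t_def exp_minus field_simps power2_eq_square)
  hence "1 / (4 * (sinh (pi * y))\<^sup>2) = t / (t - 1)\<^sup>2"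
    by (simp add: power_divide power_mult_distrib t_def)
  also have "\<dots> = inverse t / (1 - inverse t)\<^sup>2"
    using t by (simp add: field_simps power2_eq_square)
  finally have "exp (- 2 * pi * y) / (1 - exp (- 2 * pi * y))\<^sup>2 = 1 / (4 * (sinh (pi * y))\<^sup>2)"
    unfolding q ..
  thus ?thesis using sums_nat_mult_power[of "exp (- 2 * pi * y)"] assms by simp
qed

lemma corner_row_deriv:
  assumes "y > 0"
  shows "(corner_row j has_real_derivative
     - 2 * pi * sin (2 * pi * real j * y) * (1 / (4 * (sinh (pi * y))\<^sup>2))) (at y)"
proof -
  have "((\<lambda>y. \<Sum>n. corner_term j n y) has_real_derivative
     (\<Sum>n. - 2 * pi * sin (2 * pi * real j * y) * (real n * exp (- 2 * pi * y) ^ n))) (at y)"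
  proof (rule has_real_derivative_suminf_pos[OF corner_term_deriv _ summable_corner_term assms])
    fix \<delta> :: real
    assume "\<delta> > 0"
    have "\<bar>- 2 * pi * sin (2 * pi * real j * t) * (real n * exp (- 2 * pi * t) ^ n)\<bar> \<le>
        2 * pi * (real n * exp (- 2 * pi * \<delta>) ^ n)" if "t \<ge> \<delta>" for n t
    proof -
      have "\<bar>- 2 * pi * sin (2 * pi * real j * t) * (real n * exp (- 2 * pi * t) ^ n)\<bar> =
         2 * pi * (\<bar>sin (2 * pi * real j * t)\<bar> * (real n * exp (- 2 * pi * t) ^ n))"
        by (simp add: abs_mult)
      also have "\<dots> \<le> 2 * pi * (1 * (real n * exp (- 2 * pi * \<delta>) ^ n))"
        using that by (intro mult_left_mono mult_mono power_mono abs_sin_le_one) auto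
      finally show ?thesis by simp
    qed
    moreover have "summable (\<lambda>n. 2 * pi * (real n * exp (- 2 * pi * \<delta>) ^ n))"
      using sums_nat_mult_exp[OF \<open>\<delta> > 0\<close>] by (intro summable_mult) (rule sums_summable)
    ultimately show "\<exists>M. summable M \<and> (\<forall>n. \<forall>t\<ge>\<delta>.
        \<bar>- 2 * pi * sin (2 * pi * real j * t) * (real n * exp (- 2 * pi * t) ^ n)\<bar> \<le> M n)"
      by blast
  qed
  also have "(\<Sum>n. - 2 * pi * sin (2 * pi * real j * y) * (real n * exp (- 2 * pi * y) ^ n)) =
     - 2 * pi * sin (2 * pi * real j * y) * (1 / (4 * (sinh (pi * y))\<^sup>2))"
    using sums_mult[OF sums_nat_mult_exp[OF assms], of "- 2 * pi * sin (2 * pi * real j * y)"]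
    by (simp only: sums_iff)
  finally show ?thesis unfolding corner_row_def [abs_def] .
qed

text \<open>A geometric series in \<open>exp (- 2 * pi * w)\<close>. Starting it at
  \<open>j = 0\<close> adds \<open>\<i>\<close>, whose real part is 0.\<close>

lemma sums_sin_exp:
  assumes "m \<ge> 1"
  shows "(\<lambda>j. exp (- 2 * pi * real j * real m) * sin (2 * pi * real j * y)) sums
           Re (\<i> / (exp (2 * of_real pi * vline m y) - 1))"
proof -
  define E where "E = exp (2 * of_real pi * vline m y)"
  have nE: "norm E > 1" using assms by (simp add: E_def)
  hence E: "E \<noteq> 0" "E \<noteq> 1" by auto
  have "(\<lambda>j. \<i> * inverse E ^ j) sums (\<i> * (1 / (1 - inverse E)))"
    using nE by (intro sums_mult geometric_sums) (simp add: norm_inverse inverse_less_1_iff)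
  hence "(\<lambda>j. Re (\<i> * inverse E ^ j)) sums Re (\<i> * (1 / (1 - inverse E)))"
    by (rule sums_Re)
  also have "\<i> * (1 / (1 - inverse E)) = \<i> + \<i> / (E - 1)"
    using E by (simp add: field_simps)
  also have "Re \<dots> = Re (\<i> / (E - 1))" by simp
  also have "(\<lambda>j. Re (\<i> * inverse E ^ j)) =
     (\<lambda>j. exp (- 2 * pi * real j * real m) * sin (2 * pi * real j * y))"
  proof
    fix j
    have "inverse E ^ j = exp (of_nat j * (- (2 * of_real pi * vline m y)))"
      by (simp only: E_def exp_minus[symmetric] exp_of_nat_mult)
    thus "Re (\<i> * inverse E ^ j) = exp (- 2 * pi * real j * real m) * sin (2 * pi * real j * y)"
      by (simp add: Im_exp mult_ac)
  qed
  finally show ?thesis by (simp add: E_def)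
qed

lemma summable_exp_mult:
  assumes "m \<ge> 1" "\<And>j. \<bar>g j\<bar> \<le> G j" "summable (\<lambda>j. exp (- 2 * pi * real j) * G j)"
  shows "\<bar>exp (- 2 * pi * real j * real m) * g j\<bar> \<le> exp (- 2 * pi * real j) * G j"
    and "summable (\<lambda>j. exp (- 2 * pi * real j * real m) * g j)"
proof -
  have "real j * 1 \<le> real j * real m" for j using assms(1) by (intro mult_left_mono) auto
  thus *: "\<bar>exp (- 2 * pi * real j * real m) * g j\<bar> \<le> exp (- 2 * pi * real j) * G j" for j
    using assms(2)[of j] unfolding abs_mult by (intro mult_mono) auto
  show "summable (\<lambda>j. exp (- 2 * pi * real j * real m) * g j)"
    by (rule summable_comparison_test'[OF assms(3)]) (use * in simp)
qed

lemma summable_exp_const: "summable (\<lambda>j. exp (- 2 * pi * real j) * c)"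
proof -
  have "(\<lambda>j. exp (- 2 * pi * real j) * c) = (\<lambda>j. exp (- 2 * pi) ^ j * c)"
    using exp_2pi_power[of 1] by simp
  thus ?thesis by (simp add: summable_mult2)
qed

lemma corner_sum_deriv:
  assumes "m \<ge> 1" "y > 0"
  shows "(corner_sum m has_real_derivative
     - 2 * pi\<^sup>2 / (sinh (pi * y))\<^sup>2 * Re (\<i> / (exp (2 * of_real pi * vline m y) - 1))) (at y)"
proof -
  have "((\<lambda>y. \<Sum>j. exp (- 2 * pi * real j * real m) * corner_row j y) has_real_derivative
     (\<Sum>j. exp (- 2 * pi * real j * real m) *
       (- 2 * pi * sin (2 * pi * real j * y) * (1 / (4 * (sinh (pi * y))\<^sup>2))))) (at y)"
  proof (rule has_real_derivative_suminf_pos)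
    fix \<delta> :: real
    assume "\<delta> > 0"
    have "\<bar>- 2 * pi * sin (2 * pi * real j * t) * (1 / (4 * (sinh (pi * t))\<^sup>2))\<bar> \<le>
        2 * pi * (1 / (4 * (sinh (pi * \<delta>))\<^sup>2))" if "t \<ge> \<delta>" for j t
    proof -
      have "t > 0" using \<open>\<delta> > 0\<close> that by simp
      hence "sinh (pi * \<delta>) > 0" "sinh (pi * t) > 0" "sinh (pi * \<delta>) \<le> sinh (pi * t)"
        using \<open>\<delta> > 0\<close> that by simp_all
      hence "1 / (4 * (sinh (pi * t))\<^sup>2) \<le> 1 / (4 * (sinh (pi * \<delta>))\<^sup>2)"
        by (intro divide_left_mono mult_left_mono power_mono mult_pos_pos zero_less_power) auto
      hence "2 * pi * (\<bar>sin (2 * pi * real j * t)\<bar> * (1 / (4 * (sinh (pi * t))\<^sup>2))) \<le>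
         2 * pi * (1 * (1 / (4 * (sinh (pi * \<delta>))\<^sup>2)))"
        by (intro mult_left_mono mult_mono abs_sin_le_one) auto
      thus ?thesis by (simp add: abs_mult)
    qed
    note bd = summable_exp_mult(1)[where g = "\<lambda>j. - 2 * pi * sin (2 * pi * real j * t) * (1 / (4 * (sinh (pi * t))\<^sup>2))" for t,
        OF assms(1) this summable_exp_const]
    show "\<exists>M. summable M \<and> (\<forall>j. \<forall>t\<ge>\<delta>. \<bar>exp (- 2 * pi * real j * real m) *
       (- 2 * pi * sin (2 * pi * real j * t) * (1 / (4 * (sinh (pi * t))\<^sup>2)))\<bar> \<le> M j)"
      by (intro exI[of _ "\<lambda>j. exp (- 2 * pi * real j) * (2 * pi * (1 / (4 * (sinh (pi * \<delta>))\<^sup>2)))"] conjI allI impI)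
         (rule summable_exp_const, rule bd, assumption)
  next
    show "((\<lambda>y. exp (- 2 * pi * real j * real m) * corner_row j y) has_real_derivative
       exp (- 2 * pi * real j * real m) *
       (- 2 * pi * sin (2 * pi * real j * t) * (1 / (4 * (sinh (pi * t))\<^sup>2)))) (at t)"
      if "t > 0" for j t
      by (rule DERIV_cmult[OF corner_row_deriv[OF that]])
    show "summable (\<lambda>j. exp (- 2 * pi * real j * real m) * corner_row j t)" if "t > 0" for t
      by (rule summable_exp_mult(2)[OF assms(1) corner_row_bound[OF that] summable_exp_const])
  qed fact
  also have "(\<Sum>j. exp (- 2 * pi * real j * real m) *
       (- 2 * pi * sin (2 * pi * real j * y) * (1 / (4 * (sinh (pi * y))\<^sup>2)))) =
     - 2 * pi * (1 / (4 * (sinh (pi * y))\<^sup>2)) * Re (\<i> / (exp (2 * of_real pi * vline m y) - 1))"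
    using sums_mult[OF sums_sin_exp[OF assms(1), of y], of "- 2 * pi * (1 / (4 * (sinh (pi * y))\<^sup>2))"]
    by (simp only: sums_iff mult_ac)
  finally have "(corner_sum m has_real_derivative 4 * pi * (- 2 * pi * (1 / (4 * (sinh (pi * y))\<^sup>2)) *
      Re (\<i> / (exp (2 * of_real pi * vline m y) - 1)))) (at y)"
    unfolding corner_sum_def [abs_def] by (rule DERIV_cmult)
  moreover have eq: "4 * pi * (- 2 * pi * (1 / (4 * s)) * r) = - 2 * pi\<^sup>2 / s * r" for s r :: real
    by (simp add: power2_eq_square)
  ultimately show ?thesis unfolding eq by blast
qed

lemma corner_sum_tendsto_at_top:
  assumes "m \<ge> 1"
  shows "(corner_sum m \<longlongrightarrow> 0) at_top"
proof -
  have row: "(corner_row j \<longlongrightarrow> 0) at_top" for j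
  proof -
    have "((\<lambda>y. \<Sum>n. corner_term j n y) \<longlongrightarrow> (\<Sum>n. 0)) at_top"
    proof (rule dominated_series_tendsto(1))
      show "(corner_term j n \<longlongrightarrow> 0) at_top" for n
      \<comment> \<open>For \<open>n = 0\<close> the bound does not decay in \<open>y\<close>, but
        the term itself is identically 0.\<close>
      proof (cases "n = 0")
        case False
        have "((\<lambda>y. 2 * exp (- 2 * pi * y) ^ n) \<longlongrightarrow> 2 * 0 ^ n) at_top"
          by (intro tendsto_intros) real_asymp
        hence "((\<lambda>y. 2 * exp (- 2 * pi * y) ^ n) \<longlongrightarrow> 0) at_top" using False by (simp add: power_0_left)
        thus ?thesis by (rule Lim_null_comparison[rotated]) (use corner_term_bound in simp)
      qed (simp add: corner_term_def [abs_def])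
      show "eventually (\<lambda>y. \<forall>n. norm (corner_term j n y) \<le> 2 * exp (- 2 * pi * 1) ^ n) at_top"
        using eventually_ge_at_top[of "1::real"]
      proof eventually_elim
        case (elim y)
        have "2 * exp (- 2 * pi * y) ^ n \<le> 2 * exp (- 2 * pi * 1) ^ n" for n
          using elim by (intro mult_left_mono power_mono) auto
        thus ?case using order_trans[OF corner_term_bound[of j _ y]] by (simp only: real_norm_def) blast
      qed
    qed (auto intro!: summable_mult summable_geometric)
    thus ?thesis by (simp add: corner_row_def [abs_def])
  qed
  have "((\<lambda>y. \<Sum>j. exp (- 2 * pi * real j * real m) * corner_row j y) \<longlongrightarrow> (\<Sum>j. 0)) at_top"
  proof (rule dominated_series_tendsto(1))
    show "((\<lambda>y. exp (- 2 * pi * real j * real m) * corner_row j y) \<longlongrightarrow> 0) at_top" for j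
      by (intro tendsto_mult_right_zero row)
    show "eventually (\<lambda>y. \<forall>j. norm (exp (- 2 * pi * real j * real m) * corner_row j y) \<le>
        exp (- 2 * pi * real j) * (2 / (1 - exp (- 2 * pi * 1)))) at_top"
      using eventually_ge_at_top[of "1::real"]
    proof eventually_elim
      case (elim y)
      have "\<bar>corner_row j y\<bar> \<le> 2 / (1 - exp (- 2 * pi * 1))" for j
      proof -
        have "2 / (1 - exp (- 2 * pi * y)) \<le> 2 / (1 - exp (- 2 * pi * 1))"
          using elim by (intro divide_left_mono mult_pos_pos) auto
        with corner_row_bound[of y j] elim show ?thesis by linarith
      qed
      from summable_exp_mult(1)[where g = "\<lambda>j. corner_row j y", OF assms this summable_exp_const] show ?case unfolding real_norm_def by blast
    qed
  qed (rule summable_exp_const, simp)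
  hence "((\<lambda>y. 4 * pi * (\<Sum>j. exp (- 2 * pi * real j * real m) * corner_row j y)) \<longlongrightarrow> 0) at_top"
    by (intro tendsto_mult_right_zero) simp
  thus ?thesis by (simp add: corner_sum_def [abs_def])
qed

section \<open>Behaviour of the double series as \<open>y\<close> tends to 0\<close>

text \<open>The term \<open>n = 0\<close> is \<open>j\<^sup>2 / 0 = 0\<close>.\<close>

definition corner_coeff :: "nat \<Rightarrow> real" where
  "corner_coeff j = (\<Sum>n. real j ^ 2 / (real n * (real j ^ 2 + real n ^ 2)))"

lemma sq_frac_le:
  assumes "j \<ge> 1"
  shows "real j ^ 2 / (real j ^ 2 + real n ^ 2) \<le> 2 * real j ^ 2 * (1 / real (Suc n) ^ 2)"
proof -
  have "1 \<le> (real j)\<^sup>2" using assms by (simp add: one_le_power)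
  \<comment> \<open>From \<open>(n - 1)^2 \<ge> 0\<close> one gets
    \<open>(n + 1)^2 \<le> 2 * (n^2 + 1)\<close>. The shift to \<open>Suc n\<close> keeps the
    majorant positive at \<open>n = 0\<close>.\<close>
  hence "real (Suc n) ^ 2 \<le> 2 * (real j ^ 2 + real n ^ 2)"
    using zero_le_square[of "real n - 1"] by (simp add: power2_eq_square algebra_simps)
  moreover have pos: "real j ^ 2 + real n ^ 2 > 0" using assms by (intro add_pos_nonneg) auto
  ultimately have "2 / (2 * (real j ^ 2 + real n ^ 2)) \<le> 2 / real (Suc n) ^ 2"
    by (intro divide_left_mono mult_pos_pos) auto
  moreover have "2 / (2 * x) = 1 / x" for x :: real by simp
  ultimately have "1 / (real j ^ 2 + real n ^ 2) \<le> 2 / real (Suc n) ^ 2" by metis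
  from mult_left_mono[OF this, of "real j ^ 2"] show ?thesis by (simp add: mult_ac)
qed

lemma corner_coeff_term_le:
  assumes "j \<ge> 1"
  shows "real j ^ 2 / (real n * (real j ^ 2 + real n ^ 2)) \<le> 2 * real j ^ 2 * (1 / real (Suc n) ^ 2)"
proof (cases "n = 0")
  case False
  have "real j ^ 2 / (real n * (real j ^ 2 + real n ^ 2)) =
     real j ^ 2 / (real j ^ 2 + real n ^ 2) * (1 / real n)" by simp
  also have "\<dots> \<le> real j ^ 2 / (real j ^ 2 + real n ^ 2) * 1"
    using False by (intro mult_left_mono) auto
  also note sq_frac_le[OF assms]
  finally show ?thesis by simp
qed simp

lemma sums_inverse_Suc_squares: "(\<lambda>n. 1 / real (Suc n) ^ 2) sums (pi\<^sup>2 / 6)"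
  using inverse_squares_sums by (simp add: add.commute)

lemma summable_corner_coeff: "summable (\<lambda>n. real j ^ 2 / (real n * (real j ^ 2 + real n ^ 2)))"
proof (cases "j = 0")
  case False
  hence "j \<ge> 1" by simp
  show ?thesis
    by (rule summable_comparison_test'[OF summable_mult[OF sums_summable[OF sums_inverse_Suc_squares]]])
       (use corner_coeff_term_le[OF \<open>j \<ge> 1\<close>] in simp)
qed simp

lemma sums_power_div_nat:
  fixes q :: real
  assumes "0 < q" "q < 1"
  shows "(\<lambda>n. q ^ n / real n) sums (- ln (1 - q))"
proof -
  have "(\<lambda>n. - ((- (- q)) ^ n / real n)) sums ln (1 + - q)"
    using ln_series'[of "- q"] assms by simp
  from sums_minus[OF this] show ?thesis by simp
qed

text \<open>
  Splitting off \<open>n / (n\<^sup>2 + j\<^sup>2) = 1 / n - j\<^sup>2 / (n (n\<^sup>2 + j\<^sup>2))\<close> isolates the logarithmic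
  singularity at \<open>y = 0\<close>.
\<close>

lemma corner_row_expansion:
  fixes j :: nat and y :: real
  assumes "j \<ge> 1" "y > 0"
  defines "q \<equiv> exp (- 2 * pi * y)" and "\<theta> \<equiv> 2 * pi * real j * y"
  shows "corner_row j y + real j * ln (1 - q) =
     real j * (1 - cos \<theta>) * ln (1 - q)
     - real j * cos \<theta> * (\<Sum>n. real j ^ 2 / (real n * (real j ^ 2 + real n ^ 2)) * q ^ n)
     + sin \<theta> / (1 - q) - sin \<theta> * (\<Sum>n. real j ^ 2 / (real j ^ 2 + real n ^ 2) * q ^ n)"
proof -
  have q: "0 < q" "q < 1" using assms(2) by (auto simp: q_def)
  \<comment> \<open>\<open>\<alpha>\<close> corrects the cosine part, where \<open>1 / n\<close>
    sums to a logarithm; \<open>\<beta>\<close> corrects the sine part by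
    \<open>n^2 / (j^2 + n^2) = 1 - \<beta> n\<close>, whose main term is geometric.\<close>
  define \<alpha> where "\<alpha> n = real j ^ 2 / (real n * (real j ^ 2 + real n ^ 2))" for n
  define \<beta> where "\<beta> n = real j ^ 2 / (real j ^ 2 + real n ^ 2)" for n
  have qn: "q ^ n \<le> 1" "q ^ n \<ge> 0" for n using q by (auto simp: power_le_one)
  have sum: "summable (\<lambda>n. 2 * real j ^ 2 * (1 / real (Suc n) ^ 2))"
    by (intro summable_mult sums_summable[OF sums_inverse_Suc_squares])
  have "summable (\<lambda>n. \<alpha> n * q ^ n)"
  proof (rule summable_comparison_test'[OF sum])
    fix n
    have "\<alpha> n * q ^ n \<le> \<alpha> n * 1" using qn by (intro mult_left_mono) (auto simp: \<alpha>_def)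
    with corner_coeff_term_le[OF assms(1), of n] qn(2)[of n]
    show "norm (\<alpha> n * q ^ n) \<le> 2 * real j ^ 2 * (1 / real (Suc n) ^ 2)"
      by (simp add: \<alpha>_def abs_mult)
  qed
  moreover have "summable (\<lambda>n. \<beta> n * q ^ n)"
  proof (rule summable_comparison_test'[OF sum])
    fix n
    have "\<beta> n * q ^ n \<le> \<beta> n * 1" using qn by (intro mult_left_mono) (auto simp: \<beta>_def)
    with sq_frac_le[OF assms(1), of n] qn(2)[of n]
    show "norm (\<beta> n * q ^ n) \<le> 2 * real j ^ 2 * (1 / real (Suc n) ^ 2)"
      by (simp add: \<beta>_def abs_mult)
  qed
  ultimately have "(\<lambda>n. real j * cos \<theta> * (q ^ n / real n - \<alpha> n * q ^ n) + sin \<theta> * (q ^ n - \<beta> n * q ^ n)) sums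
     (real j * cos \<theta> * (- ln (1 - q) - (\<Sum>n. \<alpha> n * q ^ n)) + sin \<theta> * (1 / (1 - q) - (\<Sum>n. \<beta> n * q ^ n)))"
    using q by (intro sums_add[OF sums_mult[OF sums_diff[OF sums_power_div_nat summable_sums]]
          sums_mult[OF sums_diff[OF geometric_sums summable_sums]]]) auto
  moreover have "real j * cos \<theta> * (q ^ n / real n - \<alpha> n * q ^ n) + sin \<theta> * (q ^ n - \<beta> n * q ^ n) =
      corner_term j n y" for n
  proof -
    have pos: "real j ^ 2 + real n ^ 2 > 0" using assms(1) by (intro add_pos_nonneg) auto
    have 1: "1 - \<beta> n = real n ^ 2 / (real j ^ 2 + real n ^ 2)"
    proof -
      have "1 = (real j ^ 2 + real n ^ 2) / (real j ^ 2 + real n ^ 2)"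
        using less_imp_neq[OF pos] by (metis divide_self)
      thus ?thesis unfolding \<beta>_def by (metis add_diff_cancel_left' diff_divide_distrib)
    qed
    have 2: "1 / real n - \<alpha> n = real n / (real j ^ 2 + real n ^ 2)"
    proof (cases "n = 0")
      case False
      hence "1 / real n - \<alpha> n = 1 / real n * (1 - \<beta> n)"
        by (simp add: \<alpha>_def \<beta>_def right_diff_distrib)
      thus ?thesis unfolding 1 using False by (simp add: power2_eq_square)
    qed (simp add: \<alpha>_def)
    have "real j * cos \<theta> * (q ^ n / real n - \<alpha> n * q ^ n) + sin \<theta> * (q ^ n - \<beta> n * q ^ n) =
      real j * cos \<theta> * (1 / real n - \<alpha> n) * q ^ n + sin \<theta> * (1 - \<beta> n) * q ^ n"
      by (simp add: algebra_simps)
    also have "\<dots> = real n / (real j ^ 2 + real n ^ 2) * q ^ n * (real j * cos \<theta> + real n * sin \<theta>)"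
      unfolding 1 2 by (simp add: algebra_simps power2_eq_square add_divide_distrib)
    also have "\<dots> = corner_term j n y"
      by (simp add: corner_term_def q_def \<theta>_def add.commute)
    finally show ?thesis .
  qed
  ultimately have "corner_row j y = real j * cos \<theta> * (- ln (1 - q) - (\<Sum>n. \<alpha> n * q ^ n)) +
      sin \<theta> * (1 / (1 - q) - (\<Sum>n. \<beta> n * q ^ n))"
    by (simp add: corner_row_def sums_iff)
  thus ?thesis unfolding \<alpha>_def \<beta>_def by (simp add: algebra_simps)
qed

text \<open>One neighbourhood of 0, independent of \<open>j\<close>, on which the rows are dominated
  for all \<open>j\<close> at once. The first quotient tends to \<open>1 / (2 * pi)\<close>, which
  is below 1.\<close>

lemma eventually_near_0:
  "eventually (\<lambda>y::real. y > 0 \<and> y / (1 - exp (- 2 * pi * y)) \<le> 1 \<and>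
     y\<^sup>2 * \<bar>ln (1 - exp (- 2 * pi * y))\<bar> \<le> 1) (at_right 0)"
proof (intro eventually_conj)
  show "eventually (\<lambda>y::real. y > 0) (at_right 0)" by (simp add: eventually_at_right_less)
  have "((\<lambda>y::real. y / (1 - exp (- 2 * pi * y))) \<longlongrightarrow> 1 / (2 * pi)) (at_right 0)"
    by real_asymp (simp add: field_simps)
  moreover have "1 / (2 * pi) < 1" using pi_gt3 by simp
  ultimately have "eventually (\<lambda>y::real. y / (1 - exp (- 2 * pi * y)) < 1) (at_right 0)"
    by (rule order_tendstoD(2))
  thus "eventually (\<lambda>y::real. y / (1 - exp (- 2 * pi * y)) \<le> 1) (at_right 0)"
    by (rule eventually_mono) simp
  have "((\<lambda>y::real. y\<^sup>2 * \<bar>ln (1 - exp (- 2 * pi * y))\<bar>) \<longlongrightarrow> 0) (at_right 0)" by real_asymp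
  hence "eventually (\<lambda>y::real. y\<^sup>2 * \<bar>ln (1 - exp (- 2 * pi * y))\<bar> < 1) (at_right 0)"
    by (rule order_tendstoD(2)) simp
  thus "eventually (\<lambda>y::real. y\<^sup>2 * \<bar>ln (1 - exp (- 2 * pi * y))\<bar> \<le> 1) (at_right 0)"
    by (rule eventually_mono) simp
qed

lemma abs_suminf_le:
  fixes f g :: "nat \<Rightarrow> real"
  assumes "\<And>n. \<bar>f n\<bar> \<le> g n" "g sums s"
  shows "\<bar>suminf f\<bar> \<le> s"
proof -
  have f: "summable (\<lambda>n. \<bar>f n\<bar>)"
    by (rule summable_comparison_test'[OF sums_summable[OF assms(2)]]) (use assms(1) in simp)
  have "\<bar>suminf f\<bar> \<le> (\<Sum>n. \<bar>f n\<bar>)" by (rule summable_rabs[OF f])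
  also have "\<dots> \<le> (\<Sum>n. g n)" by (intro suminf_le f assms(1) sums_summable[OF assms(2)])
  finally show ?thesis using assms(2) by (simp add: sums_iff)
qed

lemma one_minus_cos_le: "\<bar>1 - cos (x::real)\<bar> \<le> x\<^sup>2 / 2"
proof -
  have "1 - cos x = 2 * (sin (x / 2))\<^sup>2" using cos_double_sin[of "x / 2"] by simp
  moreover have "(sin (x / 2))\<^sup>2 \<le> (x / 2)\<^sup>2"
    using abs_sin_x_le_abs_x[of "x / 2"] unfolding abs_le_square_iff .
  ultimately show ?thesis by (simp add: power_divide)
qed

text \<open>In the row expansion \<open>1 - cos\<close> is quadratic in \<open>y\<close> and kills
  the logarithm, the \<open>\<alpha>\<close>-series tends to \<open>corner_coeff j\<close>, and the
  bounded \<open>\<beta>\<close>-series is multiplied by a sine that tends to 0. The quotient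
  \<open>sin (2 * pi * j * y) / (1 - exp (- 2 * pi * y))\<close> tends to \<open>j\<close>; this is
  the origin of the -1 beside the logarithms in the theorem.\<close>

lemma corner_row_asymptotics:
  assumes "j \<ge> 1"
  shows "((\<lambda>y. corner_row j y + real j * ln (1 - exp (- 2 * pi * y))) \<longlongrightarrow>
           real j - real j * corner_coeff j) (at_right 0)"
proof -
  define \<alpha> where "\<alpha> n = real j ^ 2 / (real n * (real j ^ 2 + real n ^ 2))" for n
  define \<beta> where "\<beta> n = real j ^ 2 / (real j ^ 2 + real n ^ 2)" for n
  have lim: "((\<lambda>y. \<Sum>n. c n * exp (- 2 * pi * y) ^ n) \<longlongrightarrow> suminf c) (at_right 0)"
    if c: "\<And>n. c n \<ge> 0" "\<And>n. c n \<le> 2 * real j ^ 2 * (1 / real (Suc n) ^ 2)" for c :: "nat \<Rightarrow> real"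
  proof (rule dominated_series_tendsto(1))
    show "((\<lambda>y. c n * exp (- 2 * pi * y) ^ n) \<longlongrightarrow> c n) (at_right 0)" for n
    proof -
      have "((\<lambda>y. c n * exp (- 2 * pi * y) ^ n) \<longlongrightarrow> c n * exp (- 2 * pi * 0) ^ n) (at_right 0)"
        by (intro tendsto_intros)
      thus ?thesis by simp
    qed
    show "summable (\<lambda>n. 2 * real j ^ 2 * (1 / real (Suc n) ^ 2))"
      by (intro summable_mult sums_summable[OF sums_inverse_Suc_squares])
    show "eventually (\<lambda>y. \<forall>n. norm (c n * exp (- 2 * pi * y) ^ n) \<le> 2 * real j ^ 2 * (1 / real (Suc n) ^ 2)) (at_right 0)"
      using eventually_at_right_less[of "0::real"]
    proof eventually_elim
      case (elim y)
      have "c n * exp (- 2 * pi * y) ^ n \<le> c n * 1" for n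
        using elim c by (intro mult_left_mono power_le_one) auto
      with c show ?case by (auto simp: abs_mult intro: order_trans)
    qed
  qed simp
  have \<alpha>: "((\<lambda>y. \<Sum>n. \<alpha> n * exp (- 2 * pi * y) ^ n) \<longlongrightarrow> corner_coeff j) (at_right 0)"
    unfolding corner_coeff_def \<alpha>_def using corner_coeff_term_le[OF assms] by (intro lim) auto
  have \<beta>: "((\<lambda>y. \<Sum>n. \<beta> n * exp (- 2 * pi * y) ^ n) \<longlongrightarrow> suminf \<beta>) (at_right 0)"
    unfolding \<beta>_def using sq_frac_le[OF assms] by (intro lim) auto
  have ln0: "((\<lambda>y. real j * (1 - cos (2 * pi * real j * y)) * ln (1 - exp (- 2 * pi * y))) \<longlongrightarrow> 0) (at_right 0)"
  proof (rule Lim_null_comparison)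
    have "((\<lambda>y::real. y\<^sup>2 * \<bar>ln (1 - exp (- 2 * pi * y))\<bar>) \<longlongrightarrow> 0) (at_right 0)" by real_asymp
    thus "((\<lambda>y::real. real j * ((2 * pi * real j)\<^sup>2 / 2) * (y\<^sup>2 * \<bar>ln (1 - exp (- 2 * pi * y))\<bar>)) \<longlongrightarrow> 0) (at_right 0)"
      by (rule tendsto_mult_right_zero)
    have "norm (real j * (1 - cos (2 * pi * real j * y)) * L) \<le>
        real j * ((2 * pi * real j)\<^sup>2 / 2) * (y\<^sup>2 * \<bar>L\<bar>)" for y L
    proof -
      have "\<bar>1 - cos (2 * pi * real j * y)\<bar> * (real j * \<bar>L\<bar>) \<le> (2 * pi * real j * y)\<^sup>2 / 2 * (real j * \<bar>L\<bar>)"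
        by (intro mult_right_mono one_minus_cos_le) auto
      thus ?thesis by (simp add: abs_mult power_mult_distrib mult_ac)
    qed
    thus "eventually (\<lambda>y. norm (real j * (1 - cos (2 * pi * real j * y)) * ln (1 - exp (- 2 * pi * y))) \<le>
        real j * ((2 * pi * real j)\<^sup>2 / 2) * (y\<^sup>2 * \<bar>ln (1 - exp (- 2 * pi * y))\<bar>)) (at_right 0)"
      by (intro always_eventually allI)
  qed
  have sin1: "((\<lambda>y. sin (2 * pi * real j * y) / (1 - exp (- 2 * pi * y))) \<longlongrightarrow> real j) (at_right 0)"
  proof -
    define c where "c = real j"
    have "c > 0" using assms by (simp add: c_def)
    hence "((\<lambda>y. sin (2 * pi * c * y) / (1 - exp (- 2 * pi * y))) \<longlongrightarrow> c) (at_right 0)" by real_asymp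
    thus ?thesis by (simp add: c_def)
  qed
  have cos1: "((\<lambda>y. cos (2 * pi * real j * y)) \<longlongrightarrow> 1) (at_right 0)"
    and sin0: "((\<lambda>y. sin (2 * pi * real j * y)) \<longlongrightarrow> 0) (at_right 0)"
    using tendsto_cos[OF tendsto_mult_right[OF tendsto_ident_at], of "2 * pi * real j" 0 "{0<..}"]
      tendsto_sin[OF tendsto_mult_right[OF tendsto_ident_at], of "2 * pi * real j" 0 "{0<..}"]
    by (simp_all add: mult_ac)
  have "((\<lambda>y. real j * (1 - cos (2 * pi * real j * y)) * ln (1 - exp (- 2 * pi * y))
     - real j * cos (2 * pi * real j * y) * (\<Sum>n. \<alpha> n * exp (- 2 * pi * y) ^ n)
     + sin (2 * pi * real j * y) / (1 - exp (- 2 * pi * y))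
     - sin (2 * pi * real j * y) * (\<Sum>n. \<beta> n * exp (- 2 * pi * y) ^ n)) \<longlongrightarrow>
     0 - real j * 1 * corner_coeff j + real j - 0 * suminf \<beta>) (at_right 0)"
    by (intro tendsto_add tendsto_diff tendsto_mult tendsto_const ln0 sin1 cos1 sin0 \<alpha> \<beta>)
  moreover have ev: "eventually (\<lambda>y. corner_row j y + real j * ln (1 - exp (- 2 * pi * y)) =
     real j * (1 - cos (2 * pi * real j * y)) * ln (1 - exp (- 2 * pi * y))
     - real j * cos (2 * pi * real j * y) * (\<Sum>n. \<alpha> n * exp (- 2 * pi * y) ^ n)
     + sin (2 * pi * real j * y) / (1 - exp (- 2 * pi * y))
     - sin (2 * pi * real j * y) * (\<Sum>n. \<beta> n * exp (- 2 * pi * y) ^ n)) (at_right 0)"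
    using eventually_at_right_less[of "0::real"]
    by eventually_elim (simp only: corner_row_expansion[OF assms] \<alpha>_def \<beta>_def)
  moreover have "0 - real j * 1 * corner_coeff j + real j - 0 * suminf \<beta> = real j - real j * corner_coeff j"
    by simp
  ultimately show ?thesis unfolding tendsto_cong[OF ev] by metis
qed

lemma summable_exp_cubic:
  "summable (\<lambda>j. exp (- 2 * pi * real j) * (a * real j ^ 3 + b * real j ^ 2 + c * real j))"
proof -
  have *: "summable (\<lambda>j. exp (- 2 * pi * real j) * real j ^ k)" for k
  proof (rule summable_comparison_test_bigo)
    show "summable (\<lambda>k. norm (1 / real k ^ 2))"
      using inverse_power_summable[of 2, where 'a = real] by (simp add: inverse_eq_divide)
    show "(\<lambda>j. exp (- 2 * pi * real j) * real j ^ k) \<in> O(\<lambda>k. 1 / real k ^ 2)"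
      by real_asymp
  qed
  have "summable (\<lambda>j. a * (exp (- 2 * pi * real j) * real j ^ 3) +
      b * (exp (- 2 * pi * real j) * real j ^ 2) + c * (exp (- 2 * pi * real j) * real j ^ 1))"
    by (intro summable_add summable_mult *)
  thus ?thesis by (simp add: algebra_simps)
qed

lemma corner_row_0: "corner_row 0 y = 0"
  by (simp add: corner_row_def corner_term_def)

lemma corner_coeff_0: "corner_coeff 0 = 0"
  by (simp add: corner_coeff_def)

text \<open>The general \<open>c\<close> covers both correction series of the row expansion, and
  \<open>q = 1\<close> covers \<open>corner_coeff\<close> itself. The 4 comes from
  \<open>pi^2 / 6 \<le> 2\<close>.\<close>

lemma corner_coeff_bound:
  fixes c :: "nat \<Rightarrow> real"
  assumes "\<And>n. c n \<ge> 0" "\<And>n. c n \<le> 2 * real j ^ 2 * (1 / real (Suc n) ^ 2)" "0 \<le> q" "q \<le> 1"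
  shows "\<bar>\<Sum>n. c n * q ^ n\<bar> \<le> 4 * real j ^ 2"
proof -
  have "\<bar>\<Sum>n. c n * q ^ n\<bar> \<le> 2 * real j ^ 2 * (pi\<^sup>2 / 6)"
  proof (rule abs_suminf_le)
    fix n
    have "c n * q ^ n \<le> c n * 1" using assms by (intro mult_left_mono power_le_one)
    with assms(2)[of n] have "c n * q ^ n \<le> 2 * real j ^ 2 * (1 / real (Suc n) ^ 2)" by linarith
    thus "\<bar>c n * q ^ n\<bar> \<le> 2 * real j ^ 2 * (1 / real (Suc n) ^ 2)"
      using assms(1)[of n] assms(3) by simp
  qed (intro sums_mult sums_inverse_Suc_squares)
  also have "pi\<^sup>2 \<le> 3.2\<^sup>2" using pi_approx by (intro power_mono) auto
  hence "pi\<^sup>2 / 6 \<le> 2" by (simp add: power2_eq_square)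
  hence "2 * real j ^ 2 * (pi\<^sup>2 / 6) \<le> 2 * real j ^ 2 * 2" by (intro mult_left_mono) auto
  finally show ?thesis by simp
qed

text \<open>Polynomial growth in \<open>j\<close>, uniform in \<open>y\<close>, suffices against
  \<open>exp (- 2 * pi * j)\<close>. The cubic terms come from \<open>j * (1 - cos \<theta>)\<close>
  with \<open>1 - cos \<theta> \<le> \<theta>^2 / 2\<close>, and from \<open>j\<close> times the
  quadratic bound for the series \<open>a\<close>.\<close>

lemma corner_row_near_0:
  assumes "y > 0" "y / (1 - exp (- 2 * pi * y)) \<le> 1" "y\<^sup>2 * \<bar>ln (1 - exp (- 2 * pi * y))\<bar> \<le> 1"
  shows "\<bar>corner_row j y + real j * ln (1 - exp (- 2 * pi * y))\<bar> \<le>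
     (2 * pi\<^sup>2 + 4) * real j ^ 3 + 4 * real j ^ 2 + 2 * pi * real j"
proof (cases "j = 0")
  case False
  hence j: "j \<ge> 1" by simp
  define q where "q = exp (- 2 * pi * y)"
  define \<theta> where "\<theta> = 2 * pi * real j * y"
  define a where "a = (\<Sum>n. real j ^ 2 / (real n * (real j ^ 2 + real n ^ 2)) * q ^ n)"
  define b where "b = (\<Sum>n. real j ^ 2 / (real j ^ 2 + real n ^ 2) * q ^ n)"
  have q: "0 \<le> q" "q < 1" using assms(1) by (auto simp: q_def)
  have a: "\<bar>a\<bar> \<le> 4 * real j ^ 2" unfolding a_def
    using corner_coeff_term_le[OF j] q by (intro corner_coeff_bound) auto
  have b: "\<bar>b\<bar> \<le> 4 * real j ^ 2" unfolding b_def
    using sq_frac_le[OF j] q by (intro corner_coeff_bound) auto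
  have 1: "\<bar>real j * (1 - cos \<theta>) * ln (1 - q)\<bar> \<le> 2 * pi\<^sup>2 * real j ^ 3"
  proof -
    have "\<bar>real j * (1 - cos \<theta>) * ln (1 - q)\<bar> = \<bar>1 - cos \<theta>\<bar> * (real j * \<bar>ln (1 - q)\<bar>)"
      by (simp add: abs_mult)
    also have "\<dots> \<le> \<theta>\<^sup>2 / 2 * (real j * \<bar>ln (1 - q)\<bar>)"
      by (intro mult_right_mono one_minus_cos_le) auto
    also have "\<dots> = 2 * pi\<^sup>2 * real j ^ 3 * (y\<^sup>2 * \<bar>ln (1 - q)\<bar>)"
      by (simp add: \<theta>_def power2_eq_square power3_eq_cube)
    also have "\<dots> \<le> 2 * pi\<^sup>2 * real j ^ 3 * 1"
      using assms(3) by (intro mult_left_mono) (auto simp: q_def)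
    finally show ?thesis by simp
  qed
  have 2: "\<bar>real j * cos \<theta> * a\<bar> \<le> 4 * real j ^ 3"
  proof -
    have "\<bar>real j * cos \<theta> * a\<bar> = real j * (\<bar>cos \<theta>\<bar> * \<bar>a\<bar>)" by (simp add: abs_mult)
    also have "\<dots> \<le> real j * (1 * (4 * real j ^ 2))"
      by (intro mult_left_mono mult_mono a abs_cos_le_one) auto
    finally show ?thesis by (simp add: power2_eq_square power3_eq_cube)
  qed
  have 3: "\<bar>sin \<theta> / (1 - q)\<bar> \<le> 2 * pi * real j"
  proof -
    have "\<bar>sin \<theta> / (1 - q)\<bar> = \<bar>sin \<theta>\<bar> / (1 - q)" using q by simp
    also have "\<dots> \<le> \<theta> / (1 - q)"
      using abs_sin_x_le_abs_x[of \<theta>] q assms(1) by (intro divide_right_mono) (auto simp: \<theta>_def)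
    also have "\<dots> = 2 * pi * real j * (y / (1 - q))" by (simp add: \<theta>_def)
    also have "\<dots> \<le> 2 * pi * real j * 1" using assms(2) by (intro mult_left_mono) (auto simp: q_def)
    finally show ?thesis by simp
  qed
  have 4: "\<bar>sin \<theta> * b\<bar> \<le> 1 * (4 * real j ^ 2)"
    unfolding abs_mult by (intro mult_mono b abs_sin_le_one) auto
  have "corner_row j y + real j * ln (1 - q) =
     real j * (1 - cos \<theta>) * ln (1 - q) - real j * cos \<theta> * a + sin \<theta> / (1 - q) - sin \<theta> * b"
    unfolding a_def b_def q_def \<theta>_def by (rule corner_row_expansion[OF j assms(1)])
  moreover have "(2 * pi\<^sup>2 + 4) * real j ^ 3 = 2 * pi\<^sup>2 * real j ^ 3 + 4 * real j ^ 3"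
    by (simp add: algebra_simps)
  ultimately show ?thesis using 1 2 3 4 unfolding q_def[symmetric] by linarith
qed (simp add: corner_row_0)

text \<open>This sum collects the singularities \<open>- j * ln (1 - q)\<close> of the rows, where
  \<open>q = exp (- 2 * pi * y)\<close>. Times \<open>4 * pi\<close> it equals
  \<open>sinh_weight m\<close>, the weight of the term with index \<open>m\<close> in
  \<open>log_part\<close>, which is why the two logarithmic singularities cancel.\<close>

lemma sums_exp_nat:
  assumes "m \<ge> 1"
  shows "(\<lambda>j. exp (- 2 * pi * real j * real m) * real j) sums (1 / (4 * (sinh (pi * real m))\<^sup>2))"
proof -
  have "exp (- 2 * pi * real m) ^ j = exp (- 2 * pi * real j * real m)" for j
    by (rule exp_2pi_power)
  thus ?thesis using sums_nat_mult_exp[of "real m"] assms by (simp add: mult.commute)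
qed

lemma corner_coeff_le: "\<bar>corner_coeff j\<bar> \<le> 4 * real j ^ 2"
proof (cases "j = 0")
  case False
  hence "j \<ge> 1" by simp
  thus ?thesis
    using corner_coeff_bound[of "\<lambda>n. real j ^ 2 / (real n * (real j ^ 2 + real n ^ 2))" j 1]
      corner_coeff_term_le by (simp add: corner_coeff_def)
qed (simp add: corner_coeff_0)

lemma summable_corner_coeff_exp:
  assumes "m \<ge> 1"
  shows "summable (\<lambda>j. exp (- 2 * pi * real j * real m) * (real j * corner_coeff j))"
proof (rule summable_exp_mult(2)[OF assms _ summable_exp_cubic[of 4 0 0]])
  show "\<bar>real j * corner_coeff j\<bar> \<le> 4 * real j ^ 3 + 0 * real j ^ 2 + 0 * real j" for j
    using mult_left_mono[OF corner_coeff_le[of j], of "real j"]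
    by (simp add: abs_mult power2_eq_square power3_eq_cube)
qed

lemma corner_sum_asymptotics:
  assumes "m \<ge> 1"
  shows "((\<lambda>y. corner_sum m y + sinh_weight m * ln (1 - exp (- 2 * pi * y))) \<longlongrightarrow>
     sinh_weight m - 4 * pi * (\<Sum>j. exp (- 2 * pi * real j * real m) * (real j * corner_coeff j))) (at_right 0)"
proof -
  define e where "e j = exp (- 2 * pi * real j * real m)" for j
  define h where "h j y = corner_row j y + real j * ln (1 - exp (- 2 * pi * y))" for j y
  have "((\<lambda>y. \<Sum>j. e j * h j y) \<longlongrightarrow> (\<Sum>j. e j * (real j - real j * corner_coeff j))) (at_right 0)"
  proof (rule dominated_series_tendsto(1))
    show "((\<lambda>y. e j * h j y) \<longlongrightarrow> e j * (real j - real j * corner_coeff j)) (at_right 0)" for j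
    proof (cases "j = 0")
      case False
      thus ?thesis unfolding h_def by (intro tendsto_mult_left corner_row_asymptotics) simp
    qed (simp add: h_def corner_row_0)
    show "eventually (\<lambda>y. \<forall>j. norm (e j * h j y) \<le> exp (- 2 * pi * real j) *
        ((2 * pi\<^sup>2 + 4) * real j ^ 3 + 4 * real j ^ 2 + 2 * pi * real j)) (at_right 0)"
      using eventually_near_0
    proof eventually_elim
      case (elim y)
      hence "\<bar>h j y\<bar> \<le> (2 * pi\<^sup>2 + 4) * real j ^ 3 + 4 * real j ^ 2 + 2 * pi * real j" for j
        unfolding h_def by (intro corner_row_near_0) auto
      from summable_exp_mult(1)[where g = "\<lambda>j. h j y", OF assms this summable_exp_cubic]
      show ?case unfolding e_def real_norm_def by blast
    qed
  qed (rule summable_exp_cubic, simp)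
  also have "(\<Sum>j. e j * (real j - real j * corner_coeff j)) =
      1 / (4 * (sinh (pi * real m))\<^sup>2) - (\<Sum>j. e j * (real j * corner_coeff j))"
    using sums_diff[OF sums_exp_nat[OF assms] summable_sums[OF summable_corner_coeff_exp[OF assms]]]
    by (simp add: e_def sums_iff right_diff_distrib)
  finally have "((\<lambda>y. 4 * pi * (\<Sum>j. e j * h j y)) \<longlongrightarrow>
      4 * pi * (1 / (4 * (sinh (pi * real m))\<^sup>2) - (\<Sum>j. e j * (real j * corner_coeff j)))) (at_right 0)"
    by (rule tendsto_mult_left)
  also have "4 * pi * (1 / (4 * (sinh (pi * real m))\<^sup>2) - (\<Sum>j. e j * (real j * corner_coeff j))) =
     sinh_weight m - 4 * pi * (\<Sum>j. e j * (real j * corner_coeff j))"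
    by (simp add: sinh_weight_def right_diff_distrib)
  finally have lim: "((\<lambda>y. 4 * pi * (\<Sum>j. e j * h j y)) \<longlongrightarrow>
     sinh_weight m - 4 * pi * (\<Sum>j. e j * (real j * corner_coeff j))) (at_right 0)" .
  have ev: "eventually (\<lambda>y. corner_sum m y + sinh_weight m * ln (1 - exp (- 2 * pi * y)) =
      4 * pi * (\<Sum>j. e j * h j y)) (at_right 0)"
    using eventually_at_right_less[of "0::real"]
  proof eventually_elim
    case (elim y)
    define L where "L = ln (1 - exp (- 2 * pi * y))"
    have "summable (\<lambda>j. e j * corner_row j y)" unfolding e_def
      by (rule summable_exp_mult(2)[OF assms corner_row_bound[OF elim] summable_exp_const])
    from sums_add[OF summable_sums[OF this] sums_mult2[OF sums_exp_nat[OF assms], of L, folded e_def]]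
    have "(\<Sum>j. e j * h j y) = (\<Sum>j. e j * corner_row j y) + 1 / (4 * (sinh (pi * real m))\<^sup>2) * L"
      by (simp add: sums_iff h_def L_def distrib_left mult.assoc)
    thus ?case unfolding corner_sum_def sinh_weight_def L_def e_def by (simp add: distrib_left)
  qed
  show ?thesis using lim unfolding tendsto_cong[OF ev] e_def .
qed

section \<open>The integrated pole expansion\<close>

text \<open>\<open>Digamma (w + 1)\<close> grows like \<open>ln w\<close>; subtracting the real part
  of this logarithm makes the difference vanish at infinity.\<close>

definition psi_part :: "nat \<Rightarrow> real \<Rightarrow> real" where
  "psi_part m y = Re (Digamma (vline m y + 1)) - ln (norm (vline m y))"

definition pole_part :: "nat \<Rightarrow> real \<Rightarrow> real" where
  "pole_part m y = (\<Sum>k. BE_weight k * pole_term m k y)"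

definition log_part :: "nat \<Rightarrow> real \<Rightarrow> real" where
  "log_part m y = (\<Sum>k. sinh_weight k * log_term m k y)"

text \<open>
  An antiderivative of the pole expansion would also contain a multiple of \<open>ln |w|\<close>, with
  coefficient \<open>2 \<pi> / 3 - 2\<close> minus four times the sum of \<open>sinh_weight\<close>. This coefficient turns
  out to be 0, since otherwise the two antiderivatives could not both vanish at infinity.
\<close>

definition pole_sum :: "nat \<Rightarrow> real \<Rightarrow> real" where
  "pole_sum m y = Re (1 / vline m y) - Re (1 / (2 * of_real pi * (vline m y)\<^sup>2)) - 2 * psi_part m y
     + pole_part m y - log_part m y"

lemma vline_notin_Ints:
  assumes "m \<ge> 1" "y > 0"
  shows "vline m y \<notin> \<int>" "\<i> * vline m y \<notin> \<int>" "vline m y + 1 \<notin> \<int>\<^sub>\<le>\<^sub>0"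
  using assms by (auto simp: complex_is_Int_iff elim!: nonpos_Ints_cases simp: complex_eq_iff)

lemma sin_pi_vline: "(of_real pi / sin (of_real pi * vline m y))\<^sup>2 = - of_real ((pi / sinh (pi * y))\<^sup>2)"
proof -
  have "of_real pi * vline m y = of_real (pi * real m) + \<i> * of_real (pi * y)"
    by (simp add: vline_eq algebra_simps)
  hence "sin (of_real pi * vline m y) =
     of_real (sin (pi * real m)) * cos (\<i> * of_real (pi * y)) +
     of_real (cos (pi * real m)) * sin (\<i> * of_real (pi * y))"
    by (simp only: sin_add sin_of_real cos_of_real)
  also have "sin (\<i> * of_real (pi * y)) = \<i> * of_real (sinh (pi * y))"
    by (simp add: sinh_field_def sin_exp_eq exp_of_real[symmetric] field_simps)
  also have "sin (pi * real m) = 0" by (simp add: sin_npi2)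
  finally have "sin (of_real pi * vline m y) = of_real (cos (pi * real m)) * (\<i> * of_real (sinh (pi * y)))"
    by simp
  moreover have "(cos (pi * real m))\<^sup>2 = 1"
    by (simp add: cos_npi2 flip: power_mult)
  hence "(of_real (cos (pi * real m)))\<^sup>2 = (1 :: complex)" by (metis of_real_1 of_real_power)
  ultimately show ?thesis by (simp add: power_divide power_mult_distrib)
qed

lemma weights_0: "BE_weight 0 = 0" "sinh_weight 0 = 0"
  by (simp_all add: BE_weight_def sinh_weight_def)

text \<open>The complex expansion is multiplied by \<open>\<i> / pi\<close>. As
  \<open>pi^2 / sin^2\<close> is real on the line, it factors out of the real part. The index 0,
  where both weights vanish, is added.\<close>

lemma pole_expansion_real:
  assumes "m \<ge> 1" "y > 0"
  defines "w \<equiv> vline m y"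
  shows "(\<lambda>k. BE_weight k * Re (\<i> * (4 * w * of_nat k / (w\<^sup>2 - of_nat k ^ 2)\<^sup>2)) -
            sinh_weight k * Re (\<i> * (2 * w / (w\<^sup>2 - of_nat k ^ 2) + 2 * w / (w\<^sup>2 + of_nat k ^ 2)))) sums
     (- 2 * pi\<^sup>2 / (sinh (pi * y))\<^sup>2 * Re (\<i> / (exp (2 * of_real pi * w) - 1))
      - Re (\<i> * (1 / w ^ 3)) / pi - 2 * pi / 3 * Re (\<i> * (1 / w)) + Re (\<i> * (1 / w\<^sup>2))
      + 2 * Re (\<i> * Polygamma 1 (w + 1)))"
proof -
  define F where "F k = BE_weight k * Re (\<i> * (4 * w * of_nat k / (w\<^sup>2 - of_nat k ^ 2)\<^sup>2)) -
    sinh_weight k * Re (\<i> * (2 * w / (w\<^sup>2 - of_nat k ^ 2) + 2 * w / (w\<^sup>2 + of_nat k ^ 2)))" for k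
  have F0: "F 0 = 0" by (simp add: F_def weights_0)
  note sums_mult[OF cosecant_coth_expansion[OF vline_notin_Ints(1,2)[OF assms(1,2)], folded w_def], of "\<i> / of_real pi"]
  note sums_Re[OF this]
  also have "(\<lambda>k. Re (\<i> / of_real pi * (of_real (2 * pi / (exp (2 * pi * real (Suc k)) - 1)) *
              (4 * w * of_nat (Suc k) / (w\<^sup>2 - of_nat (Suc k) ^ 2)\<^sup>2) -
            of_real ((pi / sinh (pi * real (Suc k)))\<^sup>2) *
              (2 * w / (w\<^sup>2 - of_nat (Suc k) ^ 2) + 2 * w / (w\<^sup>2 + of_nat (Suc k) ^ 2))))) =
     (\<lambda>k. F (Suc k))"
  proof
    fix k
    have gen: "Re (\<i> / of_real pi * (of_real (2 * pi / b) * r - of_real ((pi / s)\<^sup>2) * u)) =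
       2 / b * Re (\<i> * r) - pi / s\<^sup>2 * Re (\<i> * u)" for b s :: real and r u :: complex
      by (simp add: Re_divide power2_eq_square right_diff_distrib)
    show "Re (\<i> / of_real pi * (of_real (2 * pi / (exp (2 * pi * real (Suc k)) - 1)) *
              (4 * w * of_nat (Suc k) / (w\<^sup>2 - of_nat (Suc k) ^ 2)\<^sup>2) -
            of_real ((pi / sinh (pi * real (Suc k)))\<^sup>2) *
              (2 * w / (w\<^sup>2 - of_nat (Suc k) ^ 2) + 2 * w / (w\<^sup>2 + of_nat (Suc k) ^ 2)))) = F (Suc k)"
      unfolding gen F_def BE_weight_def sinh_weight_def ..
  qed
  finally have "(\<lambda>k. F (Suc k)) sums Re (\<i> / of_real pi *
      ((of_real pi / sin (of_real pi * w))\<^sup>2 * (2 * of_real pi / (exp (2 * of_real pi * w) - 1))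
       - 1 / w ^ 3 - 2 * of_real pi ^ 2 / (3 * w) + of_real pi / w\<^sup>2 + 2 * of_real pi * Polygamma 1 (w + 1)))" .
  also have "Re (\<i> / of_real pi *
      ((of_real pi / sin (of_real pi * w))\<^sup>2 * (2 * of_real pi / (exp (2 * of_real pi * w) - 1))
       - 1 / w ^ 3 - 2 * of_real pi ^ 2 / (3 * w) + of_real pi / w\<^sup>2 + 2 * of_real pi * Polygamma 1 (w + 1))) =
     - 2 * pi\<^sup>2 / (sinh (pi * y))\<^sup>2 * Re (\<i> / (exp (2 * of_real pi * w) - 1))
      - Re (\<i> * (1 / w ^ 3)) / pi - 2 * pi / 3 * Re (\<i> * (1 / w)) + Re (\<i> * (1 / w\<^sup>2))
      + 2 * Re (\<i> * Polygamma 1 (w + 1))"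
  proof -
    have rm: "Re (of_real a * z) = a * Re z" for a z by simp
    have "\<i> / of_real pi * (- of_real S * (2 * of_real pi / E) - 1 / w ^ 3 - 2 * of_real pi ^ 2 / (3 * w) + of_real pi / w\<^sup>2
        + 2 * of_real pi * P) =
        of_real (- 2 * S) * (\<i> / E) - \<i> * (1 / w ^ 3) / of_real pi - of_real (2 * pi / 3) * (\<i> * (1 / w))
         + \<i> * (1 / w\<^sup>2) + of_real 2 * (\<i> * P)" for S :: real and E P
      by (simp add: algebra_simps power2_eq_square)
    note this[of "(pi / sinh (pi * y))\<^sup>2" "exp (2 * of_real pi * w) - 1" "Polygamma 1 (w + 1)"]
    hence "Re (\<i> / of_real pi *
      ((of_real pi / sin (of_real pi * w))\<^sup>2 * (2 * of_real pi / (exp (2 * of_real pi * w) - 1))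
       - 1 / w ^ 3 - 2 * of_real pi ^ 2 / (3 * w) + of_real pi / w\<^sup>2 + 2 * of_real pi * Polygamma 1 (w + 1))) =
      Re (of_real (- 2 * (pi / sinh (pi * y))\<^sup>2) * (\<i> / (exp (2 * of_real pi * w) - 1)) - \<i> * (1 / w ^ 3) / of_real pi - of_real (2 * pi / 3) * (\<i> * (1 / w))
         + \<i> * (1 / w\<^sup>2) + of_real 2 * (\<i> * Polygamma 1 (w + 1)))"
      unfolding w_def sin_pi_vline by (rule arg_cong)
    also have "\<dots> = - 2 * (pi / sinh (pi * y))\<^sup>2 * Re (\<i> / (exp (2 * of_real pi * w) - 1)) - Re (\<i> * (1 / w ^ 3)) / pi
      - 2 * pi / 3 * Re (\<i> * (1 / w)) + Re (\<i> * (1 / w\<^sup>2)) + 2 * Re (\<i> * Polygamma 1 (w + 1))"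
      by (simp only: plus_complex.sel minus_complex.sel rm Re_divide_of_real)
    finally show ?thesis by (simp add: power_divide)
  qed
  finally show ?thesis unfolding sums_Suc_iff F0 add_0_right unfolding F_def [abs_def] .
qed

text \<open>Common to \<open>pole_part\<close> and \<open>log_part\<close>: the bound on the
  derivatives does not depend on \<open>k\<close> and decreases in \<open>y\<close>, so
  \<open>c k * b \<delta>\<close> is a majorant on the ray from \<open>\<delta>\<close>.\<close>

lemma series_part_deriv:
  fixes c :: "nat \<Rightarrow> real"
  assumes "\<And>k y. y > 0 \<Longrightarrow> (t k has_real_derivative t' k y) (at y)"
    and "\<And>k y. y > 0 \<Longrightarrow> \<bar>t' k y\<bar> \<le> b y" "\<And>y z. 0 < y \<Longrightarrow> y \<le> z \<Longrightarrow> b z \<le> b y"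
    and "\<And>k. c k \<ge> 0" "summable c" "\<And>y. y > 0 \<Longrightarrow> summable (\<lambda>k. c k * t k y)" "y > 0"
  shows "((\<lambda>y. \<Sum>k. c k * t k y) has_real_derivative (\<Sum>k. c k * t' k y)) (at y)"
    "summable (\<lambda>k. c k * t' k y)"
proof -
  have bd: "\<bar>c k * t' k z\<bar> \<le> c k * b y" if "0 < y" "y \<le> z" for k y z
    using assms(2)[of z k] assms(3)[OF that] assms(4)[of k] that
    by (auto simp: abs_mult intro!: mult_left_mono)
  show "((\<lambda>y. \<Sum>k. c k * t k y) has_real_derivative (\<Sum>k. c k * t' k y)) (at y)"
  proof (rule has_real_derivative_suminf_pos[OF DERIV_cmult[OF assms(1)] _ assms(6) assms(7)])
    fix \<delta> :: real assume "\<delta> > 0"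
    thus "\<exists>M. summable M \<and> (\<forall>k. \<forall>y\<ge>\<delta>. \<bar>c k * t' k y\<bar> \<le> M k)"
      by (intro exI[of _ "\<lambda>k. c k * b \<delta>"] conjI allI impI bd summable_mult2 assms(5)) auto
  qed
  show "summable (\<lambda>k. c k * t' k y)"
    by (rule summable_comparison_test'[OF summable_mult2[OF assms(5), of "b y"]])
       (use bd[of y y] assms(7) in simp)
qed

lemma summable_pole_part:
  assumes "m \<ge> 1" "y > 0"
  shows "summable (\<lambda>k. BE_weight k * pole_term m k y)"
proof (rule summable_comparison_test_ev)
  show "summable (\<lambda>k. BE_weight k * 2)" by (intro summable_mult2 summable_BE_weight)
  show "eventually (\<lambda>k. norm (BE_weight k * pole_term m k y) \<le> BE_weight k * 2) sequentially"
    using eventually_gt_at_top[of m]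
  proof eventually_elim
    case (elim k)
    have "\<bar>pole_term m k y\<bar> \<le> 2"
      using elim pole_term_bound[of 1 m y k] norm_vline_diff_ge_1[of k m y] norm_vline_ge(2)[OF assms(1), of y k]
      by simp
    thus ?case using BE_weight_nonneg[of k] by (simp add: abs_mult mult_left_mono)
  qed
qed

lemma summable_log_part:
  assumes "m \<ge> 1" "y > 0"
  shows "summable (\<lambda>k. sinh_weight k * log_term m k y)"
proof (rule summable_comparison_test_ev)
  show "summable (\<lambda>k. sinh_weight k * real k * 4)" by (intro summable_mult2 summable_sinh_weight_mult)
  show "eventually (\<lambda>k. norm (sinh_weight k * log_term m k y) \<le> sinh_weight k * real k * 4) sequentially"
    using eventually_gt_at_top[of m]
  proof eventually_elim
    case (elim k)
    have "\<bar>log_term m k y\<bar> \<le> 4 * real k"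
      using elim by (intro log_term_bound norm_vline_diff_ge_1 assms) auto
    from mult_left_mono[OF this sinh_weight_nonneg[of k]] show ?case
      using sinh_weight_nonneg[of k] by (simp add: abs_mult mult_ac)
  qed
qed

lemma ln_norm_vline_deriv:
  assumes "m \<ge> 1"
  shows "((\<lambda>y. ln (norm (vline m y))) has_real_derivative Re (\<i> * (1 / vline m y))) (at y)"
  using has_real_derivative_ln_norm_vline[of m y 0] vline_nonzero[OF assms] by simp

text \<open>The coefficient of \<open>Re (\<i> * (1 / w))\<close> collects 2 from the logarithm in
  \<open>psi_part\<close>, \<open>- 2 * pi / 3\<close> from the simple pole at 0 in the expansion,
  and \<open>4 * suminf sinh_weight\<close> from the normalisation of
  \<open>log_term\<close>.\<close>

lemma pole_sum_deriv:
  assumes "m \<ge> 1" "y > 0"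
  shows "(pole_sum m has_real_derivative
     - 2 * pi\<^sup>2 / (sinh (pi * y))\<^sup>2 * Re (\<i> / (exp (2 * of_real pi * vline m y) - 1))
     + (2 - 2 * pi / 3 + 4 * suminf sinh_weight) * Re (\<i> * (1 / vline m y))) (at y)"
proof -
  define w where "w = vline m y"
  have w0: "w \<noteq> 0" using vline_nonzero[OF assms(1)] by (simp add: w_def)
  define r where "r k = Re (\<i> * (4 * w * of_nat k / (w\<^sup>2 - of_nat k ^ 2)\<^sup>2))" for k
  define u where "u k = Re (\<i> * (2 * w / (w\<^sup>2 - of_nat k ^ 2) + 2 * w / (w\<^sup>2 + of_nat k ^ 2)))" for k
  have d1: "((\<lambda>y. Re (1 / vline m y)) has_real_derivative Re (\<i> * (- (1 / w\<^sup>2)))) (at y)"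
    unfolding w_def
    by (rule has_real_derivative_Re_vline)
       (use w0 in \<open>auto intro!: derivative_eq_intros simp: w_def power2_eq_square\<close>)
  have d2: "((\<lambda>y. Re (1 / (2 * of_real pi * (vline m y)\<^sup>2))) has_real_derivative
      Re (\<i> * (- (1 / w ^ 3) / of_real pi))) (at y)"
  proof -
    have "((\<lambda>z. 1 / (2 * of_real pi * z\<^sup>2)) has_field_derivative (- (1 / w ^ 3) / of_real pi)) (at w)"
      using w0 by (auto intro!: derivative_eq_intros simp: field_simps power2_eq_square power3_eq_cube)
    thus ?thesis unfolding w_def by (rule has_real_derivative_Re_vline)
  qed
  have d3: "(psi_part m has_real_derivative Re (\<i> * Polygamma 1 (w + 1)) - Re (\<i> * (1 / w))) (at y)"
    unfolding psi_part_def [abs_def] w_def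
    by (intro DERIV_diff ln_norm_vline_deriv[OF assms(1)] has_real_derivative_Re_vline)
       (use vline_notin_Ints(3)[OF assms] in \<open>auto intro!: derivative_eq_intros\<close>)
  have d4: "(pole_part m has_real_derivative (\<Sum>k. BE_weight k * r k)) (at y)"
    and s4: "summable (\<lambda>k. BE_weight k * r k)"
  proof -
    note * = pole_term_deriv[OF assms(1)] _ BE_weight_nonneg summable_BE_weight
      summable_pole_part[OF assms(1)] assms(2)
    have mono: "1 / z\<^sup>2 + 1 \<le> 1 / y\<^sup>2 + 1" if "0 < y" "y \<le> z" for y z :: real
      using that by (auto intro!: divide_left_mono power_mono)
    show "(pole_part m has_real_derivative (\<Sum>k. BE_weight k * r k)) (at y)"
      unfolding pole_part_def [abs_def] r_def w_def
      by (rule series_part_deriv(1)[OF *]) (use mono in auto)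
    show "summable (\<lambda>k. BE_weight k * r k)"
      unfolding r_def w_def
      by (rule series_part_deriv(2)[OF *]) (use mono in auto)
  qed
  have d5: "(log_part m has_real_derivative (\<Sum>k. sinh_weight k * (u k - 4 * Re (\<i> * (1 / w))))) (at y)"
    and s5: "summable (\<lambda>k. sinh_weight k * (u k - 4 * Re (\<i> * (1 / w))))"
  proof -
    note * = log_term_deriv[OF assms(1)] _ sinh_weight_nonneg summable_sinh_weight
      summable_log_part[OF assms(1)] assms(2)
    have mono: "1 / z + 7 \<le> 1 / y + 7" if "0 < y" "y \<le> z" for y z :: real
      using that by (auto intro!: divide_left_mono)
    show "(log_part m has_real_derivative (\<Sum>k. sinh_weight k * (u k - 4 * Re (\<i> * (1 / w))))) (at y)"
      unfolding log_part_def [abs_def] u_def w_def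
      by (rule series_part_deriv(1)[OF *]) (use mono in auto)
    show "summable (\<lambda>k. sinh_weight k * (u k - 4 * Re (\<i> * (1 / w))))"
      unfolding u_def w_def
      by (rule series_part_deriv(2)[OF *]) (use mono in auto)
  qed
  have "(\<lambda>k. BE_weight k * r k - sinh_weight k * (u k - 4 * Re (\<i> * (1 / w)))
       - sinh_weight k * (4 * Re (\<i> * (1 / w)))) sums
     ((\<Sum>k. BE_weight k * r k) - (\<Sum>k. sinh_weight k * (u k - 4 * Re (\<i> * (1 / w))))
       - suminf sinh_weight * (4 * Re (\<i> * (1 / w))))"
    by (intro sums_diff summable_sums s4 s5 sums_mult2 summable_sinh_weight)
  hence "(\<lambda>k. BE_weight k * r k - sinh_weight k * u k) sums
     ((\<Sum>k. BE_weight k * r k) - (\<Sum>k. sinh_weight k * (u k - 4 * Re (\<i> * (1 / w))))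
       - suminf sinh_weight * (4 * Re (\<i> * (1 / w))))"
    by (simp add: right_diff_distrib)
  from sums_unique2[OF this pole_expansion_real[OF assms, folded w_def, folded r_def u_def]]
  have eq: "(\<Sum>k. BE_weight k * r k) - (\<Sum>k. sinh_weight k * (u k - 4 * Re (\<i> * (1 / w)))) =
     - 2 * pi\<^sup>2 / (sinh (pi * y))\<^sup>2 * Re (\<i> / (exp (2 * of_real pi * w) - 1))
      - Re (\<i> * (1 / w ^ 3)) / pi - 2 * pi / 3 * Re (\<i> * (1 / w)) + Re (\<i> * (1 / w\<^sup>2))
      + 2 * Re (\<i> * Polygamma 1 (w + 1)) + suminf sinh_weight * (4 * Re (\<i> * (1 / w)))"
    by linarith
  have D: "(pole_sum m has_real_derivative Re (\<i> * (- (1 / w\<^sup>2))) - Re (\<i> * (- (1 / w ^ 3) / of_real pi))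
     - 2 * (Re (\<i> * Polygamma 1 (w + 1)) - Re (\<i> * (1 / w)))
     + (\<Sum>k. BE_weight k * r k) - (\<Sum>k. sinh_weight k * (u k - 4 * Re (\<i> * (1 / w))))) (at y)"
    unfolding pole_sum_def [abs_def]
    by (intro DERIV_add DERIV_diff DERIV_cmult d1 d2 d3 d4 d5)
  have e1: "Re (\<i> * (- (1 / w\<^sup>2))) = - Re (\<i> * (1 / w\<^sup>2))" by simp
  have e2: "Re (\<i> * (- (1 / w ^ 3) / of_real pi)) = - (Re (\<i> * (1 / w ^ 3)) / pi)"
  proof -
    have "\<i> * (- (1 / w ^ 3) / of_real pi) = - (\<i> * (1 / w ^ 3)) / of_real pi" by simp
    thus ?thesis by (simp only: Re_divide_of_real uminus_complex.sel minus_divide_left)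
  qed
  have e3: "(2 - 2 * pi / 3 + 4 * suminf sinh_weight) * Re (\<i> * (1 / w)) =
     2 * Re (\<i> * (1 / w)) - 2 * pi / 3 * Re (\<i> * (1 / w)) + suminf sinh_weight * (4 * Re (\<i> * (1 / w)))"
    by (simp only: ring_distribs mult_ac)
  have combine: "a1 = - b1 \<Longrightarrow> a2 = - b2 \<Longrightarrow> c = 2 * p - q + r \<Longrightarrow> S1 - S2 = X - b2 - q + b1 + 2 * P + r \<Longrightarrow>
      a1 - a2 - 2 * (P - p) + S1 - S2 = X + c" for a1 b1 a2 b2 c p q r S1 S2 X P :: real
    by (simp add: algebra_simps)
  show ?thesis unfolding w_def[symmetric]
    by (rule DERIV_cong[OF D combine[OF e1 e2 e3 eq]])
qed

section \<open>Decay of the pole side at infinity, and equality of the two antiderivatives\<close>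

definition psi_term :: "nat \<Rightarrow> nat \<Rightarrow> real \<Rightarrow> real" where
  "psi_term m n y = ln (norm (vline (m + Suc n) y)) - ln (norm (vline (m + n) y)) - Re (1 / vline (m + Suc n) y)"

text \<open>With the squared norms \<open>A\<close> and \<open>B\<close> of consecutive points,
  \<open>B - A = 2 * M + 1\<close>, and \<open>ln (B / A)\<close> lies between
  \<open>(B - A) / B\<close> and \<open>(B - A) / A\<close>. Half of either bound differs from
  \<open>(M + 1) / B\<close> by at most \<open>2 / A\<close> in the relevant direction.\<close>

lemma psi_term_bound:
  assumes "m \<ge> 1"
  shows "\<bar>psi_term m n y\<bar> \<le> 2 / (real (m + n) ^ 2 + y\<^sup>2)"
proof -
  define M where "M = real (m + n)"
  define A where "A = M\<^sup>2 + y\<^sup>2"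
  define B where "B = (M + 1)\<^sup>2 + y\<^sup>2"
  have M: "M \<ge> 1" using assms by (simp add: M_def)
  have A: "A > 0" and B: "B > 0" using M by (auto simp: A_def B_def intro!: add_pos_nonneg)
  have BA: "B = A + 2 * M + 1" by (simp add: A_def B_def power2_eq_square algebra_simps)
  have BM: "B \<ge> (M + 1)\<^sup>2" by (simp add: B_def)
  have eq: "psi_term m n y = (ln B - ln A) / 2 - (M + 1) / B"
  proof -
    have "ln (norm (vline (m + n) y)) = ln A / 2"
      using A by (simp add: cmod_def A_def M_def ln_sqrt)
    moreover have "ln (norm (vline (m + Suc n) y)) = ln B / 2"
      using B by (simp add: cmod_def B_def M_def ln_sqrt algebra_simps)
    moreover have "Re (1 / vline (m + Suc n) y) = (M + 1) / B"
      by (simp add: Re_divide B_def M_def algebra_simps)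
    ultimately show ?thesis by (simp add: psi_term_def)
  qed
  have up: "ln B - ln A \<le> (2 * M + 1) / A"
  proof -
    have "ln B - ln A = ln (B / A)" using A B by (simp add: ln_div)
    also have "\<dots> \<le> B / A - 1" using A B by (intro ln_le_minus_one) simp
    also have "\<dots> = (2 * M + 1) / A" using A by (simp add: BA field_simps)
    finally show ?thesis .
  qed
  have lo: "ln B - ln A \<ge> (2 * M + 1) / B"
  proof -
    have "ln A - ln B = ln (A / B)" using A B by (simp add: ln_div)
    also have "\<dots> \<le> A / B - 1" using A B by (intro ln_le_minus_one) simp
    also have "\<dots> = - (2 * M + 1) / B" using B by (simp add: BA field_simps)
    finally show ?thesis unfolding minus_divide_left[symmetric] by linarith
  qed
  have "psi_term m n y \<le> (2 * M + 1) / A / 2 - (M + 1) / B" unfolding eq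
    using up by (intro diff_right_mono divide_right_mono) auto
  also have "\<dots> = ((2 * M + 1) * B - 2 * (M + 1) * A) / (2 * A * B)"
    using A B by (simp add: field_simps)
  also have "\<dots> \<le> 4 * B / (2 * A * B)"
  proof (intro divide_right_mono)
    have "(2 * M + 1) * B - 2 * (M + 1) * A = (2 * M + 1)\<^sup>2 - A"
      by (simp add: BA algebra_simps power2_eq_square)
    also have "\<dots> \<le> 4 * (M + 1)\<^sup>2" using A M by (simp add: power2_eq_square algebra_simps)
    also have "\<dots> \<le> 4 * B" using BM by simp
    finally show "(2 * M + 1) * B - 2 * (M + 1) * A \<le> 4 * B" .
  qed (use A B in simp)
  also have "\<dots> = 2 / A" using A B by simp
  finally have "psi_term m n y \<le> 2 / A" .
  moreover have "psi_term m n y \<ge> - (2 / A)"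
  proof -
    have "1 / B \<le> 1 / A" using A B M by (intro divide_left_mono) (auto simp: BA)
    moreover have "(2 * M + 1) / B / 2 - (M + 1) / B = - (1 / B) / 2"
      using B by (simp add: field_simps)
    moreover have "psi_term m n y \<ge> (2 * M + 1) / B / 2 - (M + 1) / B" unfolding eq
      using lo by (intro diff_right_mono divide_right_mono) auto
    moreover have "1 / A \<ge> 0" using A by simp
    moreover have "2 / A = 2 * (1 / A)" by simp
    ultimately show ?thesis by argo
  qed
  ultimately show ?thesis unfolding A_def M_def by (simp add: abs_le_iff)
qed

text \<open>In the limit formula for \<open>Digamma\<close> the term \<open>ln N\<close> may be
  replaced by \<open>ln (norm (vline (m + N) y))\<close>, which telescopes. The summands become the
  errors of replacing the integral of \<open>1 / w\<close> over a unit step by its value at the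
  right end; they are small enough for domination.\<close>

lemma psi_term_sums:
  assumes "m \<ge> 1"
  shows "(\<lambda>n. psi_term m n y) sums psi_part m y"
proof -
  have nz: "vline m y + 1 \<noteq> 0" by (simp add: complex_eq_iff)
  have l1: "(\<lambda>N. Re (of_real (ln (real N)) - (\<Sum>n<N. inverse (vline m y + 1 + of_nat n)))) \<longlonglongrightarrow>
      Re (Digamma (vline m y + 1))"
    by (intro tendsto_Re Digamma_LIMSEQ nz)
  have l2: "(\<lambda>N. ln (norm (vline (m + N) y)) - ln (real N)) \<longlonglongrightarrow> 0"
  proof -
    define c where "c = real m"
    have "(\<lambda>N. ln (sqrt ((c + real N)\<^sup>2 + y\<^sup>2)) - ln (real N)) \<longlonglongrightarrow> 0" by real_asymp
    thus ?thesis by (simp add: cmod_def c_def)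
  qed
  have "(\<lambda>N. Re (of_real (ln (real N)) - (\<Sum>n<N. inverse (vline m y + 1 + of_nat n))) +
       (ln (norm (vline (m + N) y)) - ln (real N)) - ln (norm (vline m y))) \<longlonglongrightarrow>
       Re (Digamma (vline m y + 1)) + 0 - ln (norm (vline m y))"
    by (rule tendsto_diff[OF tendsto_add[OF l1 l2] tendsto_const])
  also have "(\<lambda>N. Re (of_real (ln (real N)) - (\<Sum>n<N. inverse (vline m y + 1 + of_nat n))) +
       (ln (norm (vline (m + N) y)) - ln (real N)) - ln (norm (vline m y))) =
     (\<lambda>N. \<Sum>n<N. psi_term m n y)"
  proof
    fix N
    have "vline m y + 1 + of_nat n = vline (m + Suc n) y" for n by (simp add: vline_eq)
    moreover have "(\<Sum>n<N. psi_term m n y) =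
       (\<Sum>n<N. ln (norm (vline (m + Suc n) y)) - ln (norm (vline (m + n) y))) - (\<Sum>n<N. Re (inverse (vline (m + Suc n) y)))"
      unfolding psi_term_def inverse_eq_divide by (rule sum_subtractf)
    moreover have "(\<Sum>n<N. ln (norm (vline (m + Suc n) y)) - ln (norm (vline (m + n) y))) =
        ln (norm (vline (m + N) y)) - ln (norm (vline m y))"
      using sum_lessThan_telescope[of "\<lambda>n. ln (norm (vline (m + n) y))" N] by simp
    ultimately show "Re (of_real (ln (real N)) - (\<Sum>n<N. inverse (vline m y + 1 + of_nat n))) +
       (ln (norm (vline (m + N) y)) - ln (real N)) - ln (norm (vline m y)) = (\<Sum>n<N. psi_term m n y)"
      by (simp add: Re_sum)
  qed
  finally show ?thesis by (simp add: sums_def psi_part_def)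
qed

lemma psi_part_tendsto_at_top:
  assumes "m \<ge> 1"
  shows "(psi_part m \<longlongrightarrow> 0) at_top"
proof -
  have "((\<lambda>y. \<Sum>n. psi_term m n y) \<longlongrightarrow> (\<Sum>n. 0)) at_top"
  proof (rule dominated_series_tendsto(1))
    show "(psi_term m n \<longlongrightarrow> 0) at_top" for n
    proof (rule Lim_null_comparison)
      define c where "c = real (m + n)"
      have "((\<lambda>y. 2 / (c\<^sup>2 + y\<^sup>2)) \<longlongrightarrow> 0) at_top" by real_asymp
      thus "((\<lambda>y. 2 / (real (m + n) ^ 2 + y\<^sup>2)) \<longlongrightarrow> 0) at_top" by (simp add: c_def)
      show "eventually (\<lambda>y. norm (psi_term m n y) \<le> 2 / (real (m + n) ^ 2 + y\<^sup>2)) at_top"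
        using psi_term_bound[OF assms] by (intro always_eventually) simp
    qed
    show "eventually (\<lambda>y. \<forall>n. norm (psi_term m n y) \<le> 2 * (1 / real (Suc n) ^ 2)) at_top"
    proof (intro always_eventually allI)
      fix y n
      have "norm (psi_term m n y) \<le> 2 / (real (m + n) ^ 2 + y\<^sup>2)" using psi_term_bound[OF assms] by simp
      also have "\<dots> \<le> 2 / (real (Suc n) ^ 2 + 0)"
        using assms by (intro divide_left_mono add_mono power_mono mult_pos_pos add_pos_nonneg) auto
      finally show "norm (psi_term m n y) \<le> 2 * (1 / real (Suc n) ^ 2)" by simp
    qed
    show "summable (\<lambda>n. 2 * (1 / real (Suc n) ^ 2))"
      by (intro summable_mult sums_summable[OF sums_inverse_Suc_squares])
  qed simp
  moreover have "(\<Sum>n. psi_term m n y) = psi_part m y" for y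
    using psi_term_sums[OF assms, of y] by (simp add: sums_iff)
  ultimately show ?thesis by simp
qed

lemma filterlim_vline: "filterlim (vline m) at_infinity at_top"
proof (rule filterlim_norm_at_top_imp_at_infinity, rule filterlim_at_top_mono)
  show "eventually (\<lambda>y. y \<le> norm (vline m y)) at_top"
    using norm_vline_ge_Im[of _ m] abs_ge_self order_trans by (intro always_eventually) blast
qed (rule filterlim_ident)

lemma ln_norm_diff_tendsto_0:
  assumes "m \<ge> 1"
  shows "((\<lambda>y. ln (norm (vline m y - z)) - ln (norm (vline m y))) \<longlongrightarrow> 0) at_top"
proof -
  have "((\<lambda>y. ln (norm (1 - z / vline m y))) \<longlongrightarrow> ln (norm (1 - 0 :: complex))) at_top"
    by (intro tendsto_ln tendsto_norm tendsto_diff tendsto_const tendsto_divide_0 filterlim_vline) auto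
  moreover have "eventually (\<lambda>y. ln (norm (1 - z / vline m y)) = ln (norm (vline m y - z)) - ln (norm (vline m y))) at_top"
    using eventually_gt_at_top[of "norm z"]
  proof eventually_elim
    case (elim y)
    have w: "vline m y \<noteq> 0" by (rule vline_nonzero[OF assms])
    have "vline m y \<noteq> z" using elim norm_vline_ge_Im[of y m] by auto
    moreover have "1 - z / vline m y = (vline m y - z) / vline m y" using w by (simp add: diff_divide_distrib)
    ultimately show ?case using w by (simp add: norm_divide ln_div)
  qed
  ultimately show ?thesis by (simp add: tendsto_cong)
qed

lemma pole_sum_tendsto_at_top:
  assumes "m \<ge> 1"
  shows "(pole_sum m \<longlongrightarrow> 0) at_top"
proof -
  have 1: "((\<lambda>y. Re (1 / vline m y)) \<longlongrightarrow> Re 0) at_top"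
    by (intro tendsto_Re tendsto_divide_0[OF tendsto_const] filterlim_vline)
  have 2: "((\<lambda>y. Re (1 / (2 * of_real pi * (vline m y)\<^sup>2))) \<longlongrightarrow> Re 0) at_top"
  proof -
    have "((\<lambda>y. 1 / (2 * of_real pi) * (1 / vline m y * (1 / vline m y))) \<longlongrightarrow> 1 / (2 * of_real pi) * (0 * 0)) at_top"
      by (intro tendsto_mult tendsto_const tendsto_divide_0[OF tendsto_const] filterlim_vline)
    from tendsto_Re[OF this] show ?thesis by (simp add: power2_eq_square)
  qed
  have 3: "(pole_part m \<longlongrightarrow> (\<Sum>k. 0)) at_top"
    unfolding pole_part_def [abs_def]
  proof (rule dominated_series_tendsto(1))
    have bd: "\<bar>pole_term m k y\<bar> \<le> 2 / y" if "y > 0" for k y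
      using pole_term_bound[of y m y k] that abs_Im_le_cmod[of "vline m y - of_nat k"]
        abs_Im_le_cmod[of "vline m y + of_nat k"] by simp
    show "((\<lambda>y. BE_weight k * pole_term m k y) \<longlongrightarrow> 0) at_top" for k
    proof (rule tendsto_mult_right_zero, rule Lim_null_comparison)
      show "((\<lambda>y::real. 2 / y) \<longlongrightarrow> 0) at_top" by real_asymp
      show "eventually (\<lambda>y. norm (pole_term m k y) \<le> 2 / y) at_top"
        using eventually_gt_at_top[of 0] by eventually_elim (use bd in simp)
    qed
    show "eventually (\<lambda>y. \<forall>k. norm (BE_weight k * pole_term m k y) \<le> BE_weight k * 2) at_top"
      using eventually_ge_at_top[of 1]
    proof (eventually_elim, intro allI)
      fix y k assume "1 \<le> (y::real)"
      hence "2 / y \<le> 2" by (simp add: field_simps)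
      with bd[of y k] \<open>1 \<le> y\<close> have "\<bar>pole_term m k y\<bar> \<le> 2" by linarith
      thus "norm (BE_weight k * pole_term m k y) \<le> BE_weight k * 2"
        using BE_weight_nonneg[of k] by (simp add: abs_mult mult_left_mono)
    qed
    show "summable (\<lambda>k. BE_weight k * 2)" by (intro summable_mult2 summable_BE_weight)
  qed simp
  have 4: "(log_part m \<longlongrightarrow> (\<Sum>k. 0)) at_top"
    unfolding log_part_def [abs_def]
  proof (rule dominated_series_tendsto(1))
    show "((\<lambda>y. sinh_weight k * log_term m k y) \<longlongrightarrow> 0) at_top" for k
    proof (rule tendsto_mult_right_zero)
      have "((\<lambda>y. (ln (norm (vline m y - of_nat k)) - ln (norm (vline m y))) +
         (ln (norm (vline m y - (- of_nat k))) - ln (norm (vline m y))) +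
         (ln (norm (vline m y - \<i> * of_nat k)) - ln (norm (vline m y))) +
         (ln (norm (vline m y - (- (\<i> * of_nat k)))) - ln (norm (vline m y)))) \<longlongrightarrow> 0 + 0 + 0 + 0) at_top"
        by (intro tendsto_add ln_norm_diff_tendsto_0 assms)
      thus "(log_term m k \<longlongrightarrow> 0) at_top"
        unfolding log_term_def [abs_def] by (simp add: algebra_simps)
    qed
    show "eventually (\<lambda>y. \<forall>k. norm (sinh_weight k * log_term m k y) \<le> sinh_weight k * real k * 4) at_top"
      using eventually_ge_at_top[of 1]
    proof (eventually_elim, intro allI)
      fix y k assume "1 \<le> (y::real)"
      hence "\<bar>log_term m k y\<bar> \<le> 4 * real k"
        using norm_vline_ge(1)[OF assms, of y k] by (intro log_term_bound assms) linarith
      from mult_left_mono[OF this sinh_weight_nonneg[of k]]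
      show "norm (sinh_weight k * log_term m k y) \<le> sinh_weight k * real k * 4"
        using sinh_weight_nonneg[of k] by (simp add: abs_mult mult_ac)
    qed
    show "summable (\<lambda>k. sinh_weight k * real k * 4)" by (intro summable_mult2 summable_sinh_weight_mult)
  qed simp
  have "(pole_sum m \<longlongrightarrow> Re 0 - Re 0 - 2 * 0 + (\<Sum>k::nat. 0) - (\<Sum>k::nat. 0)) at_top"
    unfolding pole_sum_def [abs_def]
    by (intro tendsto_add tendsto_diff tendsto_mult tendsto_const 1 2 3 4 psi_part_tendsto_at_top assms)
  thus ?thesis by simp
qed

text \<open>The difference of the two sides has the derivative of \<open>\<kappa> * ln |w|\<close>,
  so it equals this up to a constant. It tends to 0 while \<open>ln |w|\<close> is unbounded, which
  forces \<open>\<kappa> = 0\<close> and then a zero constant. The first claim evaluates the sum of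
  \<open>1 / sinh^2 (pi * k)\<close> as a by-product.\<close>

lemma pole_sum_eq_corner_sum:
  assumes "m \<ge> 1"
  shows "4 * suminf sinh_weight = 2 * pi / 3 - 2" and "y > 0 \<Longrightarrow> pole_sum m y = corner_sum m y"
proof -
  define \<kappa> where "\<kappa> = 2 - 2 * pi / 3 + 4 * suminf sinh_weight"
  define f where "f y = pole_sum m y - corner_sum m y - \<kappa> * ln (norm (vline m y))" for y
  have "(f has_real_derivative 0) (at y within {0<..})" if "y > 0" for y
    unfolding f_def [abs_def]
    by (rule has_field_derivative_at_within, rule DERIV_cong[OF DERIV_diff[OF
        DERIV_diff[OF pole_sum_deriv[OF assms that] corner_sum_deriv[OF assms that]]
        DERIV_cmult[OF ln_norm_vline_deriv[OF assms]]]]) (simp add: \<kappa>_def)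
  then obtain c where c: "\<And>y. y > 0 \<Longrightarrow> f y = c"
    using has_field_derivative_zero_constant[of "{0::real<..}" f] by auto
  have diff0: "((\<lambda>y. pole_sum m y - corner_sum m y) \<longlongrightarrow> 0) at_top"
    using tendsto_diff[OF pole_sum_tendsto_at_top[OF assms] corner_sum_tendsto_at_top[OF assms]] by simp
  have "\<kappa> = 0"
  proof (rule ccontr)
    assume "\<kappa> \<noteq> 0"
    have "((\<lambda>y. (pole_sum m y - corner_sum m y - c) / \<kappa>) \<longlongrightarrow> (0 - c) / \<kappa>) at_top"
      by (intro tendsto_divide tendsto_diff[OF diff0] tendsto_const \<open>\<kappa> \<noteq> 0\<close>)
    moreover have "eventually (\<lambda>y. (pole_sum m y - corner_sum m y - c) / \<kappa> = ln (norm (vline m y))) at_top"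
      using eventually_gt_at_top[of 0]
      by eventually_elim (use c \<open>\<kappa> \<noteq> 0\<close> in \<open>auto simp: f_def field_simps\<close>)
    ultimately have lim: "((\<lambda>y. ln (norm (vline m y))) \<longlongrightarrow> (0 - c) / \<kappa>) at_top"
      by (simp add: tendsto_cong)
    have "filterlim (\<lambda>y. ln (norm (vline m y))) at_infinity at_top"
      using filterlim_compose[OF ln_at_top filterlim_at_infinity_imp_norm_at_top[OF filterlim_vline]]
      by (rule filterlim_at_top_imp_at_infinity)
    from not_tendsto_and_filterlim_at_infinity[OF _ lim this] show False by simp
  qed
  thus "4 * suminf sinh_weight = 2 * pi / 3 - 2" by (simp add: \<kappa>_def)
  have fc: "pole_sum m y - corner_sum m y = c" if "y > 0" for y
    using c[OF that] \<open>\<kappa> = 0\<close> by (simp add: f_def)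
  have "((\<lambda>y::real. c) \<longlongrightarrow> 0) at_top"
    using diff0 by (rule Lim_transform_eventually)
      (rule eventually_mono[OF eventually_gt_at_top[of 0]], rule fc)
  hence "c = 0" by (simp add: tendsto_const_iff)
  thus "pole_sum m y = corner_sum m y" if "y > 0" using fc[OF that] by simp
qed


section \<open>Comparison at the end point\<close>

lemma suminf_split_off:
  fixes f :: "nat \<Rightarrow> real"
  assumes "summable f"
  shows "suminf f = (\<Sum>k. if k = m then 0 else f k) + f m"
proof -
  have "(\<lambda>k. f k - (if k = m then f k else 0)) sums (suminf f - f m)"
    by (intro sums_diff summable_sums assms sums_single)
  moreover have "(\<lambda>k. f k - (if k = m then f k else 0)) = (\<lambda>k. if k = m then 0 else f k)" by auto
  ultimately show ?thesis by (simp add: sums_iff)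
qed

lemma vline_tendsto: "(vline m \<longlongrightarrow> of_nat m) (at_right 0)"
proof -
  have "((\<lambda>y. of_nat m + \<i> * of_real y) \<longlongrightarrow> of_nat m + \<i> * of_real 0) (at_right 0)"
    by (intro tendsto_intros)
  thus ?thesis by (simp add: vline_eq [abs_def])
qed

lemma vline_0: "vline m 0 = of_nat m"
  by (simp add: vline_eq)

lemma pole_term_at_0: "pole_term m k 0 = 2 * real k / (real k ^ 2 - real m ^ 2)"
proof -
  have "2 * of_nat k / (of_nat k ^ 2 - of_nat m ^ 2) = complex_of_real (2 * real k / (real k ^ 2 - real m ^ 2))"
    by simp
  thus ?thesis unfolding pole_term_def vline_0 by (metis Re_complex_of_real)
qed

lemma log_term_at_0:
  assumes "m \<ge> 1" "k \<noteq> m"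
  shows "log_term m k 0 = ln \<bar>real k ^ 4 - real m ^ 4\<bar> - 4 * ln (real m)"
proof -
  define w :: complex where "w = of_nat m"
  define a :: complex where "a = of_nat k"
  note ge = norm_vline_ge[OF assms(1), of 0 k] norm_vline_diff_ge_1[OF assms(2), of 0]
  have pos: "norm (w - a) > 0" "norm (w - (- a)) > 0" "norm (w - \<i> * a) > 0" "norm (w - (- (\<i> * a))) > 0"
    using ge unfolding vline_0 w_def a_def by linarith+
  have "ln (norm (w - a)) + ln (norm (w - (- a))) + ln (norm (w - \<i> * a)) + ln (norm (w - (- (\<i> * a)))) =
      ln (norm (w - a) * norm (w - (- a)) * norm (w - \<i> * a) * norm (w - (- (\<i> * a))))"
    using pos by (simp add: ln_mult)
  also have "norm (w - a) * norm (w - (- a)) * norm (w - \<i> * a) * norm (w - (- (\<i> * a))) =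
      norm ((w - a) * (w - (- a)) * (w - \<i> * a) * (w - (- (\<i> * a))))"
    by (simp only: norm_mult)
  also have "(w - a) * (w - (- a)) * (w - \<i> * a) * (w - (- (\<i> * a))) = w ^ 4 - a ^ 4"
    by (simp add: algebra_simps power4_eq_xxxx)
  also have "w ^ 4 - a ^ 4 = of_real (real m ^ 4 - real k ^ 4)" by (simp add: w_def a_def)
  also have "norm \<dots> = \<bar>real k ^ 4 - real m ^ 4\<bar>" by (simp only: norm_of_real abs_minus_commute)
  finally show ?thesis unfolding log_term_def vline_0 w_def a_def by simp
qed

lemma pole_term_tendsto:
  assumes "m \<noteq> k"
  shows "(pole_term m k \<longlongrightarrow> pole_term m k 0) (at_right 0)"
proof -
  have "real k ^ 2 \<noteq> real m ^ 2" using assms by (simp add: power2_eq_iff)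
  hence "of_nat k ^ 2 - (of_nat m :: complex) ^ 2 \<noteq> 0"
    by (metis eq_iff_diff_eq_0 of_nat_eq_iff of_nat_power)
  thus ?thesis unfolding pole_term_def [abs_def] vline_0
    by (intro tendsto_intros vline_tendsto) auto
qed

lemma log_term_tendsto:
  assumes "m \<ge> 1" "m \<noteq> k"
  shows "(log_term m k \<longlongrightarrow> log_term m k 0) (at_right 0)"
  using assms unfolding log_term_def [abs_def] vline_0
  by (intro tendsto_intros vline_tendsto) (auto simp: complex_eq_iff)

text \<open>Here \<open>2 * m / (m^2 - w^2) = 1 / (w + m) - 1 / (w - m)\<close>, and
  \<open>w - m = \<i> * y\<close> makes the singular part imaginary. The surviving
  \<open>1 / (2 * m)\<close> is the origin of the term with
  \<open>2 * m * (exp (2 * pi * m) - 1)\<close> in the denominator.\<close>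

lemma pole_term_diag_tendsto:
  assumes "m \<ge> 1"
  shows "(pole_term m m \<longlongrightarrow> 1 / (2 * real m)) (at_right 0)"
proof -
  define c where "c = real m"
  have c: "c > 0" using assms by (simp add: c_def)
  have "((\<lambda>y. 2 * c / (y\<^sup>2 + 4 * c\<^sup>2)) \<longlongrightarrow> 2 * c / (0\<^sup>2 + 4 * c\<^sup>2)) (at_right 0)"
    using c by (intro tendsto_intros) auto
  hence lim: "((\<lambda>y. 2 * c / (y\<^sup>2 + 4 * c\<^sup>2)) \<longlongrightarrow> 1 / (2 * real m)) (at_right 0)"
    using c by (simp add: c_def power2_eq_square)
  have ev: "eventually (\<lambda>y. pole_term m m y = 2 * c / (y\<^sup>2 + 4 * c\<^sup>2)) (at_right 0)"
    using eventually_at_right_less[of "0::real"]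
  proof eventually_elim
    case (elim y)
    have "of_nat m ^ 2 - (vline m y)\<^sup>2 = Complex (y\<^sup>2) (- (2 * c * y))"
      by (simp add: complex_eq_iff c_def power2_eq_square)
    moreover have "2 * of_nat m = Complex (2 * c) 0" by (simp add: complex_eq_iff c_def)
    ultimately have "pole_term m m y = 2 * c * y\<^sup>2 / ((y\<^sup>2)\<^sup>2 + (2 * c * y)\<^sup>2)"
      by (simp add: pole_term_def Re_divide)
    also have "(y\<^sup>2)\<^sup>2 + (2 * c * y)\<^sup>2 = (y\<^sup>2 + 4 * c\<^sup>2) * y\<^sup>2"
      by (simp add: power2_eq_square algebra_simps)
    also have "2 * c * y\<^sup>2 / ((y\<^sup>2 + 4 * c\<^sup>2) * y\<^sup>2) = 2 * c / (y\<^sup>2 + 4 * c\<^sup>2)"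
      using elim by simp
    finally show ?case .
  qed
  show ?thesis using lim unfolding tendsto_cong[OF ev] .
qed

text \<open>The factor \<open>w - m\<close> has norm exactly \<open>y\<close>. The other three have
  at \<open>w = m\<close> the product \<open>2 * m * (m^2 + m^2) = 4 * m^3\<close>.\<close>

lemma log_term_diag_tendsto:
  assumes "m \<ge> 1"
  shows "((\<lambda>y. log_term m m y - ln y) \<longlongrightarrow> ln (4 * real m ^ 3) - 4 * ln (real m)) (at_right 0)"
proof -
  define w :: complex where "w = of_nat m"
  have "((\<lambda>y. ln (norm (vline m y - (- w))) + ln (norm (vline m y - \<i> * w)) +
       ln (norm (vline m y - (- (\<i> * w)))) - 4 * ln (norm (vline m y))) \<longlongrightarrow>
       ln (norm (w - (- w))) + ln (norm (w - \<i> * w)) + ln (norm (w - (- (\<i> * w)))) - 4 * ln (norm w)) (at_right 0)"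
    using assms unfolding w_def
    by (intro tendsto_intros vline_tendsto) (auto simp: complex_eq_iff)
  also have "ln (norm (w - (- w))) + ln (norm (w - \<i> * w)) + ln (norm (w - (- (\<i> * w)))) - 4 * ln (norm w) =
     ln (4 * real m ^ 3) - 4 * ln (real m)"
  proof -
    have "ln (norm (w - (- w))) + ln (norm (w - \<i> * w)) + ln (norm (w - (- (\<i> * w)))) =
       ln (norm (w - (- w)) * norm (w - \<i> * w) * norm (w - (- (\<i> * w))))"
      using assms by (subst ln_mult, simp_all add: w_def complex_eq_iff)+
    also have "norm (w - (- w)) * norm (w - \<i> * w) * norm (w - (- (\<i> * w))) =
       norm ((w - (- w)) * (w - \<i> * w) * (w - (- (\<i> * w))))" by (simp only: norm_mult)
    also have "(w - (- w)) * (w - \<i> * w) * (w - (- (\<i> * w))) = of_real (4 * real m ^ 3)"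
      by (simp add: w_def algebra_simps power3_eq_cube)
    also have "norm \<dots> = 4 * real m ^ 3" by (simp only: norm_of_real) simp
    finally show ?thesis by (simp add: w_def)
  qed
  finally have lim: "((\<lambda>y. ln (norm (vline m y - (- w))) + ln (norm (vline m y - \<i> * w)) +
       ln (norm (vline m y - (- (\<i> * w)))) - 4 * ln (norm (vline m y))) \<longlongrightarrow>
       ln (4 * real m ^ 3) - 4 * ln (real m)) (at_right 0)" .
  have ev: "eventually (\<lambda>y. log_term m m y - ln y = ln (norm (vline m y - (- w))) + ln (norm (vline m y - \<i> * w)) +
       ln (norm (vline m y - (- (\<i> * w)))) - 4 * ln (norm (vline m y))) (at_right 0)"
    using eventually_at_right_less[of "0::real"]
  proof eventually_elim
    case (elim y)
    have "norm (vline m y - of_nat m) = y" using elim by (simp add: vline_eq norm_mult)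
    thus ?case by (simp add: log_term_def w_def)
  qed
  show ?thesis using lim unfolding tendsto_cong[OF ev] .
qed

text \<open>For \<open>k \<noteq> m\<close> the line keeps distance at least 1 from
  \<open>k\<close>, also at \<open>y = 0\<close>. The same bound therefore dominates the passage to
  the limit and shows that the limit series converges.\<close>

lemma BE_pole_bound:
  assumes "m \<ge> 1"
  shows "norm (if k = m then 0 else BE_weight k * pole_term m k y) \<le> BE_weight k * 2"
proof (cases "k = m")
  case False
  have "\<bar>pole_term m k y\<bar> \<le> 2"
    using pole_term_bound[of 1 m y k] norm_vline_diff_ge_1[OF False, of y] norm_vline_ge(2)[OF assms, of y k]
    by simp
  thus ?thesis using BE_weight_nonneg[of k] False by (simp add: abs_mult mult_left_mono)
qed (simp add: BE_weight_nonneg)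

lemma sinh_log_bound:
  assumes "m \<ge> 1"
  shows "norm (if k = m then 0 else sinh_weight k * log_term m k y) \<le> sinh_weight k * real k * 4"
proof (cases "k = m")
  case False
  have "\<bar>log_term m k y\<bar> \<le> 4 * real k"
    using False by (intro log_term_bound norm_vline_diff_ge_1 assms)
  from mult_left_mono[OF this sinh_weight_nonneg[of k]] show ?thesis
    using sinh_weight_nonneg[of k] False by (simp add: abs_mult mult_ac)
qed (simp add: sinh_weight_nonneg)

lemma pole_part_tendsto_0:
  assumes "m \<ge> 1"
  shows "(pole_part m \<longlongrightarrow> (\<Sum>k. if k = m then 0 else BE_weight k * pole_term m k 0)
            + BE_weight m * (1 / (2 * real m))) (at_right 0)"
proof -
  have "((\<lambda>y. \<Sum>k. if k = m then 0 else BE_weight k * pole_term m k y) \<longlongrightarrow>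
      (\<Sum>k. if k = m then 0 else BE_weight k * pole_term m k 0)) (at_right 0)"
  proof (rule dominated_series_tendsto(1))
    show "((\<lambda>y. if k = m then 0 else BE_weight k * pole_term m k y) \<longlongrightarrow>
        (if k = m then 0 else BE_weight k * pole_term m k 0)) (at_right 0)" for k
      using tendsto_mult_left[OF pole_term_tendsto[of m k], of "BE_weight k"] by auto
    show "eventually (\<lambda>y. \<forall>k. norm (if k = m then 0 else BE_weight k * pole_term m k y) \<le> BE_weight k * 2) (at_right 0)"
      by (intro always_eventually allI BE_pole_bound assms)
    show "summable (\<lambda>k. BE_weight k * 2)" by (intro summable_mult2 summable_BE_weight)
  qed simp
  from tendsto_add[OF this tendsto_mult_left[OF pole_term_diag_tendsto[OF assms]]]
  have lim: "((\<lambda>y. (\<Sum>k. if k = m then 0 else BE_weight k * pole_term m k y) + BE_weight m * pole_term m m y) \<longlongrightarrow>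
     (\<Sum>k. if k = m then 0 else BE_weight k * pole_term m k 0) + BE_weight m * (1 / (2 * real m))) (at_right 0)" .
  have ev: "eventually (\<lambda>y. pole_part m y =
     (\<Sum>k. if k = m then 0 else BE_weight k * pole_term m k y) + BE_weight m * pole_term m m y) (at_right 0)"
    using eventually_at_right_less[of "0::real"]
    by eventually_elim (simp only: pole_part_def suminf_split_off[OF summable_pole_part[OF assms], of _ m])
  show ?thesis using lim unfolding tendsto_cong[OF ev] .
qed

lemma log_part_tendsto_0:
  assumes "m \<ge> 1"
  shows "((\<lambda>y. log_part m y - sinh_weight m * ln y) \<longlongrightarrow>
     (\<Sum>k. if k = m then 0 else sinh_weight k * log_term m k 0)
            + sinh_weight m * (ln (4 * real m ^ 3) - 4 * ln (real m))) (at_right 0)"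
proof -
  have "((\<lambda>y. \<Sum>k. if k = m then 0 else sinh_weight k * log_term m k y) \<longlongrightarrow>
      (\<Sum>k. if k = m then 0 else sinh_weight k * log_term m k 0)) (at_right 0)"
  proof (rule dominated_series_tendsto(1))
    show "((\<lambda>y. if k = m then 0 else sinh_weight k * log_term m k y) \<longlongrightarrow>
        (if k = m then 0 else sinh_weight k * log_term m k 0)) (at_right 0)" for k
      using tendsto_mult_left[OF log_term_tendsto[of m k], of "sinh_weight k"] assms by auto
    show "eventually (\<lambda>y. \<forall>k. norm (if k = m then 0 else sinh_weight k * log_term m k y) \<le>
        sinh_weight k * real k * 4) (at_right 0)"
      by (intro always_eventually allI sinh_log_bound assms)
    show "summable (\<lambda>k. sinh_weight k * real k * 4)" by (intro summable_mult2 summable_sinh_weight_mult)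
  qed simp
  from tendsto_add[OF this tendsto_mult_left[OF log_term_diag_tendsto[OF assms]]]
  have lim: "((\<lambda>y. (\<Sum>k. if k = m then 0 else sinh_weight k * log_term m k y) + sinh_weight m * (log_term m m y - ln y)) \<longlongrightarrow>
     (\<Sum>k. if k = m then 0 else sinh_weight k * log_term m k 0)
            + sinh_weight m * (ln (4 * real m ^ 3) - 4 * ln (real m))) (at_right 0)" .
  have ev: "eventually (\<lambda>y. log_part m y - sinh_weight m * ln y =
     (\<Sum>k. if k = m then 0 else sinh_weight k * log_term m k y) + sinh_weight m * (log_term m m y - ln y)) (at_right 0)"
    using eventually_at_right_less[of "0::real"]
  proof eventually_elim
    case (elim y)
    show ?case unfolding log_part_def suminf_split_off[OF summable_log_part[OF assms elim], of m]
      by (simp add: right_diff_distrib)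
  qed
  show ?thesis using lim unfolding tendsto_cong[OF ev] .
qed

lemma pole_sum_tendsto_0:
  assumes "m \<ge> 1"
  shows "((\<lambda>y. pole_sum m y + sinh_weight m * ln y) \<longlongrightarrow>
     1 / real m - 1 / (2 * pi * real m ^ 2) - 2 * (harm m - euler_mascheroni - ln (real m))
     + ((\<Sum>k. if k = m then 0 else BE_weight k * pole_term m k 0) + BE_weight m * (1 / (2 * real m)))
     - ((\<Sum>k. if k = m then 0 else sinh_weight k * log_term m k 0)
            + sinh_weight m * (ln (4 * real m ^ 3) - 4 * ln (real m)))) (at_right 0)"
proof -
  have 1: "((\<lambda>y. Re (1 / vline m y)) \<longlongrightarrow> 1 / real m) (at_right 0)"
  proof -
    have "((\<lambda>y. Re (1 / vline m y)) \<longlongrightarrow> Re (1 / of_nat m)) (at_right 0)"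
      using assms by (intro tendsto_intros vline_tendsto) auto
    moreover have "Re (1 / of_nat m) = 1 / real m"
      by (metis Re_complex_of_real of_real_1 of_real_divide of_real_of_nat_eq)
    ultimately show ?thesis by simp
  qed
  have 2: "((\<lambda>y. Re (1 / (2 * of_real pi * (vline m y)\<^sup>2))) \<longlongrightarrow> 1 / (2 * pi * real m ^ 2)) (at_right 0)"
  proof -
    have "((\<lambda>y. Re (1 / (2 * of_real pi * (vline m y)\<^sup>2))) \<longlongrightarrow> Re (1 / (2 * of_real pi * of_nat m ^ 2))) (at_right 0)"
      using assms by (intro tendsto_intros vline_tendsto) auto
    moreover have "1 / (2 * of_real pi * of_nat m ^ 2) = complex_of_real (1 / (2 * pi * real m ^ 2))" by simp
    ultimately show ?thesis by (metis Re_complex_of_real)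
  qed
  \<comment> \<open>Continuity of \<open>Digamma\<close> at \<open>m + 1\<close>, where its value is
    the harmonic number minus Euler's constant.\<close>
  have 3: "(psi_part m \<longlongrightarrow> harm m - euler_mascheroni - ln (real m)) (at_right 0)"
  proof -
    have n: "of_nat m + 1 \<notin> (\<int>\<^sub>\<le>\<^sub>0 :: complex set)"
      by (auto elim!: nonpos_Ints_cases simp: complex_eq_iff)
    have "((\<lambda>y. Re (Digamma (vline m y + 1)) - ln (norm (vline m y))) \<longlongrightarrow>
        Re (Digamma (of_nat m + 1)) - ln (norm (of_nat m :: complex))) (at_right 0)"
      using assms n by (intro tendsto_intros vline_tendsto isCont_tendsto_compose[OF isCont_Polygamma]) auto
    moreover have "Re (Digamma (of_nat m + 1)) = harm m - euler_mascheroni"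
    proof -
      have "Digamma (of_nat m + 1 :: complex) = of_real (Digamma (1 + real m))"
        using Polygamma_of_real[of "1 + real m" 0, where 'a = complex] by (simp add: add.commute)
      also have "Digamma (1 + real m) = harm m - euler_mascheroni"
        using Digamma_of_nat[of m, where 'a = real] by (simp add: add.commute)
      finally show ?thesis by (simp only: Re_complex_of_real)
    qed
    ultimately show ?thesis by (simp add: psi_part_def [abs_def])
  qed
  have "((\<lambda>y. Re (1 / vline m y) - Re (1 / (2 * of_real pi * (vline m y)\<^sup>2)) - 2 * psi_part m y
     + pole_part m y - (log_part m y - sinh_weight m * ln y)) \<longlongrightarrow>
     1 / real m - 1 / (2 * pi * real m ^ 2) - 2 * (harm m - euler_mascheroni - ln (real m))
     + ((\<Sum>k. if k = m then 0 else BE_weight k * pole_term m k 0) + BE_weight m * (1 / (2 * real m)))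
     - ((\<Sum>k. if k = m then 0 else sinh_weight k * log_term m k 0)
            + sinh_weight m * (ln (4 * real m ^ 3) - 4 * ln (real m)))) (at_right 0)"
    by (intro tendsto_add tendsto_diff tendsto_mult_left 1 2 3
        pole_part_tendsto_0[OF assms] log_part_tendsto_0[OF assms])
  thus ?thesis by (simp add: pole_sum_def [abs_def] algebra_simps)
qed

text \<open>Both antiderivatives are regularised with the same coefficient
  \<open>sinh_weight m\<close>, one by \<open>ln y\<close>, the other by
  \<open>ln (1 - exp (- 2 * pi * y))\<close>. The difference of these two logarithms tends to
  \<open>- ln (2 * pi)\<close>, so the two finite parts can be compared.\<close>

lemma harm_identity:
  assumes "m \<ge> 1"
  defines "F \<equiv> (\<Sum>j. exp (- 2 * pi * real j * real m) * (real j * corner_coeff j))"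
  shows "2 * (harm m - euler_mascheroni) = 2 * ln (real m) + 1 / real m - 1 / (2 * pi * real m ^ 2)
     + (\<Sum>k. if k = m then 0 else BE_weight k * pole_term m k 0) + BE_weight m * (1 / (2 * real m))
     - (\<Sum>k. if k = m then 0 else sinh_weight k * log_term m k 0)
     + sinh_weight m * (ln (2 * pi) - ln (4 * real m ^ 3) + 4 * ln (real m) - 1) + 4 * pi * F"
proof -
  have "((\<lambda>y. ln y - ln (1 - exp (- 2 * pi * y))) \<longlongrightarrow> - ln (2 * pi)) (at_right 0)"
    by real_asymp
  hence "((\<lambda>y. sinh_weight m * (ln y - ln (1 - exp (- 2 * pi * y)))) \<longlongrightarrow> sinh_weight m * (- ln (2 * pi))) (at_right 0)"
    by (rule tendsto_mult_left)
  moreover have "eventually (\<lambda>y. (pole_sum m y + sinh_weight m * ln y) -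
      (corner_sum m y + sinh_weight m * ln (1 - exp (- 2 * pi * y))) =
      sinh_weight m * (ln y - ln (1 - exp (- 2 * pi * y)))) (at_right 0)"
    using eventually_at_right_less[of "0::real"]
    by eventually_elim (simp add: pole_sum_eq_corner_sum(2)[OF assms(1)] right_diff_distrib)
  ultimately have "((\<lambda>y. (pole_sum m y + sinh_weight m * ln y) -
      (corner_sum m y + sinh_weight m * ln (1 - exp (- 2 * pi * y)))) \<longlongrightarrow> sinh_weight m * (- ln (2 * pi))) (at_right 0)"
    by (subst tendsto_cong)
  from tendsto_unique[OF _ this tendsto_diff[OF pole_sum_tendsto_0[OF assms(1)] corner_sum_asymptotics[OF assms(1)]]]
  show ?thesis by (simp add: F_def algebra_simps)
qed

text \<open>The summability claims ensure that every \<open>suminf\<close> denotes a convergent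
  series; the guards exclude the index 0 and the pole \<open>k = m\<close>. The proof halves
  \<open>harm_identity\<close> and removes the normalising logarithms.\<close>

theorem mainTheorem2:
  fixes m :: nat
  assumes "m \<ge> 1"
  shows
    "summable (\<lambda>k. if k = 0 \<or> k = m then 0
        else 2 * real k / ((exp (2 * pi * real k) - 1) * (real k ^ 2 - real m ^ 2))) \<and>
     summable (\<lambda>k. if k = 0 \<or> k = m then 0
        else ln \<bar>real k ^ 4 - real m ^ 4\<bar> / (sinh (pi * real k)) ^ 2) \<and>
     (\<forall>k\<ge>1. summable (\<lambda>n. if n = 0 then 0
        else real k ^ 2 / (real n * (real k ^ 2 + real n ^ 2)))) \<and>
     summable (\<lambda>k. if k = 0 then 0
        else real k * exp (- 2 * pi * real k * real m) *
          (\<Sum>n. if n = 0 then 0 else real k ^ 2 / (real n * (real k ^ 2 + real n ^ 2)))) \<and>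
     - euler_mascheroni + (\<Sum>j=1..m. 1 / real j) =
       pi / 3 * ln (real m) + 1 / (2 * real m) - 1 / (4 * pi * real m ^ 2)
       + (\<Sum>k. if k = 0 \<or> k = m then 0
            else 2 * real k / ((exp (2 * pi * real k) - 1) * (real k ^ 2 - real m ^ 2)))
       + pi / 2 * ((ln pi - ln (2 * real m ^ 3) - 1) / (sinh (pi * real m)) ^ 2)
       - pi / 2 * (\<Sum>k. if k = 0 \<or> k = m then 0
            else ln \<bar>real k ^ 4 - real m ^ 4\<bar> / (sinh (pi * real k)) ^ 2)
       + 1 / (2 * real m * (exp (2 * pi * real m) - 1))
       + 2 * pi * (\<Sum>k. if k = 0 then 0
            else real k * exp (- 2 * pi * real k * real m) *
              (\<Sum>n. if n = 0 then 0 else real k ^ 2 / (real n * (real k ^ 2 + real n ^ 2))))"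
proof -
  define f1 where "f1 k = (if k = 0 \<or> k = m then 0
    else 2 * real k / ((exp (2 * pi * real k) - 1) * (real k ^ 2 - real m ^ 2)))" for k
  define f2 where "f2 k = (if k = 0 \<or> k = m then 0
    else ln \<bar>real k ^ 4 - real m ^ 4\<bar> / (sinh (pi * real k)) ^ 2)" for k
  define f3 where "f3 k n = (if n = 0 then 0 else real k ^ 2 / (real n * (real k ^ 2 + real n ^ 2)))" for k n :: nat
  define f4 where "f4 k = (if k = 0 then 0 else real k * exp (- 2 * pi * real k * real m) * (\<Sum>n. f3 k n))" for k

  have f1_eq: "(if k = m then 0 else BE_weight k * pole_term m k 0) = 2 * f1 k" for k
    by (simp add: f1_def pole_term_at_0 BE_weight_def)
  have f1: "summable f1"
  proof -
    have "summable (\<lambda>k. if k = m then 0 else BE_weight k * pole_term m k 0)"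
      by (rule summable_comparison_test'[OF summable_mult2[OF summable_BE_weight] BE_pole_bound[OF assms]])
    thus ?thesis unfolding f1_eq by simp
  qed

  \<comment> \<open>Separates the normalisation \<open>4 * ln m\<close>, which multiplies only the
    weights, from the logarithms of the theorem.\<close>
  have f2_eq: "(if k = m then 0 else sinh_weight k * log_term m k 0) =
      pi * f2 k - (if k = m then 0 else sinh_weight k) * (4 * ln (real m))" for k
    using assms by (cases "k = m \<or> k = 0")
      (auto simp: f2_def weights_0 log_term_at_0 sinh_weight_def right_diff_distrib)
  have weights: "(\<lambda>k. if k = m then 0 else sinh_weight k) sums (suminf sinh_weight - sinh_weight m)"
  proof -
    have "summable (\<lambda>k. if k = m then 0 else sinh_weight k)"
      by (rule summable_comparison_test'[OF summable_sinh_weight]) (simp add: sinh_weight_nonneg)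
    thus ?thesis using suminf_split_off[OF summable_sinh_weight, of m] by (simp add: sums_iff)
  qed
  have log_sums: "summable (\<lambda>k. if k = m then 0 else sinh_weight k * log_term m k 0)"
    by (rule summable_comparison_test'[OF summable_mult2[OF summable_sinh_weight_mult] sinh_log_bound[OF assms]])
  have pi_f2: "(\<lambda>k. pi * f2 k) sums ((\<Sum>k. if k = m then 0 else sinh_weight k * log_term m k 0)
      + (suminf sinh_weight - sinh_weight m) * (4 * ln (real m)))"
    using sums_add[OF summable_sums[OF log_sums] sums_mult2[OF weights, of "4 * ln (real m)"]]
    unfolding f2_eq by simp
  have f2: "summable f2"
    using sums_summable[OF pi_f2] by (simp add: summable_cmult_iff)

  have f3_eq: "f3 k = (\<lambda>n. real k ^ 2 / (real n * (real k ^ 2 + real n ^ 2)))" for k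
    by (auto simp: f3_def)
  have f3: "summable (f3 k)" for k
    unfolding f3_eq by (rule summable_corner_coeff)
  have f4_eq: "f4 k = exp (- 2 * pi * real k * real m) * (real k * corner_coeff k)" for k
    by (simp add: f4_def f3_eq corner_coeff_def)
  have f4: "summable f4"
    using summable_corner_coeff_exp[OF assms] unfolding f4_eq [abs_def] .

  have "2 * (harm m - euler_mascheroni) = 2 * ln (real m) + 1 / real m - 1 / (2 * pi * real m ^ 2)
     + (\<Sum>k. 2 * f1 k) + BE_weight m * (1 / (2 * real m))
     - (\<Sum>k. if k = m then 0 else sinh_weight k * log_term m k 0)
     + sinh_weight m * (ln (2 * pi) - ln (4 * real m ^ 3) + 4 * ln (real m) - 1) + 4 * pi * suminf f4"
    using harm_identity[OF assms] unfolding f1_eq f4_eq [abs_def] .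
  moreover have "(\<Sum>k. 2 * f1 k) = 2 * suminf f1"
    using f1 by (rule suminf_mult)
  moreover have "(\<Sum>k. if k = m then 0 else sinh_weight k * log_term m k 0) =
      pi * suminf f2 - (suminf sinh_weight - sinh_weight m) * (4 * ln (real m))"
    using pi_f2 suminf_mult[OF f2, of pi] by (simp add: sums_iff)
  \<comment> \<open>The logarithms of \<open>m\<close> add up to
    \<open>(2 + 4 * suminf sinh_weight) * ln m\<close>, the omitted weight \<open>k = m\<close>
    being restored by the diagonal term; this value makes it
    \<open>2 * pi / 3 * ln m\<close>.\<close>
  moreover have "suminf sinh_weight = (2 * pi / 3 - 2) / 4"
    using pole_sum_eq_corner_sum(1)[OF assms] by simp
  ultimately have "2 * (harm m - euler_mascheroni) = 2 * (pi / 3 * ln (real m) + 1 / (2 * real m)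
     - 1 / (4 * pi * real m ^ 2) + suminf f1 + BE_weight m * (1 / (4 * real m))
     - pi / 2 * suminf f2 + sinh_weight m / 2 * (ln (2 * pi) - ln (4 * real m ^ 3) - 1)
     + 2 * pi * suminf f4)"
    by (simp add: field_simps)
  moreover have "BE_weight m * (1 / (4 * real m)) = 1 / (2 * real m * (exp (2 * pi * real m) - 1))"
    by (simp add: BE_weight_def)
  moreover have "sinh_weight m / 2 * (ln (2 * pi) - ln (4 * real m ^ 3) - 1) =
      pi / 2 * ((ln pi - ln (2 * real m ^ 3) - 1) / (sinh (pi * real m)) ^ 2)"
  proof -
    have "ln (2 * pi) - ln (4 * real m ^ 3) = ln (2 * pi / (4 * real m ^ 3))"
      using assms ln_div[of "2 * pi" "4 * real m ^ 3"] by simp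
    also have "2 * pi / (4 * real m ^ 3) = pi / (2 * real m ^ 3)" by simp
    also have "ln \<dots> = ln pi - ln (2 * real m ^ 3)" using assms ln_div[of pi "2 * real m ^ 3"] by simp
    finally show ?thesis by (simp add: sinh_weight_def)
  qed
  moreover have "harm m = (\<Sum>j=1..m. 1 / real j)"
    by (simp add: harm_def inverse_eq_divide)
  ultimately have "- euler_mascheroni + (\<Sum>j=1..m. 1 / real j) =
     pi / 3 * ln (real m) + 1 / (2 * real m) - 1 / (4 * pi * real m ^ 2) + suminf f1
     + pi / 2 * ((ln pi - ln (2 * real m ^ 3) - 1) / (sinh (pi * real m)) ^ 2)
     - pi / 2 * suminf f2 + 1 / (2 * real m * (exp (2 * pi * real m) - 1)) + 2 * pi * suminf f4"
    by simp
  with f1 f2 f3 f4 show ?thesis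
    unfolding f4_def [abs_def] f3_def [abs_def] f1_def [abs_def] f2_def [abs_def] by blast
qed

end
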